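(* Let $n\ge2$ and let the tensor $\mathbb A$ satisfy the relaxed ellipticity condition. (i) Let $s_1>-1+n/2$. If $(\mathbf u,p)\in\dot{\mathbf H}_{\#\sigma}^{s_1}\times\dot H_\#^{s_1-1}$ is a solution of the anisotropic Navier-Stokes equation $$-\boldsymbol{\mathfrak L}\mathbf u+\nabla p+(\mathbf u\cdot\nabla)\mathbf u=\mathbf f$$ with a right-hand side $\mathbf f\in\dot{\mathbf H}_\#^{s_2-2}$, where $s_2>s_1$, then $(\mathbf u,p)\in\dot{\mathbf H}_{\#\sigma}^{s_2}\times\dot H_\#^{s_2-1}$. (ii) Moreover, if $(\mathbf u,p)\in\dot{\mathbf H}_{\#\sigma}^{s_1}\times\dot H_\#^{s_1-1}$ with $s_1>-1+n/2$ is a solution of this equation and $\mathbf f\in\dot{\mathbf C}_\#^\infty$, then $(\mathbf u,p)\in\dot{\mathbf C}_\#^\infty\times\dot{\mathcal C}^\infty_\#$.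
   Context: Repeated indices are summed from $1$ to $n$; $\partial_j=\partial/\partial x_j$. $\mathbb A=(a_{kj}^{\alpha\beta})_{1\le k,j,\alpha,\beta\le n}$ is a tensor of real constants with the symmetry $a_{kj}^{\alpha\beta}=a_{\alpha j}^{k\beta}=a_{k\beta}^{\alpha j}$ (standing assumption). Relaxed ellipticity condition: there is a constant $C_{\mathbb A}>0$ such that $C_{\mathbb A}a_{kj}^{\alpha\beta}\zeta_{k\alpha}\zeta_{j\beta}\ge|\boldsymbol\zeta|^2:=\zeta_{k\alpha}\zeta_{k\alpha}$ for all $\boldsymbol\zeta\in\mathbb R^{n\times n}$ with $\boldsymbol\zeta=\boldsymbol\zeta^\top$ and $\sum_k\zeta_{kk}=0$. $(\boldsymbol{\mathfrak L}\mathbf u)_k:=\partial_\alpha(a_{kj}^{\alpha\beta}E_{j\beta}(\mathbf u))=\partial_\alpha(a_{kj}^{\alpha\beta}\partial_\beta u_j)$ with $E_{j\beta}(\mathbf u)=\frac12(\partial_ju_\beta+\partial_\beta u_j)$. $((\mathbf u\cdot\nabla)\mathbf u)_k=u_j\partial_ju_k$, which for divergence-free $\mathbf u$ is the distribution $\partial_j(u_ju_k)$. Equations are understood in the sense of (periodic) distributions. $\mathbb T=[0,1)^n$ is the flat torus; functions/distributions on it are identified with $1$-periodic ones on $\mathbb R^n$. $\mathcal C^\infty_\#$ denotes the $1$-periodic functions in $\mathcal C^\infty(\mathbb R^n)$. Fourier coefficients: $\hat g(\boldsymbol\xi)=\int_{\mathbb T}e^{-2\pi i\mathbf x\cdot\boldsymbol\xi}g(\mathbf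 x)d\mathbf x$, $\boldsymbol\xi\in\mathbb Z^n$, extended to periodic distributions. For $s\in\mathbb R$, $H^s_\#$ is the space of periodic distributions with finite norm $\|g\|_{H^s_\#}=\big(\sum_{\boldsymbol\xi\in\mathbb Z^n}(1+|\boldsymbol\xi|^2)^s|\hat g(\boldsymbol\xi)|^2\big)^{1/2}$; $\dot H^s_\#=\{g\in H^s_\#:\hat g(\mathbf 0)=0\}$; $\dot{\mathcal C}^\infty_\#=\{g\in\mathcal C^\infty_\#:\int_{\mathbb T}g=0\}$. Bold symbols denote $n$-component vector versions; $\dot{\mathbf H}^s_{\#\sigma}=\{\mathbf w\in\dot{\mathbf H}^s_\#:\mathrm{div}\,\mathbf w=0\}$. *)

theory Defs
  imports "HOL-Analysis.Analysis"
begin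

text \<open>
  Functions on the flat torus are 1-periodic functions on \<open>real ^ 'n\<close>, and \<open>n = CARD('n)\<close>.
  Scalars are complex; real-valued functions and distributions are included as a special case.
\<close>

definition torus :: "(real ^ 'n) set" where
  "torus = {x. \<forall>i. 0 \<le> x $ i \<and> x $ i < 1}"

definition periodic :: "(real ^ 'n \<Rightarrow> complex) \<Rightarrow> bool" where
  "periodic g \<longleftrightarrow> (\<forall>i x. g (x + axis i 1) = g x)"

definition partial_deriv :: "'n \<Rightarrow> (real ^ 'n \<Rightarrow> complex) \<Rightarrow> real ^ 'n \<Rightarrow> complex" where
  "partial_deriv i g = (\<lambda>x. frechet_derivative g (at x) (axis i 1))"

text \<open>A multi-index is given as the list of the directions in which one differentiates.\<close>

definition iterated_partial :: "'n list \<Rightarrow> (real ^ 'n \<Rightarrow> complex) \<Rightarrow> real ^ 'n \<Rightarrow> complex" where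
  "iterated_partial is g = fold partial_deriv is g"

definition smooth :: "(real ^ 'n \<Rightarrow> complex) \<Rightarrow> bool" where
  "smooth g \<longleftrightarrow> (\<forall>is x. iterated_partial is g differentiable (at x))"

definition Cinf :: "(real ^ 'n \<Rightarrow> complex) set" where
  "Cinf = {g. periodic g \<and> smooth g}"

definition Cinf_dot :: "(real ^ 'n \<Rightarrow> complex) set" where
  "Cinf_dot = {g \<in> Cinf. (LINT x:torus|lborel. g x) = 0}"

definition Cm_norm :: "nat \<Rightarrow> (real ^ 'n \<Rightarrow> complex) \<Rightarrow> real" where
  "Cm_norm m g = (SUP (is, x) \<in> {is. length is \<le> m} \<times> UNIV. cmod (iterated_partial is g x))"

text \<open>
  Periodic distributions are the continuous linear functionals on \<open>Cinf\<close>, whose topology is given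
  by the norms \<open>Cm_norm m\<close>. As HOL functions they are total; only their values on \<open>Cinf\<close> matter, and
  equality of distributions is \<open>dist_eq\<close>.
\<close>

type_synonym 'n distribution = "((real, 'n) vec \<Rightarrow> complex) \<Rightarrow> complex"

definition distributions :: "'n::finite distribution set" where
  "distributions = {T.
     (\<forall>\<phi>\<in>Cinf. \<forall>\<psi>\<in>Cinf. T (\<lambda>x. \<phi> x + \<psi> x) = T \<phi> + T \<psi>) \<and>
     (\<forall>c. \<forall>\<phi>\<in>Cinf. T (\<lambda>x. c * \<phi> x) = c * T \<phi>) \<and>
     (\<exists>C m. \<forall>\<phi>\<in>Cinf. cmod (T \<phi>) \<le> C * Cm_norm m \<phi>)}"

definition dist_eq :: "'n::finite distribution \<Rightarrow> 'n distribution \<Rightarrow> bool" (infix \<open>=\<^sub>D\<close> 50) where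
  "S =\<^sub>D T \<longleftrightarrow> (\<forall>\<phi>\<in>Cinf. S \<phi> = T \<phi>)"

definition dist_of :: "(real ^ 'n \<Rightarrow> complex) \<Rightarrow> 'n::finite distribution" where
  "dist_of g = (\<lambda>\<phi>. LINT x:torus|lborel. g x * \<phi> x)"

definition dist_deriv :: "'n \<Rightarrow> 'n::finite distribution \<Rightarrow> 'n distribution" where
  "dist_deriv i T = (\<lambda>\<phi>. - T (partial_deriv i \<phi>))"

text \<open>
  The function that a distribution is identified with, for distributions given by an integrable
  function; it is determined up to a null set.
\<close>

definition fun_of :: "'n::finite distribution \<Rightarrow> real ^ 'n \<Rightarrow> complex" where
  "fun_of T = (SOME g. periodic g \<and> set_integrable lborel torus g \<and> T =\<^sub>D dist_of g)"

text \<open>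
  The pointwise product. It is meaningful when both factors are square-integrable functions, in
  particular for factors in \<open>H_per s\<close> with \<open>s \<ge> 0\<close>.
\<close>

definition dist_mult :: "'n::finite distribution \<Rightarrow> 'n distribution \<Rightarrow> 'n distribution" where
  "dist_mult S T = dist_of (\<lambda>x. fun_of S x * fun_of T x)"

definition fourier_coeff :: "'n::finite distribution \<Rightarrow> int ^ 'n \<Rightarrow> complex" where
  "fourier_coeff T \<xi> = T (\<lambda>x. exp (- 2 * complex_of_real pi * \<i> *
      complex_of_real (\<Sum>i\<in>UNIV. x $ i * real_of_int (\<xi> $ i))))"

definition H_per :: "real \<Rightarrow> 'n::finite distribution set" where
  "H_per s = {T \<in> distributions.
     (\<lambda>\<xi>. (1 + (\<Sum>i\<in>UNIV. (real_of_int (\<xi> $ i))\<^sup>2)) powr s * (cmod (fourier_coeff T \<xi>))\<^sup>2)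
       summable_on UNIV}"

definition H_dot :: "real \<Rightarrow> 'n::finite distribution set" where
  "H_dot s = {T \<in> H_per s. fourier_coeff T 0 = 0}"

definition vec_H_dot :: "real \<Rightarrow> ('n \<Rightarrow> 'n::finite distribution) set" where
  "vec_H_dot s = {w. \<forall>k. w k \<in> H_dot s}"

definition dist_div :: "('n \<Rightarrow> 'n::finite distribution) \<Rightarrow> 'n distribution" where
  "dist_div w = (\<lambda>\<phi>. \<Sum>j\<in>UNIV. dist_deriv j (w j) \<phi>)"

definition vec_H_dot_sigma :: "real \<Rightarrow> ('n \<Rightarrow> 'n::finite distribution) set" where
  "vec_H_dot_sigma s = {w \<in> vec_H_dot s. dist_div w =\<^sub>D (\<lambda>\<phi>. 0)}"

definition dist_Cinf_dot :: "'n::finite distribution set" where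
  "dist_Cinf_dot = {T. \<exists>g\<in>Cinf_dot. T =\<^sub>D dist_of g}"

definition vec_dist_Cinf_dot :: "('n \<Rightarrow> 'n::finite distribution) set" where
  "vec_dist_Cinf_dot = {w. \<forall>k. w k \<in> dist_Cinf_dot}"

text \<open>The coefficient \<open>a\<close> with lower indices \<open>k j\<close> and upper indices \<open>\<alpha> \<beta>\<close> is written \<open>a k j \<alpha> \<beta>\<close>.\<close>

type_synonym 'n tensor = "'n \<Rightarrow> 'n \<Rightarrow> 'n \<Rightarrow> 'n \<Rightarrow> real"

definition tensor_symmetric :: "'n tensor \<Rightarrow> bool" where
  "tensor_symmetric a \<longleftrightarrow>
     (\<forall>k j \<alpha> \<beta>. a k j \<alpha> \<beta> = a \<alpha> j k \<beta> \<and> a k j \<alpha> \<beta> = a k \<beta> \<alpha> j)"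

definition relaxed_elliptic :: "'n::finite tensor \<Rightarrow> bool" where
  "relaxed_elliptic a \<longleftrightarrow> (\<exists>C>0. \<forall>\<zeta> :: real ^ 'n ^ 'n.
     \<zeta> = transpose \<zeta> \<longrightarrow> (\<Sum>k\<in>UNIV. \<zeta> $ k $ k) = 0 \<longrightarrow>
     C * (\<Sum>k\<in>UNIV. \<Sum>j\<in>UNIV. \<Sum>\<alpha>\<in>UNIV. \<Sum>\<beta>\<in>UNIV. a k j \<alpha> \<beta> * \<zeta> $ k $ \<alpha> * \<zeta> $ j $ \<beta>)
       \<ge> (\<Sum>k\<in>UNIV. \<Sum>\<alpha>\<in>UNIV. \<zeta> $ k $ \<alpha> * \<zeta> $ k $ \<alpha>))"

definition strain :: "('n \<Rightarrow> 'n::finite distribution) \<Rightarrow> 'n \<Rightarrow> 'n \<Rightarrow> 'n distribution" where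
  "strain u j \<beta> = (\<lambda>\<phi>. (dist_deriv j (u \<beta>) \<phi> + dist_deriv \<beta> (u j) \<phi>) / 2)"

definition L_op :: "'n tensor \<Rightarrow> ('n \<Rightarrow> 'n::finite distribution) \<Rightarrow> 'n \<Rightarrow> 'n distribution" where
  "L_op a u k = (\<lambda>\<phi>. \<Sum>\<alpha>\<in>UNIV. dist_deriv \<alpha>
     (\<lambda>\<psi>. \<Sum>j\<in>UNIV. \<Sum>\<beta>\<in>UNIV. complex_of_real (a k j \<alpha> \<beta>) * strain u j \<beta> \<psi>) \<phi>)"

text \<open>\<open>(u \<cdot> \<nabla>) u\<close> for divergence-free \<open>u\<close>, in the conservative form that makes sense for distributions.\<close>

definition convection :: "('n \<Rightarrow> 'n::finite distribution) \<Rightarrow> 'n \<Rightarrow> 'n distribution" where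
  "convection u k = (\<lambda>\<phi>. \<Sum>j\<in>UNIV. dist_deriv j (dist_mult (u j) (u k)) \<phi>)"

definition NS_solution ::
    "'n tensor \<Rightarrow> ('n \<Rightarrow> 'n::finite distribution) \<Rightarrow> 'n distribution \<Rightarrow> ('n \<Rightarrow> 'n distribution) \<Rightarrow> bool"
  where
  "NS_solution a u p f \<longleftrightarrow>
     (\<forall>k. (\<lambda>\<phi>. - L_op a u k \<phi> + dist_deriv k p \<phi> + convection u k \<phi>) =\<^sub>D f k)"

end

theory Submission
  imports Defs
begin

text \<open>
  In Fourier coefficients the equation reads, frequency by frequency, as a linear elliptic system with the
  convection term on the right. Relaxed ellipticity and the divergence constraint give
  \<open>\<bar>\<xi>\<bar>\<^sup>2 \<bar>u\<bar> \<le> C (\<bar>f\<bar> + \<bar>\<xi>\<bar> \<bar>u \<otimes> u\<bar>)\<close> at each frequency \<open>\<xi>\<close>, and the equation itself then controls the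
  pressure. The Fourier coefficients of \<open>u \<otimes> u\<close> are convolutions, and for \<open>s > n/2 - 1\<close> there is a
  \<open>\<delta> > 0\<close> such that products of two functions in \<open>H\<^sup>s\<close> lie in \<open>H\<close> of order \<open>s - 1 + \<delta>\<close>, because the
  weight \<open>(1 + \<bar>\<xi>\<bar>\<^sup>2)\<close> to the power \<open>- (s + 1 - \<delta>)\<close> is summable. Each pass through the equation hence
  gains \<open>\<delta>\<close> derivatives, with \<open>\<delta>\<close> independent of the order already reached, until the
  regularity of \<open>f\<close> is exhausted. If \<open>f\<close> is smooth, all coefficients decay rapidly and the Fourier series
  are smooth functions.
\<close>

section \<open>Sums over the integer lattice\<close>

text \<open>The product in the convection term is built from \<open>fun_of\<close>, a choice of
  representative. Much of the work therefore lies in making the coefficient picture legitimate: an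
  integrable function must be determined by its coefficients, a square-summable sequence must come
  from a function, and the coefficients of a product must be accessible. The last point needs both
  factors in L^2, that is s \<ge> 0, which n \<ge> 2 guarantees because s > n/2 - 1.

  The gain stays constant because the product estimate requires s + 1 - \<delta> > n/2, a condition
  that only becomes easier as s grows: a \<delta> chosen at the starting order serves every pass.
  The order s - 1 + \<delta> of the product loses one derivative in the divergence and regains two
  by ellipticity, which gives s + \<delta>.

  The convolution estimates are stated over arbitrary finite sets of frequencies with one constant.
  Such bounds survive pointwise limits of the coefficients, so infinite convolutions never have to
  be formed.\<close>

definition weight :: "int ^ 'n \<Rightarrow> real" where
  "weight \<xi> = 1 + (\<Sum>i\<in>UNIV. (real_of_int (\<xi> $ i))\<^sup>2)"

lemma weight_ge_1: "1 \<le> weight \<xi>"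
  by (simp add: weight_def sum_nonneg)

lemma weight_pos: "0 < weight \<xi>"
  using weight_ge_1[of \<xi>] by linarith

lemma weight_add_le: "weight (\<eta> + \<zeta>) \<le> 2 * (weight \<eta> + weight \<zeta>)"
proof -
  have "(real_of_int ((\<eta> + \<zeta>) $ i))\<^sup>2 \<le> 2 * ((real_of_int (\<eta> $ i))\<^sup>2 + (real_of_int (\<zeta> $ i))\<^sup>2)" for i
    using zero_le_power2[of "real_of_int (\<eta> $ i) - real_of_int (\<zeta> $ i)"]
    by (simp add: power2_eq_square algebra_simps)
  then have "(\<Sum>i\<in>UNIV. (real_of_int ((\<eta> + \<zeta>) $ i))\<^sup>2)
      \<le> (\<Sum>i\<in>UNIV. 2 * ((real_of_int (\<eta> $ i))\<^sup>2 + (real_of_int (\<zeta> $ i))\<^sup>2))"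
    by (rule sum_mono)
  then show ?thesis
    by (simp add: weight_def sum.distrib sum_distrib_left[symmetric])
qed

text \<open>A crude bound that gives away a square root, harmless for rapidly decaying sequences.
  Where derivatives are counted exactly, \<open>abs_component_le_sqrt_weight\<close> takes its
  place.\<close>

lemma abs_component_le_weight: "\<bar>real_of_int (\<xi> $ i)\<bar> \<le> weight \<xi>"
proof -
  have "\<bar>real_of_int (\<xi> $ i)\<bar> \<le> 1 + (real_of_int (\<xi> $ i))\<^sup>2"
    using zero_le_power2[of "\<bar>real_of_int (\<xi> $ i)\<bar> - 1"]
      power2_abs[of "real_of_int (\<xi> $ i)"] zero_le_power2[of "real_of_int (\<xi> $ i)"]
    by (simp add: power2_eq_square algebra_simps)
  also have "(real_of_int (\<xi> $ i))\<^sup>2 \<le> (\<Sum>i\<in>UNIV. (real_of_int (\<xi> $ i))\<^sup>2)"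
    by (rule member_le_sum) auto
  finally show ?thesis by (simp add: weight_def)
qed

section \<open>Summability of powers of the weight\<close>

lemma summable_on_nonneg_iff:
  fixes f :: "'a \<Rightarrow> real"
  assumes "\<And>x. f x \<ge> 0"
  shows "f summable_on UNIV \<longleftrightarrow> (\<exists>B. \<forall>X. finite X \<longrightarrow> sum f X \<le> B)"
proof
  assume "f summable_on UNIV"
  then show "\<exists>B. \<forall>X. finite X \<longrightarrow> sum f X \<le> B"
    using assms by (intro exI[of _ "infsum f UNIV"]) (auto intro!: finite_sum_le_infsum)
next
  assume "\<exists>B. \<forall>X. finite X \<longrightarrow> sum f X \<le> B"
  then show "f summable_on UNIV"
    using assms by (intro nonneg_bdd_above_summable_on) (auto simp: bdd_above_def)
qed

lemma sum_int_powr_bound: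
  fixes q :: real
  assumes "q > 1/2"
  shows "\<exists>B. \<forall>N::nat. (\<Sum>k\<in>{-int N..int N}. (1 + (real_of_int k)\<^sup>2) powr (- q)) \<le> B"
proof -
  let ?h = "\<lambda>k::int. (1 + (real_of_int k)\<^sup>2) powr (- q)"
  have sm: "summable (\<lambda>n. real n powr (- (2 * q)))"
    using assms by (simp add: summable_real_powr_iff)
  define B where "B = (\<Sum>n. real n powr (- (2 * q)))"
  have h: "?h k \<le> \<bar>real_of_int k\<bar> powr (- (2 * q))" if "k \<noteq> 0" for k
  proof -
    have "?h k \<le> (\<bar>real_of_int k\<bar>\<^sup>2) powr (- q)"
      using that assms by (intro powr_mono2') auto
    also have "\<dots> = \<bar>real_of_int k\<bar> powr (- (2 * q))"
      using that powr_powr[of "\<bar>real_of_int k\<bar>" 2 "- q"] by simp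
    finally show ?thesis .
  qed
  have "(\<Sum>k\<in>{-int N..int N}. ?h k) \<le> 1 + 2 * B" for N
  proof -
    have eq: "{-int N..int N} = {0} \<union> ((\<lambda>n. int n) ` {1..N} \<union> (\<lambda>n. - int n) ` {1..N})"
    proof (intro equalityI subsetI)
      fix k assume k: "k \<in> {-int N..int N}"
      consider "k = 0" | "k > 0" | "k < 0" by linarith
      then show "k \<in> {0} \<union> ((\<lambda>n. int n) ` {1..N} \<union> (\<lambda>n. - int n) ` {1..N})"
      proof cases
        case 2
        then have "k = int (nat k)" "nat k \<in> {1..N}" using k by auto
        then show ?thesis by blast
      next
        case 3
        then have "k = - int (nat (-k))" "nat (-k) \<in> {1..N}" using k by auto
        then show ?thesis by blast
      qed auto
    qed auto
    have s1: "(\<Sum>n\<in>{1..N}. ?h (int n)) \<le> B" "(\<Sum>n\<in>{1..N}. ?h (- int n)) \<le> B"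
    proof -
      have "(\<Sum>n\<in>{1..N}. ?h (int n)) \<le> (\<Sum>n\<in>{1..N}. real n powr (- (2 * q)))"
        using h[of "int _"] by (intro sum_mono) auto
      also have "\<dots> \<le> B" unfolding B_def by (intro sum_le_suminf sm) auto
      finally show "(\<Sum>n\<in>{1..N}. ?h (int n)) \<le> B" .
      then show "(\<Sum>n\<in>{1..N}. ?h (- int n)) \<le> B" by simp
    qed
    have "(\<Sum>k\<in>{-int N..int N}. ?h k) \<le> ?h 0 + ((\<Sum>n\<in>{1..N}. ?h (int n)) + (\<Sum>n\<in>{1..N}. ?h (- int n)))"
      unfolding eq
      by (subst sum.union_disjoint; (subst sum.union_disjoint)?)
        (auto simp: sum.reindex inj_on_def)
    also have "\<dots> \<le> 1 + 2 * B" using s1 by simp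
    finally show ?thesis .
  qed
  then show ?thesis by blast
qed

text \<open>A product bound replaces counting lattice points. The weight dominates 1 plus the square
  of each single component, so distributing the exponent equally over the n directions bounds each
  term by a product of one-dimensional terms with exponent \<open>q = \<sigma> / n > 1/2\<close>,
  and the sum over a box then factorizes.\<close>

lemma sum_weight_powr_bound:
  fixes \<sigma> :: real
  assumes "\<sigma> > real CARD('n::finite) / 2"
  shows "\<exists>B. \<forall>X. finite X \<longrightarrow> (\<Sum>\<xi>\<in>X. weight (\<xi> :: int ^ 'n) powr (- \<sigma>)) \<le> B"
proof -
  let ?n = "real CARD('n)"
  define q where "q = \<sigma> / ?n"
  have n: "?n > 0" by simp
  have q: "q > 1/2" using assms n by (simp add: q_def field_simps)
  let ?h = "\<lambda>k::int. (1 + (real_of_int k)\<^sup>2) powr (- q)"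
  obtain B where B: "\<And>N::nat. (\<Sum>k\<in>{-int N..int N}. ?h k) \<le> B"
    using sum_int_powr_bound[OF q] by blast
  have le: "weight \<xi> powr (- \<sigma>) \<le> (\<Prod>i\<in>UNIV. ?h (\<xi> $ i))" for \<xi> :: "int ^ 'n"
  proof -
    have "weight \<xi> powr (- \<sigma>) = (weight \<xi> powr (- q)) powr ?n"
      using n by (simp add: powr_powr q_def)
    also have "\<dots> = (\<Prod>i\<in>(UNIV::'n set). weight \<xi> powr (- q))"
      using weight_pos[of \<xi>] by (simp add: powr_realpow)
    also have "\<dots> \<le> (\<Prod>i\<in>UNIV. ?h (\<xi> $ i))"
    proof (intro prod_mono conjI)
      fix i
      have "(real_of_int (\<xi> $ i))\<^sup>2 \<le> (\<Sum>i\<in>UNIV. (real_of_int (\<xi> $ i))\<^sup>2)"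
        by (rule member_le_sum) auto
      then show "weight \<xi> powr (- q) \<le> ?h (\<xi> $ i)"
        using q by (intro powr_mono2') (auto simp: weight_def add_pos_nonneg)
    qed auto
    finally show ?thesis .
  qed
  have "(\<Sum>\<xi>\<in>X. weight \<xi> powr (- \<sigma>)) \<le> B ^ CARD('n)" if "finite X" for X :: "(int ^ 'n) set"
  proof -
    define N where "N = Max (insert 0 ((\<lambda>(\<xi>, i). nat \<bar>\<xi> $ i\<bar>) ` (X \<times> UNIV)))"
    have N: "nat \<bar>\<xi> $ i\<bar> \<le> N" if "\<xi> \<in> X" for \<xi> i
      unfolding N_def using that \<open>finite X\<close> by (intro Max_ge) auto
    define D where "D = PiE (UNIV::'n set) (\<lambda>_. {-int N..int N})"
    have sub: "X \<subseteq> vec_lambda ` D"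
    proof
      fix \<xi> assume "\<xi> \<in> X"
      then have "\<xi> = vec_lambda (\<lambda>i. \<xi> $ i)" "(\<lambda>i. \<xi> $ i) \<in> D"
        using N[of \<xi>] by (auto simp: D_def PiE_UNIV_domain vec_eq_iff) (smt (verit) nat_le_iff)+
      then show "\<xi> \<in> vec_lambda ` D" by blast
    qed
    have fin: "finite D" unfolding D_def by (intro finite_PiE) auto
    have "(\<Sum>\<xi>\<in>X. weight \<xi> powr (- \<sigma>)) \<le> (\<Sum>\<xi>\<in>vec_lambda ` D. weight \<xi> powr (- \<sigma>))"
      using sub fin by (intro sum_mono2) auto
    also have "\<dots> \<le> (\<Sum>\<xi>\<in>vec_lambda ` D. \<Prod>i\<in>UNIV. ?h (\<xi> $ i))"
      by (intro sum_mono le)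
    also have "\<dots> = (\<Sum>g\<in>D. \<Prod>i\<in>UNIV. ?h (g i))"
      by (subst sum.reindex) (auto simp: inj_on_def vec_lambda_inject)
    also have "\<dots> = (\<Prod>i\<in>(UNIV::'n set). \<Sum>k\<in>{-int N..int N}. ?h k)"
      unfolding D_def by (subst prod_sum_PiE) auto
    also have "\<dots> = (\<Sum>k\<in>{-int N..int N}. ?h k) ^ CARD('n)" by simp
    also have "\<dots> \<le> B ^ CARD('n)" by (intro power_mono B sum_nonneg) auto
    finally show ?thesis .
  qed
  then show ?thesis by blast
qed

lemma summable_weight_powr:
  fixes \<sigma> :: real
  assumes "\<sigma> > real CARD('n::finite) / 2"
  shows "(\<lambda>\<xi> :: int ^ 'n. weight \<xi> powr (- \<sigma>)) summable_on UNIV"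
  using sum_weight_powr_bound[OF assms] by (subst summable_on_nonneg_iff) auto

text \<open>
  The exponents are halved because \<open>weight\<close> is the square of the usual bracket. The left-hand side has
  total decay \<open>s + 1 - \<delta>\<close>; since the two largest of the three frequencies are comparable, all of it
  can be moved to the smallest one.
\<close>

lemma powr_triangle_split_ordered:
  fixes x y z s \<delta> :: real
  assumes "1 \<le> x" "1 \<le> y" "1 \<le> z" and le: "z \<le> y" "x \<le> 4 * y"
    and s: "0 \<le> s" "0 < \<delta>" "\<delta> \<le> 1"
  shows "x powr ((s - 1 + \<delta>) / 2) * y powr (- s / 2) * z powr (- s / 2)
    \<le> 4 powr (s / 2) * (x powr (- (s + 1 - \<delta>) / 2) + z powr (- (s + 1 - \<delta>) / 2))"
proof -
  define t where "t = (s - 1 + \<delta>) / 2"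
  define \<sigma> where "\<sigma> = (s + 1 - \<delta>) / 2"
  have exponent: "t - s / 2 + - s / 2 = - \<sigma>" "t + (- s / 2 + - s / 2) = - \<sigma>" "t - s / 2 - s / 2 = - \<sigma>" "t - s = - \<sigma>"
    by (simp_all add: t_def \<sigma>_def field_simps)
  have c1: "1 \<le> 4 powr (s / 2)" using s by (simp add: ge_one_powr_ge_zero)
  have main: "x powr t * y powr (- s / 2) * z powr (- s / 2)
    \<le> 4 powr (s / 2) * (x powr (- \<sigma>) + z powr (- \<sigma>))"
  proof (cases "t \<ge> 0")
    case True
    \<comment> \<open>Here x is absorbed by y. What remains of y has exponent
      \<open>t - s / 2 = (\<delta> - 1) / 2\<close>, which is nonpositive, so y may be replaced by
      the smaller z.\<close>
    have "x powr t \<le> (4 * y) powr t" using assms True by (intro powr_mono2) auto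
    also have "\<dots> = 4 powr t * y powr t" using assms by (simp add: powr_mult)
    also have "\<dots> \<le> 4 powr (s/2) * y powr t"
      using s by (intro mult_right_mono powr_mono) (auto simp: t_def)
    finally have "x powr t * y powr (- s / 2) \<le> 4 powr (s/2) * y powr t * y powr (- s/2)"
      by (intro mult_right_mono) auto
    also have "\<dots> = 4 powr (s/2) * y powr (t - s/2)" by (simp add: powr_add[symmetric])
    also have "\<dots> \<le> 4 powr (s/2) * z powr (t - s/2)"
      using assms by (intro mult_left_mono powr_mono2') (auto simp: t_def)
    finally have "x powr t * y powr (- s / 2) * z powr (- s / 2)
      \<le> 4 powr (s/2) * z powr (t - s/2) * z powr (- s/2)" by (intro mult_right_mono) auto
    also have "\<dots> = 4 powr (s/2) * z powr (- \<sigma>)"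
      by (simp add: mult.assoc powr_add[symmetric] exponent)
    also have "\<dots> \<le> 4 powr (s / 2) * (x powr (- \<sigma>) + z powr (- \<sigma>))"
      by (intro mult_left_mono) auto
    finally show ?thesis .
  next
    case False
    \<comment> \<open>All three exponents are now nonpositive, so every base may be lowered to m.
      Only x and z compete for the minimum, since z \<le> y.\<close>
    define m where "m = min x z"
    have m: "1 \<le> m" "m \<le> x" "m \<le> y" "m \<le> z" using assms by (auto simp: m_def)
    have "x powr t * y powr (- s / 2) * z powr (- s / 2) \<le> m powr t * m powr (- s / 2) * m powr (- s / 2)"
      using m s False by (intro mult_mono powr_mono2') auto
    also have "\<dots> = m powr (- \<sigma>)"
      by (simp add: mult.assoc powr_add[symmetric] exponent)
    also have "\<dots> \<le> 1 * (x powr (- \<sigma>) + z powr (- \<sigma>))" by (auto simp: m_def min_def)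
    also have "\<dots> \<le> 4 powr (s / 2) * (x powr (- \<sigma>) + z powr (- \<sigma>))"
      using c1 by (intro mult_right_mono) auto
    finally show ?thesis .
  qed
  have "- (s + 1 - \<delta>) / 2 = - \<sigma>" unfolding \<sigma>_def by linarith
  then show ?thesis using main unfolding t_def by metis
qed

text \<open>Whichever summand has the larger weight plays the part of y. Its own power is added on
  the right only to obtain a bound symmetric in the two summands.\<close>

lemma weight_powr_split:
  fixes \<eta> \<zeta> :: "int ^ 'n::finite"
  assumes s: "0 \<le> s" "0 < \<delta>" "\<delta> \<le> 1"
  shows "weight (\<eta> + \<zeta>) powr ((s - 1 + \<delta>) / 2) * weight \<eta> powr (- s / 2) * weight \<zeta> powr (- s / 2)
    \<le> 4 powr (s / 2) * (weight (\<eta> + \<zeta>) powr (- (s + 1 - \<delta>) / 2)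
        + weight \<eta> powr (- (s + 1 - \<delta>) / 2) + weight \<zeta> powr (- (s + 1 - \<delta>) / 2))"
proof -
  let ?\<sigma> = "- (s + 1 - \<delta>) / 2"
  let ?x = "weight (\<eta> + \<zeta>)" and ?y = "weight \<eta>" and ?z = "weight \<zeta>"
  have ge: "1 \<le> ?x" "1 \<le> ?y" "1 \<le> ?z" by (rule weight_ge_1)+
  show ?thesis
  proof (cases "?z \<le> ?y")
    case True
    have "?x \<le> 2 * (?y + ?z)" by (rule weight_add_le)
    also have "\<dots> \<le> 4 * ?y" using True by simp
    finally have "?x \<le> 4 * ?y" .
    from powr_triangle_split_ordered[OF ge True this s]
    have "?x powr ((s - 1 + \<delta>) / 2) * ?y powr (- s / 2) * ?z powr (- s / 2)
      \<le> 4 powr (s / 2) * (?x powr ?\<sigma> + ?z powr ?\<sigma>)" .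
    also have "\<dots> \<le> 4 powr (s / 2) * (?x powr ?\<sigma> + ?y powr ?\<sigma> + ?z powr ?\<sigma>)"
      by (intro mult_left_mono) auto
    finally show ?thesis .
  next
    case False
    then have "?y \<le> ?z" by simp
    have "?x \<le> 2 * (?y + ?z)" by (rule weight_add_le)
    also have "\<dots> \<le> 4 * ?z" using False by simp
    finally have "?x \<le> 4 * ?z" .
    from powr_triangle_split_ordered[OF ge(1,3,2) \<open>?y \<le> ?z\<close> this s]
    have "?x powr ((s - 1 + \<delta>) / 2) * ?y powr (- s / 2) * ?z powr (- s / 2)
      \<le> 4 powr (s / 2) * (?x powr ?\<sigma> + ?y powr ?\<sigma>)" by (simp add: mult_ac)
    also have "\<dots> \<le> 4 powr (s / 2) * (?x powr ?\<sigma> + ?y powr ?\<sigma> + ?z powr ?\<sigma>)"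
      by (intro mult_left_mono) auto
    finally show ?thesis .
  qed
qed

section \<open>Estimates for discrete convolutions\<close>

lemma power2_sum3_le: "(x + y + z)\<^sup>2 \<le> 3 * (x\<^sup>2 + y\<^sup>2 + (z::real)\<^sup>2)"
  using zero_le_power2[of "x - y"] zero_le_power2[of "y - z"] zero_le_power2[of "x - z"]
  by (simp add: power2_eq_square algebra_simps)

lemma sum_translate_le:
  fixes f :: "'a::ab_group_add \<Rightarrow> real"
  assumes "\<And>X. finite X \<Longrightarrow> sum f X \<le> B" "finite X"
  shows "(\<Sum>x\<in>X. f (x - y)) \<le> B" "(\<Sum>x\<in>X. f (y - x)) \<le> B"
proof -
  have "(\<Sum>x\<in>X. f (x - y)) = sum f ((\<lambda>x. x - y) ` X)"
    by (subst sum.reindex) (auto simp: inj_on_def)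
  then show "(\<Sum>x\<in>X. f (x - y)) \<le> B" using assms by simp
  have "(\<Sum>x\<in>X. f (y - x)) = sum f ((\<lambda>x. y - x) ` X)"
    by (subst sum.reindex) (auto simp: inj_on_def)
  then show "(\<Sum>x\<in>X. f (y - x)) \<le> B" using assms by simp
qed

text \<open>Young's inequality for the convolution of an l1 with an l2 sequence: Cauchy-Schwarz with
  respect to the weights p, followed by translation invariance of the bound on q.\<close>

lemma sum_convolution_l1_l2:
  fixes p q :: "'a::ab_group_add \<Rightarrow> real"
  assumes p: "\<And>x. 0 \<le> p x" "\<And>X. finite X \<Longrightarrow> sum p X \<le> P"
    and q: "\<And>X. finite X \<Longrightarrow> (\<Sum>x\<in>X. (q x)\<^sup>2) \<le> Q"
    and fin: "finite X" "finite Y"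
  shows "(\<Sum>x\<in>X. (\<Sum>y\<in>Y. p y * q (x - y))\<^sup>2) \<le> P\<^sup>2 * Q"
proof -
  have P0: "0 \<le> P" using p(2)[of "{}"] by simp
  have Q0: "0 \<le> Q" using q[of "{}"] by simp
  have "(\<Sum>y\<in>Y. p y * q (x - y))\<^sup>2 \<le> P * (\<Sum>y\<in>Y. p y * (q (x - y))\<^sup>2)" for x
  proof -
    have "(\<Sum>y\<in>Y. p y * q (x - y))\<^sup>2 = (\<Sum>y\<in>Y. sqrt (p y) * (sqrt (p y) * q (x - y)))\<^sup>2"
      using p(1) by (simp add: mult.assoc[symmetric])
    also have "\<dots> \<le> (\<Sum>y\<in>Y. (sqrt (p y))\<^sup>2) * (\<Sum>y\<in>Y. (sqrt (p y) * q (x - y))\<^sup>2)"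
      by (rule Cauchy_Schwarz_ineq_sum)
    also have "\<dots> = sum p Y * (\<Sum>y\<in>Y. p y * (q (x - y))\<^sup>2)"
      using p(1) by (simp add: power_mult_distrib)
    also have "\<dots> \<le> P * (\<Sum>y\<in>Y. p y * (q (x - y))\<^sup>2)"
      using p fin by (intro mult_right_mono sum_nonneg) auto
    finally show ?thesis .
  qed
  then have "(\<Sum>x\<in>X. (\<Sum>y\<in>Y. p y * q (x - y))\<^sup>2)
      \<le> (\<Sum>x\<in>X. P * (\<Sum>y\<in>Y. p y * (q (x - y))\<^sup>2))" by (rule sum_mono)
  also have "\<dots> = P * (\<Sum>y\<in>Y. p y * (\<Sum>x\<in>X. (q (x - y))\<^sup>2))"
    unfolding sum_distrib_left[symmetric] by (subst sum.swap) (simp add: sum_distrib_left)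
  also have "\<dots> \<le> P * (\<Sum>y\<in>Y. p y * Q)"
    using P0 p(1) sum_translate_le(1)[of "\<lambda>x. (q x)\<^sup>2", OF q fin(1)]
    by (intro mult_left_mono sum_mono) auto
  also have "\<dots> = P * (sum p Y * Q)" by (simp add: sum_distrib_right)
  also have "\<dots> \<le> P * (P * Q)"
    using P0 Q0 p fin by (intro mult_left_mono mult_right_mono) auto
  finally show ?thesis by (simp add: power2_eq_square mult.assoc)
qed

lemma sum_mult_le_sqrt:
  fixes f g :: "'a \<Rightarrow> real"
  assumes "\<And>X. finite X \<Longrightarrow> (\<Sum>x\<in>X. (f x)\<^sup>2) \<le> P" "\<And>X. finite X \<Longrightarrow> (\<Sum>x\<in>X. (g x)\<^sup>2) \<le> Q" "finite X"
  shows "(\<Sum>x\<in>X. f x * g x) \<le> sqrt (P * Q)"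
proof -
  have "(\<Sum>x\<in>X. f x * g x)\<^sup>2 \<le> (\<Sum>x\<in>X. (f x)\<^sup>2) * (\<Sum>x\<in>X. (g x)\<^sup>2)"
    by (rule Cauchy_Schwarz_ineq_sum)
  also have "\<dots> \<le> P * Q"
    using assms assms(1)[of "{}"] by (intro mult_mono sum_nonneg) auto
  finally show ?thesis by (rule real_le_rsqrt)
qed

text \<open>With w at the output frequency, the convolution of A and B is bounded by Cauchy-Schwarz
  and w supplies square-summability. With w on a factor, that factor becomes summable by
  Cauchy-Schwarz and Young's inequality applies. The constant 9 is 3 for squaring a sum of three
  terms times 3 for adding three equal bounds.\<close>

lemma sum_convolution_weighted_le:
  fixes A B w :: "'a::ab_group_add \<Rightarrow> real"
  assumes nn: "\<And>x. 0 \<le> A x" "\<And>x. 0 \<le> B x" "\<And>x. 0 \<le> w x"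
    and A: "\<And>X. finite X \<Longrightarrow> (\<Sum>x\<in>X. (A x)\<^sup>2) \<le> P"
    and B: "\<And>X. finite X \<Longrightarrow> (\<Sum>x\<in>X. (B x)\<^sup>2) \<le> Q"
    and w: "\<And>X. finite X \<Longrightarrow> (\<Sum>x\<in>X. (w x)\<^sup>2) \<le> Z"
    and fin: "finite X" "finite Y"
  shows "(\<Sum>x\<in>X. (\<Sum>y\<in>Y. A y * B (x - y) * (w x + w y + w (x - y)))\<^sup>2) \<le> 9 * (P * Q * Z)"
proof -
  have nonneg: "0 \<le> P" "0 \<le> Q" "0 \<le> Z" using A[of "{}"] B[of "{}"] w[of "{}"] by auto
  let ?f1 = "\<lambda>x. w x * (\<Sum>y\<in>Y. A y * B (x - y))"
  let ?f2 = "\<lambda>x. \<Sum>y\<in>Y. (A y * w y) * B (x - y)"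
  let ?f3 = "\<lambda>x. \<Sum>y\<in>Y. A y * (B (x - y) * w (x - y))"
  have 1: "(\<Sum>x\<in>X. (?f1 x)\<^sup>2) \<le> P * Q * Z"
  proof -
    have "(\<Sum>y\<in>Y. A y * B (x - y))\<^sup>2 \<le> P * Q" for x
    proof -
      have "(\<Sum>y\<in>Y. A y * B (x - y))\<^sup>2 \<le> (\<Sum>y\<in>Y. (A y)\<^sup>2) * (\<Sum>y\<in>Y. (B (x - y))\<^sup>2)"
        by (rule Cauchy_Schwarz_ineq_sum)
      also have "\<dots> \<le> P * Q"
        using A[OF fin(2)] sum_translate_le(2)[of "\<lambda>x. (B x)\<^sup>2", OF B fin(2)] nonneg
        by (intro mult_mono sum_nonneg) auto
      finally show ?thesis .
    qed
    then have "(\<Sum>x\<in>X. (?f1 x)\<^sup>2) \<le> (\<Sum>x\<in>X. (w x)\<^sup>2 * (P * Q))"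
      by (intro sum_mono) (simp add: power_mult_distrib mult_left_mono)
    also have "\<dots> = (\<Sum>x\<in>X. (w x)\<^sup>2) * (P * Q)" by (simp add: sum_distrib_right)
    also have "\<dots> \<le> Z * (P * Q)" using w[OF fin(1)] nonneg by (intro mult_right_mono) auto
    finally show ?thesis by (simp add: mult_ac)
  qed
  have 2: "(\<Sum>x\<in>X. (?f2 x)\<^sup>2) \<le> P * Q * Z"
  proof -
    have "(\<Sum>x\<in>X. (?f2 x)\<^sup>2) \<le> (sqrt (P * Z))\<^sup>2 * Q"
      using nn by (intro sum_convolution_l1_l2 sum_mult_le_sqrt A B w fin) auto
    then show ?thesis using nonneg by (simp add: mult_ac)
  qed
  \<comment> \<open>This is the mirror image of the previous case, but the finite set Y restricts y
    and not x - y, so the roles cannot be exchanged by substitution. The Cauchy-Schwarz argument is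
    repeated with the summable factor at x - y.\<close>
  have 3: "(\<Sum>x\<in>X. (?f3 x)\<^sup>2) \<le> P * Q * Z"
  proof -
    define b where "b = (\<lambda>x. B x * w x)"
    have b0: "0 \<le> b x" for x using nn by (simp add: b_def)
    have b1: "sum b V \<le> sqrt (Q * Z)" if "finite V" for V
      unfolding b_def by (intro sum_mult_le_sqrt B w that)
    have R0: "0 \<le> sqrt (Q * Z)" using nonneg by simp
    have "(?f3 x)\<^sup>2 \<le> sqrt (Q * Z) * (\<Sum>y\<in>Y. (A y)\<^sup>2 * b (x - y))" for x
    proof -
      have "(?f3 x)\<^sup>2 = (\<Sum>y\<in>Y. sqrt (b (x - y)) * (A y * sqrt (b (x - y))))\<^sup>2"
        by (intro arg_cong[where f = "\<lambda>x. x\<^sup>2"] sum.cong refl) (use b0 in \<open>simp add: b_def algebra_simps\<close>)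
      also have "\<dots> \<le> (\<Sum>y\<in>Y. (sqrt (b (x - y)))\<^sup>2) * (\<Sum>y\<in>Y. (A y * sqrt (b (x - y)))\<^sup>2)"
        by (rule Cauchy_Schwarz_ineq_sum)
      also have "\<dots> = (\<Sum>y\<in>Y. b (x - y)) * (\<Sum>y\<in>Y. (A y)\<^sup>2 * b (x - y))"
        using b0 by (simp add: power_mult_distrib)
      also have "\<dots> \<le> sqrt (Q * Z) * (\<Sum>y\<in>Y. (A y)\<^sup>2 * b (x - y))"
        using b0 by (intro mult_right_mono sum_translate_le(2) b1 fin sum_nonneg) auto
      finally show ?thesis .
    qed
    then have "(\<Sum>x\<in>X. (?f3 x)\<^sup>2) \<le> (\<Sum>x\<in>X. sqrt (Q * Z) * (\<Sum>y\<in>Y. (A y)\<^sup>2 * b (x - y)))"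
      by (rule sum_mono)
    also have "\<dots> = sqrt (Q * Z) * (\<Sum>y\<in>Y. (A y)\<^sup>2 * (\<Sum>x\<in>X. b (x - y)))"
      unfolding sum_distrib_left[symmetric] by (subst sum.swap) (simp add: sum_distrib_left)
    also have "\<dots> \<le> sqrt (Q * Z) * (\<Sum>y\<in>Y. (A y)\<^sup>2 * sqrt (Q * Z))"
      using R0 by (intro mult_left_mono sum_mono sum_translate_le(1) b1 fin) auto
    also have "\<dots> = sqrt (Q * Z) * ((\<Sum>y\<in>Y. (A y)\<^sup>2) * sqrt (Q * Z))"
      by (simp add: sum_distrib_right)
    also have "\<dots> \<le> sqrt (Q * Z) * (P * sqrt (Q * Z))"
      using R0 A[OF fin(2)] by (intro mult_left_mono mult_right_mono) auto
    also have "\<dots> = P * (sqrt (Q * Z) * sqrt (Q * Z))" by (simp only: mult_ac)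
    also have "\<dots> = P * Q * Z" using nonneg by simp
    finally show ?thesis .
  qed
  have "(\<Sum>y\<in>Y. A y * B (x - y) * (w x + w y + w (x - y))) = ?f1 x + ?f2 x + ?f3 x" for x
    unfolding sum_distrib_left sum.distrib[symmetric] by (intro sum.cong refl) (simp add: algebra_simps)
  then have "(\<Sum>x\<in>X. (\<Sum>y\<in>Y. A y * B (x - y) * (w x + w y + w (x - y)))\<^sup>2)
      \<le> (\<Sum>x\<in>X. 3 * ((?f1 x)\<^sup>2 + (?f2 x)\<^sup>2 + (?f3 x)\<^sup>2))"
    by (intro sum_mono) (simp only: power2_sum3_le)
  also have "\<dots> = 3 * ((\<Sum>x\<in>X. (?f1 x)\<^sup>2) + (\<Sum>x\<in>X. (?f2 x)\<^sup>2) + (\<Sum>x\<in>X. (?f3 x)\<^sup>2))"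
    by (simp add: sum_distrib_left sum.distrib)
  also have "\<dots> \<le> 3 * (P * Q * Z + P * Q * Z + P * Q * Z)"
    by (intro mult_left_mono add_mono 1 2 3) auto
  also have "\<dots> = 9 * (P * Q * Z)" by simp
  finally show ?thesis .
qed

section \<open>Exponentials on the torus\<close>

definition wave :: "int ^ 'n \<Rightarrow> real ^ 'n \<Rightarrow> complex" where
  "wave \<xi> x = exp (2 * of_real pi * \<i> * of_real (\<Sum>i\<in>UNIV. x $ i * of_int (\<xi> $ i)))"

abbreviation freq :: "int ^ 'n \<Rightarrow> 'n \<Rightarrow> complex" where
  "freq \<xi> i \<equiv> 2 * of_real pi * \<i> * of_int (\<xi> $ i)"

lemma fourier_coeff_eq: "fourier_coeff T \<xi> = T (wave (- \<xi>))"
  unfolding fourier_coeff_def wave_def by (simp add: sum_negf)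

lemma wave_add: "wave (\<xi> + \<eta>) x = wave \<xi> x * wave \<eta> x"
  unfolding wave_def
  by (simp add: exp_add[symmetric] distrib_left sum.distrib)

lemma wave_0 [simp]: "wave 0 x = 1"
  by (simp add: wave_def)

lemma norm_wave [simp]: "cmod (wave \<xi> x) = 1"
  by (simp add: wave_def)

lemma cnj_wave: "cnj (wave \<xi> x) = wave (- \<xi>) x"
  by (simp add: wave_def exp_cnj sum_negf)

lemma wave_shift: "wave \<xi> (x + y) = wave \<xi> x * wave \<xi> y"
  unfolding wave_def
  by (simp add: exp_add[symmetric] distrib_left distrib_right sum.distrib)

lemma wave_axis: "wave \<xi> (axis i t) = exp (2 * of_real pi * \<i> * of_real (t * of_int (\<xi> $ i)))"
proof -
  have "(\<Sum>j\<in>UNIV. axis i t $ j * of_int (\<xi> $ j)) = (\<Sum>j\<in>UNIV. if j = i then t * of_int (\<xi> $ i) else 0)"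
    by (intro sum.cong) (auto simp: axis_def)
  then show ?thesis by (simp add: wave_def)
qed

lemma periodic_wave: "periodic (wave \<xi>)"
proof -
  have "wave \<xi> (axis i 1) = 1" for i
    unfolding wave_axis using exp_integer_2pi[of "of_int (\<xi> $ i)"] by (simp add: mult_ac)
  then show ?thesis by (simp add: periodic_def wave_shift)
qed

lemma has_derivative_wave:
  "(wave \<xi> has_derivative
     (\<lambda>h. 2 * of_real pi * \<i> * of_real (\<Sum>i\<in>UNIV. h $ i * of_int (\<xi> $ i)) * wave \<xi> x)) (at x within S)"
proof -
  have lin: "bounded_linear (\<lambda>x. 2 * of_real pi * \<i> * of_real (\<Sum>i\<in>UNIV. x $ i * of_int (\<xi> $ i)))"
    by (intro bounded_linear_const_mult bounded_linear_compose[OF bounded_linear_of_real]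
        bounded_linear_sum bounded_linear_mult_const bounded_linear_vec_nth)
  have d: "((\<lambda>x. exp (2 * of_real pi * \<i> * of_real (\<Sum>i\<in>UNIV. x $ i * of_int (\<xi> $ i)))) has_derivative
     (\<lambda>h. 2 * of_real pi * \<i> * of_real (\<Sum>i\<in>UNIV. h $ i * of_int (\<xi> $ i)) * wave \<xi> x)) (at x within S)"
    unfolding wave_def using has_derivative_compose[OF bounded_linear.has_derivative[OF lin has_derivative_ident]
      DERIV_exp[unfolded has_field_derivative_def]] by (simp add: mult.commute)
  then show ?thesis by (simp add: wave_def[abs_def])
qed

lemma continuous_on_wave [continuous_intros]: "continuous_on S (wave \<xi>)"
  by (intro differentiable_imp_continuous_on)
    (auto simp: differentiable_on_def differentiable_def intro: has_derivative_wave)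

lemma partial_deriv_eq:
  assumes "(g has_derivative g') (at x)"
  shows "partial_deriv i g x = g' (axis i 1)"
  using frechet_derivative_at[OF assms] by (simp add: partial_deriv_def)

lemma partial_deriv_wave: "partial_deriv i (wave \<xi>) x = freq \<xi> i * wave \<xi> x"
proof -
  have "(\<Sum>j\<in>UNIV. axis i 1 $ j * of_int (\<xi> $ j)) = (\<Sum>j\<in>UNIV. if j = i then of_int (\<xi> $ i) else (0::real))"
    by (intro sum.cong) (auto simp: axis_def)
  then show ?thesis by (simp add: partial_deriv_eq[OF has_derivative_wave])
qed

section \<open>Periodic functions and the fundamental cell\<close>

lemma periodic_add_int:
  assumes "periodic g"
  shows "g (x + of_int k *\<^sub>R axis i 1) = g x"
proof -
  have nat: "g (y + of_nat m *\<^sub>R axis i 1) = g y" for m y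
  proof (induction m)
    case (Suc m)
    have "y + of_nat (Suc m) *\<^sub>R axis i 1 = (y + of_nat m *\<^sub>R axis i 1) + axis i 1"
      by (simp add: algebra_simps)
    moreover have "g ((y + of_nat m *\<^sub>R axis i 1) + axis i 1) = g (y + of_nat m *\<^sub>R axis i 1)"
      using assms by (simp add: periodic_def)
    ultimately show ?case using Suc by (simp only:)
  qed simp
  show ?thesis
  proof (cases "k \<ge> 0")
    case True
    then show ?thesis using nat[of x "nat k"] by simp
  next
    case False
    then have "g (x + of_int k *\<^sub>R axis i 1) = g ((x + of_int k *\<^sub>R axis i 1) + of_nat (nat (-k)) *\<^sub>R axis i 1)"
      by (simp only: nat)
    also have "(x + of_int k *\<^sub>R axis i 1) + of_nat (nat (-k)) *\<^sub>R axis i 1 = x"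
      using False by (simp add: scaleR_left.add[symmetric] add.assoc)
    finally show ?thesis .
  qed
qed

text \<open>Coordinates are reduced one after the other, because \<open>periodic\<close> speaks of
  shifts along a single axis.\<close>

lemma periodic_frac:
  assumes "periodic (g :: real ^ 'n \<Rightarrow> complex)"
  shows "g (\<chi> i. frac (x $ i)) = g x"
proof -
  have "g (\<chi> i. if i \<in> A then frac (x $ i) else x $ i) = g x" if "finite A" for A :: "'n set"
    using that
  proof (induction A)
    case empty
    then show ?case by simp
  next
    case (insert j A)
    let ?y = "\<lambda>A. \<chi> i. if i \<in> A then frac (x $ i) else x $ i"
    have "?y A = ?y (insert j A) + of_int \<lfloor>x $ j\<rfloor> *\<^sub>R axis j 1"
      using insert.hyps by (auto simp: vec_eq_iff frac_def axis_def)
    then have "g (?y A) = g (?y (insert j A))"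
      by (simp only: periodic_add_int[OF assms])
    then show ?case using insert.IH by simp
  qed
  from this[of UNIV] show ?thesis by simp
qed

lemma frac_in_torus: "(\<chi> i. frac (x $ i)) \<in> torus"
  by (simp add: torus_def frac_lt_1)

lemma torus_subset_cbox: "torus \<subseteq> cbox 0 (1 :: real ^ 'n)"
  by (auto simp: torus_def mem_box_cart less_imp_le)

lemma box_subset_torus: "box 0 (1 :: real ^ 'n) \<subseteq> torus"
  by (auto simp: torus_def mem_box_cart less_imp_le)

lemma periodic_continuous_bounded:
  fixes g :: "real ^ 'n \<Rightarrow> complex"
  assumes "periodic g" "continuous_on UNIV g"
  shows "\<exists>B. \<forall>x. cmod (g x) \<le> B"
proof -
  have "compact (g ` cbox 0 1)"
    by (intro compact_continuous_image continuous_on_subset[OF assms(2)]) auto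
  then obtain B where B: "\<And>x. x \<in> cbox 0 1 \<Longrightarrow> cmod (g x) \<le> B"
    by (meson bounded_iff compact_imp_bounded image_eqI)
  have "cmod (g x) \<le> B" for x
    using B[of "\<chi> i. frac (x $ i)"] torus_subset_cbox frac_in_torus[of x] periodic_frac[OF assms(1), of x]
    by auto
  then show ?thesis by blast
qed

section \<open>Lebesgue measure on the torus and integration by parts\<close>

lemma torus_borel [measurable, simp]: "torus \<in> sets (borel :: (real ^ 'n) measure)"
proof -
  have "torus = (\<Inter>i. {x :: real ^ 'n. 0 \<le> x $ i} \<inter> {x. x $ i < 1})"
    by (auto simp: torus_def)
  also have "\<dots> \<in> sets borel"
    by (intro sets.countable_INT'' sets.Int borel_closed borel_open closed_Collect_le open_Collect_less
        continuous_intros) auto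
  finally show ?thesis .
qed

text \<open>A measure of total mass 1 in place of set integrals, so that bounded measurable
  functions are integrable and dominated convergence with constant majorants applies
  directly.\<close>

definition torusM :: "(real ^ 'n) measure" where
  "torusM = restrict_space lborel torus"

lemma space_torusM [simp]: "space torusM = torus"
  by (simp add: torusM_def space_restrict_space)

lemma emeasure_torus: "emeasure lborel (torus :: (real ^ 'n) set) = 1"
proof (rule antisym)
  have "measure lborel (cbox 0 (1 :: real ^ 'n)) = 1" 
    by (subst content_cbox_cart) (auto simp: interval_eq_empty_cart)
  moreover have "emeasure lborel (cbox 0 (1 :: real ^ 'n)) \<noteq> \<infinity>"
    using emeasure_lborel_cbox_finite[of 0 "1 :: real ^ 'n"] by (simp only: less_top[symmetric])
  ultimately have c: "emeasure lborel (cbox 0 (1 :: real ^ 'n)) = 1"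
    using emeasure_eq_ennreal_measure[of lborel "cbox 0 (1 :: real ^ 'n)"]
    by (simp only: infinity_ennreal_def ennreal_1 not_False_eq_True)
  have b: "emeasure lborel (box 0 (1 :: real ^ 'n)) = 1"
    using c unfolding emeasure_lborel_box_eq emeasure_lborel_cbox_eq .
  show "emeasure lborel (torus :: (real ^ 'n) set) \<le> 1"
    unfolding c[symmetric] by (intro emeasure_mono torus_subset_cbox) auto
  show "1 \<le> emeasure lborel (torus :: (real ^ 'n) set)"
    unfolding b[symmetric] by (intro emeasure_mono box_subset_torus) auto
qed

lemma torus_lborel: "torus \<inter> space lborel \<in> sets (lborel :: (real ^ 'n) measure)"
  by simp

lemma finite_measure_torus: "finite_measure (torusM :: (real ^ 'n) measure)"
proof (rule finite_measureI)
  have "emeasure torusM (torus :: (real ^ 'n) set) = 1"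
    unfolding torusM_def by (subst emeasure_restrict_space[OF torus_lborel]) (simp_all add: emeasure_torus)
  then show "emeasure torusM (space torusM :: (real ^ 'n) set) \<noteq> \<infinity>" by simp
qed

interpretation torus: finite_measure "torusM :: (real ^ 'n) measure"
  by (rule finite_measure_torus)

lemma measure_torus: "measure torusM (torus :: (real ^ 'n) set) = 1"
  unfolding torusM_def
  by (subst measure_restrict_space[OF torus_lborel]) (simp_all add: measure_def emeasure_torus)

lemma set_integral_torus:
  fixes f :: "real ^ 'n \<Rightarrow> complex"
  shows "(LINT x:torus|lborel. f x) = (LINT x|torusM. f x)"
  unfolding torusM_def set_lebesgue_integral_def
  by (rule integral_restrict_space[OF torus_lborel, symmetric])

lemma set_integrable_torus:
  fixes f :: "real ^ 'n \<Rightarrow> complex"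
  shows "set_integrable lborel torus f \<longleftrightarrow> integrable torusM f"
  unfolding torusM_def set_integrable_def
  by (rule integrable_restrict_space[OF torus_lborel, symmetric])

lemma dist_of_eq: "dist_of g \<phi> = (LINT x|torusM. g x * \<phi> x)"
  by (simp add: dist_of_def set_integral_torus)

lemma measurable_torus [measurable (raw)]:
  assumes "f \<in> borel_measurable borel"
  shows "f \<in> borel_measurable torusM"
  using assms unfolding torusM_def by (intro measurable_restrict_space1) simp

lemma borel_measurable_wave [measurable]: "wave \<xi> \<in> borel_measurable borel"
  by (intro borel_measurable_continuous_onI continuous_intros)

lemma integrable_torus_bounded:
  fixes f :: "real ^ 'n \<Rightarrow> 'b::{banach, second_countable_topology}"
  assumes "f \<in> borel_measurable torusM" "\<And>x. norm (f x) \<le> B"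
  shows "integrable torusM f"
  using assms by (intro torus.integrable_const_bound[where B = B]) auto

lemma integrable_mult_bounded:
  fixes f g :: "'a \<Rightarrow> complex"
  assumes f: "integrable M f" and g: "g \<in> borel_measurable M" "\<And>x. cmod (g x) \<le> B"
  shows "integrable M (\<lambda>x. f x * g x)"
proof (rule Bochner_Integration.integrable_bound)
  show "integrable M (\<lambda>x. of_real B * f x)" using f by simp
  show "(\<lambda>x. f x * g x) \<in> borel_measurable M" using f g by measurable
  have "cmod (f x * g x) \<le> cmod (of_real B * f x)" for x
  proof -
    have "0 \<le> B" using g(2)[of x] norm_ge_zero[of "g x"] by linarith
    then show ?thesis
      using mult_left_mono[OF g(2)[of x] norm_ge_zero[of "f x"]] by (simp add: norm_mult mult.commute)
  qed
  then show "AE x in M. cmod (f x * g x) \<le> cmod (of_real B * f x)" by simp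
qed

text \<open>The torus is cut at height \<open>1 - t\<close> in direction i. The lower slab is
  shifted within the torus; the upper one would leave it and is brought back by one period. The two
  images tile the torus cut at height t.\<close>

lemma integral_torus_shift:
  fixes g :: "real ^ 'n \<Rightarrow> complex"
  assumes per: "periodic g" and cont: "continuous_on UNIV g" and t: "0 < t" "t < 1"
  shows "(LINT x|torusM. g (x + axis i t)) = (LINT x|torusM. g x)"
proof -
  obtain B where B: "\<And>x. cmod (g x) \<le> B" using periodic_continuous_bounded[OF per cont] by blast
  have [measurable]: "g \<in> borel_measurable borel" using cont by (rule borel_measurable_continuous_onI)
  define A where "A = {x \<in> torus. x $ i < 1 - t}"
  define A' where "A' = {x \<in> (torus :: (real ^ 'n) set). 1 - t \<le> x $ i}"
  define C where "C = {x \<in> torus. t \<le> x $ i}"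
  define C' where "C' = {x \<in> (torus :: (real ^ 'n) set). x $ i < t}"
  have vn [measurable]: "(\<lambda>x :: real ^ 'n. x $ i) \<in> borel_measurable borel"
    by (intro borel_measurable_continuous_onI continuous_intros)
  have meas [measurable]: "A \<in> sets borel" "A' \<in> sets borel" "C \<in> sets borel" "C' \<in> sets borel"
    unfolding A_def A'_def C_def C'_def by measurable
  have sub: "A \<subseteq> torus" "A' \<subseteq> torus" "C \<subseteq> torus" "C' \<subseteq> torus"
    by (auto simp: A_def A'_def C_def C'_def)
  have int: "set_integrable lborel S (\<lambda>x. g (x + c))" if "S \<subseteq> torus" "S \<in> sets borel" for S c
  proof -
    have "integrable torusM (\<lambda>x. g (x + c))"
      using B by (intro integrable_torus_bounded) auto
    then show ?thesis using that by (auto simp: set_integrable_torus[symmetric] intro: set_integrable_subset)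
  qed
  have shift: "(LINT x:S|lborel. h (x + c)) = (LINT x:((\<lambda>x. x + c) ` S)|lborel. h x)"
    if [measurable]: "S \<in> sets borel" "h \<in> borel_measurable borel" for S c and h :: "real ^ 'n \<Rightarrow> complex"
  proof -
    have im: "(\<lambda>x. x + c) ` S = (\<lambda>x. x - c) -` S" by (force simp: image_iff)
    have [measurable]: "(\<lambda>x. x + c) ` S \<in> sets borel"
      unfolding im using measurable_sets_borel[of "\<lambda>x. x - c" borel S] by (simp add: that)
    have "(LINT x|lborel. indicator ((\<lambda>x. x + c) ` S) x *\<^sub>R h x)
        = (LINT x|distr lborel borel ((+) c). indicator ((\<lambda>x. x + c) ` S) x *\<^sub>R h x)"
      by (simp only: lborel_distr_plus)
    also have "\<dots> = (LINT x|lborel. indicator ((\<lambda>x. x + c) ` S) (c + x) *\<^sub>R h (c + x))"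
      by (rule integral_distr) auto
    also have "\<dots> = (LINT x|lborel. indicator S x *\<^sub>R h (x + c))"
      by (intro Bochner_Integration.integral_cong) (auto simp: indicator_def im add.commute)
    finally show ?thesis by (simp add: set_lebesgue_integral_def)
  qed
  \<comment> \<open>R collects the conditions on the other coordinates, which a shift along axis i
    leaves alone. The set identities thereby become linear arithmetic in the single coordinate
    i.\<close>
  define R where "R x \<longleftrightarrow> (\<forall>k. k \<noteq> i \<longrightarrow> 0 \<le> x $ k \<and> x $ k < 1)" for x :: "real ^ 'n"
  have split: "x \<in> torus \<longleftrightarrow> 0 \<le> x $ i \<and> x $ i < 1 \<and> R x" for x :: "real ^ 'n"
    unfolding torus_def mem_Collect_eq R_def by metis
  have comp: "(x - axis i r) $ i = x $ i - r" "R (x - axis i r) = R x" for x :: "real ^ 'n" and r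
    by (simp_all add: R_def axis_def del: all_simps)
  have im: "(\<lambda>x. x + c) ` S = {x. x - c \<in> S}" for S and c :: "real ^ 'n"
    by (force simp: image_iff)
  have imA: "(\<lambda>x. x + axis i t) ` A = C"
  proof (rule set_eqI)
    show "x \<in> (\<lambda>x. x + axis i t) ` A \<longleftrightarrow> x \<in> C" for x
      unfolding im A_def C_def mem_Collect_eq split comp using t by argo
  qed
  have imA': "(\<lambda>x. x + axis i (t - 1)) ` A' = C'"
  proof (rule set_eqI)
    show "x \<in> (\<lambda>x. x + axis i (t - 1)) ` A' \<longleftrightarrow> x \<in> C'" for x
      unfolding im A'_def C'_def mem_Collect_eq split comp using t by argo
  qed
  have g': "g (x + axis i (t - 1)) = g (x + axis i t)" for x
  proof -
    have "axis i t = axis i (t - 1) + axis i (1 :: real)"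
      unfolding vec_eq_iff by (auto simp: axis_def)
    then have "x + axis i t = (x + axis i (t - 1)) + axis i 1"
      by (simp only: add.assoc)
    moreover have "g ((x + axis i (t - 1)) + axis i 1) = g (x + axis i (t - 1))"
      using per unfolding periodic_def by blast
    ultimately show ?thesis by (simp only:)
  qed
  have T: "torus = A \<union> A'" "torus = C \<union> C'" "A \<inter> A' = {}" "C \<inter> C' = {}"
    by (auto simp: A_def A'_def C_def C'_def)
  have "(LINT x:torus|lborel. g (x + axis i t))
      = (LINT x:A|lborel. g (x + axis i t)) + (LINT x:A'|lborel. g (x + axis i t))"
    unfolding T(1) by (intro set_integral_Un T int sub meas)
  also have "(LINT x:A'|lborel. g (x + axis i t)) = (LINT x:A'|lborel. g (x + axis i (t - 1)))"
    by (simp only: g')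
  also have "(LINT x:A|lborel. g (x + axis i t)) = (LINT x:C|lborel. g x)"
    by (simp add: shift imA)
  also have "(LINT x:A'|lborel. g (x + axis i (t - 1))) = (LINT x:C'|lborel. g x)"
    by (simp add: shift imA')
  also have "(LINT x:C|lborel. g x) + (LINT x:C'|lborel. g x) = (LINT x:torus|lborel. g x)"
    unfolding T(2) using int[OF sub(3), of 0] int[OF sub(4), of 0] meas by (intro set_integral_Un[symmetric] T) auto
  finally show ?thesis by (simp add: set_integral_torus)
qed

lemma has_derivative_along_axis:
  fixes \<phi> :: "real ^ 'n \<Rightarrow> complex"
  assumes "\<phi> differentiable (at (x + axis i t))"
  shows "((\<lambda>t. \<phi> (x + axis i t)) has_derivative (\<lambda>h. h *\<^sub>R partial_deriv i \<phi> (x + axis i t))) (at t within S)"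
proof -
  have ax: "axis i r = r *\<^sub>R axis i (1::real)" for r
    by (simp add: vec_eq_iff axis_def)
  let ?D = "frechet_derivative \<phi> (at (x + axis i t))"
  have D: "(\<phi> has_derivative ?D) (at (x + axis i t))"
    using assms by (simp add: frechet_derivative_works)
  have "((\<lambda>t. x + t *\<^sub>R axis i 1) has_derivative (\<lambda>h. h *\<^sub>R axis i 1)) (at t within S)"
    by (auto intro!: derivative_eq_intros)
  then have "((\<lambda>t. x + axis i t) has_derivative (\<lambda>h. axis i h)) (at t within S)"
    by (simp only: ax[symmetric])
  from has_derivative_compose[OF this D]
  have "((\<lambda>t. \<phi> (x + axis i t)) has_derivative (\<lambda>h. ?D (axis i h))) (at t within S)" .
  moreover have "?D (axis i h) = h *\<^sub>R partial_deriv i \<phi> (x + axis i t)" for h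
    unfolding partial_deriv_def ax[of h] by (rule linear_scale[OF has_derivative_linear[OF D]])
  ultimately show ?thesis by simp
qed

text \<open>
  The integral of a periodic function is invariant under translations, so the integrals of its
  difference quotients vanish.
\<close>

lemma integral_partial_deriv_eq_0:
  fixes \<phi> :: "real ^ 'n \<Rightarrow> complex"
  assumes per: "periodic \<phi>" and diff: "\<And>x. \<phi> differentiable (at x)"
    and per': "periodic (partial_deriv i \<phi>)" and cont: "continuous_on UNIV (partial_deriv i \<phi>)"
  shows "(LINT x|torusM. partial_deriv i \<phi> x) = 0"
proof -
  obtain B where B: "\<And>x. cmod (partial_deriv i \<phi> x) \<le> B"
    using periodic_continuous_bounded[OF per' cont] by blast
  have contphi: "continuous_on UNIV \<phi>"
    using diff by (simp add: continuous_on_eq_continuous_at differentiable_imp_continuous_within)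
  obtain B' where B': "\<And>x. cmod (\<phi> x) \<le> B'"
    using periodic_continuous_bounded[OF per contphi] by blast
  have [measurable]: "\<phi> \<in> borel_measurable borel" "partial_deriv i \<phi> \<in> borel_measurable borel"
    using contphi cont by (auto intro: borel_measurable_continuous_onI)
  \<comment> \<open>The index is offset by two so that every step length, including the first, lies
    strictly between 0 and 1, as the shift lemma demands.\<close>
  define t where "t n = inverse (real (Suc (Suc n)))" for n
  have t: "0 < t n" "t n < 1" for n by (auto simp: t_def field_simps)
  have t0: "t \<longlonglongrightarrow> 0" unfolding t_def using LIMSEQ_inverse_real_of_nat by (rule LIMSEQ_Suc)
  define D where "D n x = (\<phi> (x + axis i (t n)) - \<phi> x) /\<^sub>R t n" for n x
  have D_lim: "(\<lambda>n. D n x) \<longlonglongrightarrow> partial_deriv i \<phi> x" for x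
  proof -
    have ax0: "axis i 0 = (0 :: real ^ 'n)" by (simp add: vec_eq_iff axis_def)
    have "((\<lambda>t. \<phi> (x + axis i t)) has_derivative (\<lambda>h. h *\<^sub>R partial_deriv i \<phi> (x + axis i 0))) (at 0)"
      by (intro has_derivative_along_axis diff)
    then have "((\<lambda>h. norm (\<phi> (x + axis i h) - \<phi> x - h *\<^sub>R partial_deriv i \<phi> x) / norm h) \<longlongrightarrow> 0) (at 0)"
      by (simp add: has_derivative_at ax0)
    then have "(\<lambda>n. norm (\<phi> (x + axis i (t n)) - \<phi> x - t n *\<^sub>R partial_deriv i \<phi> x) / norm (t n)) \<longlonglongrightarrow> 0"
      by (rule filterlim_compose) (use t0 t(1) in \<open>auto simp: filterlim_at less_imp_neq[symmetric]\<close>)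
    moreover have "norm (\<phi> (x + axis i (t n)) - \<phi> x - t n *\<^sub>R partial_deriv i \<phi> x) / norm (t n)
        = norm (D n x - partial_deriv i \<phi> x)" for n
    proof -
      have "D n x - partial_deriv i \<phi> x = (\<phi> (x + axis i (t n)) - \<phi> x - t n *\<^sub>R partial_deriv i \<phi> x) /\<^sub>R t n"
        using t(1)[of n] by (simp add: D_def scaleR_diff_right)
      then show ?thesis using t(1)[of n] by (simp add: divide_inverse mult.commute)
    qed
    ultimately have "(\<lambda>n. norm (D n x - partial_deriv i \<phi> x)) \<longlonglongrightarrow> 0" by simp
    then show ?thesis by (simp add: LIM_zero_iff tendsto_norm_zero_iff)
  qed
  \<comment> \<open>The mean value inequality along the axis makes the bound of the derivative a
    constant majorant for all difference quotients.\<close>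
  have D_bound: "cmod (D n x) \<le> B" for n x
  proof -
    have "norm (\<phi> (x + axis i (t n)) - \<phi> (x + axis i 0)) \<le> B * norm (t n - 0)"
    proof (rule differentiable_bound[where S = UNIV])
      show "((\<lambda>t. \<phi> (x + axis i t)) has_derivative (\<lambda>h. h *\<^sub>R partial_deriv i \<phi> (x + axis i s))) (at s within UNIV)" for s
        by (intro has_derivative_along_axis diff)
      show "onorm (\<lambda>h. h *\<^sub>R partial_deriv i \<phi> (x + axis i s)) \<le> B" for s
        by (intro onorm_le) (auto simp: mult.commute[of "\<bar>_\<bar>"] intro!: mult_right_mono B)
    qed auto
    then have "norm (\<phi> (x + axis i (t n)) - \<phi> x) \<le> B * t n"
      using t(1)[of n] by (simp add: axis_def zero_vec_def[symmetric])
    then show ?thesis using t(1)[of n] by (simp add: D_def divide_inverse[symmetric] mult.commute[of "inverse _"] pos_divide_le_eq)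
  qed
  have "(\<lambda>n. LINT x|torusM. D n x) \<longlonglongrightarrow> (LINT x|torusM. partial_deriv i \<phi> x)"
  proof (rule integral_dominated_convergence[where w = "\<lambda>_. B"])
    show "D n \<in> borel_measurable torusM" for n
      unfolding D_def by measurable
  qed (use D_lim D_bound in auto)
  moreover have "(LINT x|torusM. D n x) = 0" for n
  proof -
    have "integrable torusM (\<lambda>x. \<phi> (x + c))" for c
      using B' by (intro integrable_torus_bounded) auto
    from this[of "axis i (t n)"] this[of 0] show ?thesis
      unfolding D_def by (simp add: integral_torus_shift[OF per contphi t])
  qed
  ultimately show ?thesis by (simp add: LIMSEQ_const_iff)
qed

lemma differentiable_wave: "wave \<xi> differentiable (at x)"
  using has_derivative_wave by (rule differentiableI)

text \<open>Integration by parts: the derivative of the product with the wave has integral 0, and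
  differentiating \<open>wave (- \<xi>)\<close> produces the factor with a minus sign.\<close>

lemma integral_partial_deriv_wave:
  fixes \<phi> :: "real ^ 'n \<Rightarrow> complex"
  assumes per: "periodic \<phi>" and diff: "\<And>x. \<phi> differentiable (at x)"
    and per': "periodic (partial_deriv i \<phi>)" and cont: "continuous_on UNIV (partial_deriv i \<phi>)"
  shows "(LINT x|torusM. partial_deriv i \<phi> x * wave (- \<xi>) x)
    = freq \<xi> i * (LINT x|torusM. \<phi> x * wave (- \<xi>) x)"
proof -
  have contphi: "continuous_on UNIV \<phi>"
    using diff by (simp add: continuous_on_eq_continuous_at differentiable_imp_continuous_within)
  let ?c = "freq \<xi> i"
  let ?\<psi> = "\<lambda>x. \<phi> x * wave (- \<xi>) x"
  have pd: "partial_deriv i ?\<psi> x = partial_deriv i \<phi> x * wave (- \<xi>) x - ?c * ?\<psi> x" for x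
  proof -
    have "(\<phi> has_derivative frechet_derivative \<phi> (at x)) (at x)"
      using diff by (simp add: frechet_derivative_works)
    moreover have "(wave (- \<xi>) has_derivative frechet_derivative (wave (- \<xi>)) (at x)) (at x)"
      using differentiable_wave frechet_derivative_works by blast
    ultimately have "(?\<psi> has_derivative (\<lambda>h. \<phi> x * frechet_derivative (wave (- \<xi>)) (at x) h
        + frechet_derivative \<phi> (at x) h * wave (- \<xi>) x)) (at x)"
      by (rule has_derivative_mult)
    from partial_deriv_eq[OF this, of i] show ?thesis
      using partial_deriv_wave[of i "- \<xi>" x] by (simp add: partial_deriv_def)
  qed
  have bounded: "integrable torusM f" if "periodic f" "continuous_on UNIV f" for f :: "real ^ 'n \<Rightarrow> complex"
  proof -
    have "f \<in> borel_measurable borel" using that by (intro borel_measurable_continuous_onI)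
    then show ?thesis using periodic_continuous_bounded[OF that] by (auto intro: integrable_torus_bounded measurable_torus)
  qed
  have per_mult: "periodic (\<lambda>x. f x * g x)" if "periodic f" "periodic g" for f g :: "real ^ 'n \<Rightarrow> complex"
    using that by (simp add: periodic_def)
  have i1: "integrable torusM (\<lambda>x. partial_deriv i \<phi> x * wave (- \<xi>) x)"
    by (intro bounded per_mult per' periodic_wave continuous_intros cont)
  have i2: "integrable torusM ?\<psi>"
    by (intro bounded per_mult per periodic_wave continuous_intros contphi)
  have "(LINT x|torusM. partial_deriv i ?\<psi> x) = 0"
  proof (rule integral_partial_deriv_eq_0)
    show "periodic ?\<psi>" by (intro per_mult per periodic_wave)
    show "?\<psi> differentiable (at x)" for x
      by (intro differentiable_mult diff differentiable_wave)
    show "periodic (partial_deriv i ?\<psi>)"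
      using per per' periodic_wave[of "- \<xi>"] by (simp add: periodic_def pd)
    show "continuous_on UNIV (partial_deriv i ?\<psi>)"
      unfolding pd[abs_def] by (intro continuous_intros cont contphi)
  qed
  then show ?thesis using i1 i2 by (simp add: pd)
qed

text \<open>Integration by parts against the constant function 1 gives \<open>freq \<xi> i\<close>
  times the integral equal to 0. A direction i with nonzero component then settles the case of
  nonzero frequency, and no iterated integral has to be evaluated.\<close>

lemma integral_wave: "(LINT x|torusM. wave \<xi> x) = (if \<xi> = 0 then 1 else 0)"
proof (cases "\<xi> = 0")
  case True
  then show ?thesis by (simp add: measure_torus)
next
  case False
  then obtain i where i: "\<xi> $ i \<noteq> 0" by (auto simp: vec_eq_iff)
  have pd0: "partial_deriv i (\<lambda>x :: real ^ 'a. 1) = (\<lambda>x. 0)"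
    by (intro ext partial_deriv_eq[of _ "\<lambda>_. 0"]) auto
  have "0 = 2 * of_real pi * \<i> * of_int ((- \<xi>) $ i) * (LINT x|torusM. 1 * wave (- (- \<xi>)) x)"
    using integral_partial_deriv_wave[of "\<lambda>_. 1" i "- \<xi>"] by (simp add: pd0 periodic_def)
  then show ?thesis using i False by simp
qed

section \<open>Smooth Fourier series\<close>

text \<open>The Fourier side of \<open>Cinf\<close>. Weighted summability is chosen instead of
  pointwise decay because it makes every differentiated series absolutely convergent at once;
  \<open>rapidI\<close> recovers it from pointwise decay of all orders.\<close>

definition rapid :: "(int ^ 'n \<Rightarrow> complex) \<Rightarrow> bool" where
  "rapid c \<longleftrightarrow> (\<forall>m::nat. (\<lambda>\<xi>. weight \<xi> ^ m * cmod (c \<xi>)) summable_on UNIV)"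

definition fourier_series :: "(int ^ 'n \<Rightarrow> complex) \<Rightarrow> real ^ 'n \<Rightarrow> complex" where
  "fourier_series c x = (\<Sum>\<^sub>\<infinity>\<xi>. c \<xi> * wave \<xi> x)"

definition derivative_symbol :: "'n list \<Rightarrow> int ^ 'n \<Rightarrow> complex" where
  "derivative_symbol is \<xi> = prod_list (map (\<lambda>i. freq \<xi> i) is)"

lemma rapid_dominated:
  assumes "rapid c" "\<And>\<xi>. cmod (d \<xi>) \<le> K * weight \<xi> ^ k * cmod (c \<xi>)"
  shows "rapid d"
  unfolding rapid_def
proof
  fix m
  have "(\<lambda>\<xi>. K * (weight \<xi> ^ (m + k) * cmod (c \<xi>))) summable_on UNIV"
    using assms(1) unfolding rapid_def by (intro summable_on_cmult_right) blast
  then show "(\<lambda>\<xi>. weight \<xi> ^ m * cmod (d \<xi>)) summable_on UNIV"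
  proof (rule summable_on_comparison_test)
    fix \<xi>
    have "weight \<xi> ^ m * cmod (d \<xi>) \<le> weight \<xi> ^ m * (K * weight \<xi> ^ k * cmod (c \<xi>))"
      using weight_pos[of \<xi>] by (intro mult_left_mono assms(2)) auto
    then show "weight \<xi> ^ m * cmod (d \<xi>) \<le> K * (weight \<xi> ^ (m + k) * cmod (c \<xi>))"
      by (simp add: power_add mult_ac)
  qed (intro mult_nonneg_nonneg zero_le_power less_imp_le[OF weight_pos] norm_ge_zero)
qed

lemma rapid_abs_summable:
  assumes "rapid c"
  shows "(\<lambda>\<xi>. cmod (c \<xi>)) summable_on UNIV"
  using assms unfolding rapid_def by (auto dest: spec[of _ 0])

lemma fourier_series_abs_summable:
  assumes "rapid c"
  shows "(\<lambda>\<xi>. norm (c \<xi> * wave \<xi> x)) summable_on UNIV"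
  using rapid_abs_summable[OF assms] by (simp add: norm_mult)

lemma fourier_series_summable:
  assumes "rapid c"
  shows "(\<lambda>\<xi>. c \<xi> * wave \<xi> x) summable_on UNIV"
  using fourier_series_abs_summable[OF assms] by (rule abs_summable_summable)

lemma norm_fourier_series_le:
  assumes "rapid c"
  shows "cmod (fourier_series c x) \<le> (\<Sum>\<^sub>\<infinity>\<xi>. cmod (c \<xi>))"
  unfolding fourier_series_def
  using norm_infsum_bound[OF fourier_series_abs_summable[OF assms]] by (simp add: norm_mult)

text \<open>The constant 7 is an integer above 2 pi.\<close>

lemma norm_freq_le: "cmod (freq \<xi> i) \<le> 7 * weight \<xi>"
proof -
  have "cmod (freq \<xi> i) = 2 * pi * \<bar>real_of_int (\<xi> $ i)\<bar>"
    by (simp add: norm_mult)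
  also have "\<dots> \<le> 7 * weight \<xi>"
    using pi_less_4 pi_approx abs_component_le_weight[of \<xi> i] by (intro mult_mono) auto
  finally show ?thesis .
qed

lemma rapid_freq:
  assumes "rapid c"
  shows "rapid (\<lambda>\<xi>. freq \<xi> i * c \<xi>)"
proof (rule rapid_dominated[OF assms])
  show "cmod (freq \<xi> i * c \<xi>) \<le> 7 * weight \<xi> ^ 1 * cmod (c \<xi>)" for \<xi>
    using mult_right_mono[OF norm_freq_le[of \<xi> i], of "cmod (c \<xi>)"] by (simp add: norm_mult)
qed

lemma norm_derivative_symbol_le: "cmod (derivative_symbol is \<xi>) \<le> (7 * weight \<xi>) ^ length is"
proof (induction "is")
  case (Cons i "is")
  then show ?case
    using mult_mono[OF norm_freq_le[of \<xi> i] Cons] weight_pos[of \<xi>]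
    by (simp add: derivative_symbol_def norm_mult)
qed (simp add: derivative_symbol_def)

text \<open>Termwise differentiation is a statement about sequences, so the lattice is enumerated by
  \<open>b\<close>; absolute summability makes the sums independent of this order. The majorant
  \<open>A\<close> does not depend on x, which gives the uniform convergence of the differentiated
  series.\<close>

lemma has_derivative_fourier_series:
  assumes c: "rapid (c :: int ^ 'n \<Rightarrow> complex)"
  shows "(fourier_series c has_derivative
    (\<lambda>h. \<Sum>\<^sub>\<infinity>\<xi>. c \<xi> * (2 * of_real pi * \<i> * of_real (\<Sum>i\<in>UNIV. h $ i * of_int (\<xi> $ i)) * wave \<xi> x))) (at x)"
proof -
  define b where "b = from_nat_into (UNIV :: (int ^ 'n) set)"
  have inf: "infinite (UNIV :: (int ^ 'n) set)"
  proof -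
    have "inj (\<lambda>k::int. (\<chi> i. k) :: int ^ 'n)" by (auto simp: inj_def vec_eq_iff)
    then show ?thesis using finite_imageD infinite_UNIV_int by (metis finite_subset top_greatest)
  qed
  have bij: "bij_betw b UNIV UNIV"
    unfolding b_def using inf by (intro bij_betw_from_nat_into) auto
  have sum_nat: "(\<lambda>n. f (b n)) sums infsum f UNIV" if "(\<lambda>\<xi>. norm (f \<xi>)) summable_on UNIV" for f :: "int ^ 'n \<Rightarrow> complex"
  proof -
    have "(f has_sum infsum f UNIV) UNIV" using that by (simp add: abs_summable_summable)
    then have "((\<lambda>n. f (b n)) has_sum infsum f UNIV) UNIV"
      using has_sum_reindex_bij_betw[OF bij] by fastforce
    then show ?thesis by (rule has_sum_imp_sums)
  qed
  let ?f' = "\<lambda>\<xi> x h. c \<xi> * (2 * of_real pi * \<i> * of_real (\<Sum>i\<in>UNIV. h $ i * of_int (\<xi> $ i)) * wave \<xi> x)"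
  define K where "K = 7 * real CARD('n)"
  define A where "A \<xi> = K * (weight \<xi> * cmod (c \<xi>))" for \<xi>
  have bound: "cmod (?f' \<xi> x h) \<le> A \<xi> * norm h" for \<xi> x h
  proof -
    have "\<bar>\<Sum>i\<in>UNIV. h $ i * of_int (\<xi> $ i)\<bar> \<le> (\<Sum>i\<in>UNIV. \<bar>h $ i\<bar> * \<bar>of_int (\<xi> $ i)\<bar>)"
      by (rule order_trans[OF sum_abs]) (simp add: abs_mult)
    also have "\<dots> \<le> (\<Sum>i\<in>(UNIV::'n set). norm h * weight \<xi>)"
      by (intro sum_mono mult_mono abs_component_le_weight component_le_norm_cart) auto
    finally have 1: "\<bar>\<Sum>i\<in>UNIV. h $ i * of_int (\<xi> $ i)\<bar> \<le> real CARD('n) * (norm h * weight \<xi>)" by simp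
    have "cmod (?f' \<xi> x h) = cmod (c \<xi>) * (2 * pi * \<bar>\<Sum>i\<in>UNIV. h $ i * of_int (\<xi> $ i)\<bar>)"
      by (simp add: norm_mult del: of_real_sum)
    also have "\<dots> \<le> cmod (c \<xi>) * (7 * (real CARD('n) * (norm h * weight \<xi>)))"
      using pi_approx by (intro mult_left_mono mult_mono 1) auto
    finally show ?thesis by (simp add: A_def K_def mult_ac)
  qed
  have A_sum: "A summable_on UNIV"
  proof -
    have "(\<lambda>\<xi>. weight \<xi> ^ 1 * cmod (c \<xi>)) summable_on UNIV" using c unfolding rapid_def by blast
    then show ?thesis unfolding A_def by (intro summable_on_cmult_right) simp
  qed
  have A_nonneg: "0 \<le> A \<xi>" for \<xi> using weight_pos[of \<xi>] by (simp add: A_def K_def)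
  have A_summable: "summable (\<lambda>n. A (b n))"
  proof -
    have "((\<lambda>n. A (b n)) has_sum infsum A UNIV) UNIV"
      using A_sum has_sum_reindex_bij_betw[OF bij, of A] by fastforce
    then show ?thesis by (rule sums_summable[OF has_sum_imp_sums])
  qed
  have f'_abs: "(\<lambda>\<xi>. norm (?f' \<xi> x h)) summable_on UNIV" for x h
    by (rule summable_on_comparison_test[OF summable_on_cmult_left[OF A_sum]]) (rule bound norm_ge_zero)+
  have "\<exists>g. \<forall>x\<in>UNIV. (\<lambda>n. c (b n) * wave (b n) x) sums g x \<and>
      (g has_derivative (\<lambda>h. \<Sum>\<^sub>\<infinity>\<xi>. ?f' \<xi> x h)) (at x within UNIV)"
  proof (rule has_derivative_series)
    show "((\<lambda>x. c (b n) * wave (b n) x) has_derivative ?f' (b n) x) (at x within UNIV)" for n x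
      by (intro has_derivative_mult_right has_derivative_wave)
    show "(\<lambda>n. c (b n) * wave (b n) 0) sums fourier_series c 0"
      unfolding fourier_series_def by (rule sum_nat[OF fourier_series_abs_summable[OF c]])
    fix e :: real assume "e > 0"
    from suminf_exist_split[OF this A_summable]
    obtain N where N: "\<And>n. n \<ge> N \<Longrightarrow> norm (\<Sum>i. A (b (i + n))) < e" by blast
    have "norm ((\<Sum>i<n. ?f' (b i) x h) - (\<Sum>\<^sub>\<infinity>\<xi>. ?f' \<xi> x h)) \<le> e * norm h" if n: "n \<ge> N" for n x h
    proof -
      let ?u = "\<lambda>i. ?f' (b i) x h"
      have s: "?u sums (\<Sum>\<^sub>\<infinity>\<xi>. ?f' \<xi> x h)" by (rule sum_nat[OF f'_abs])
      have "(\<Sum>\<^sub>\<infinity>\<xi>. ?f' \<xi> x h) = (\<Sum>i. ?u (i + n)) + (\<Sum>i<n. ?u i)"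
        using suminf_split_initial_segment[OF sums_summable[OF s], of n] sums_unique[OF s] by simp
      then have "norm ((\<Sum>i<n. ?u i) - (\<Sum>\<^sub>\<infinity>\<xi>. ?f' \<xi> x h)) = norm (\<Sum>i. ?u (i + n))"
        by (simp add: norm_minus_commute)
      also have "\<dots> \<le> (\<Sum>i. A (b (i + n)) * norm h)"
        by (intro norm_suminf_le bound summable_mult2 summable_ignore_initial_segment[OF A_summable])
      also have "\<dots> = (\<Sum>i. A (b (i + n))) * norm h"
        by (intro suminf_mult2[symmetric] summable_ignore_initial_segment[OF A_summable])
      also have "\<dots> \<le> e * norm h"
        using N[OF n] by (intro mult_right_mono) auto
      finally show ?thesis .
    qed
    then show "\<forall>\<^sub>F n in sequentially. \<forall>x\<in>UNIV. \<forall>h. norm ((\<Sum>i<n. ?f' (b i) x h) - (\<Sum>\<^sub>\<infinity>\<xi>. ?f' \<xi> x h)) \<le> e * norm h"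
      unfolding eventually_sequentially by blast
  qed auto
  then obtain g where g: "\<And>x. (\<lambda>n. c (b n) * wave (b n) x) sums g x"
      "\<And>x. (g has_derivative (\<lambda>h. \<Sum>\<^sub>\<infinity>\<xi>. ?f' \<xi> x h)) (at x)" by auto
  have "g = fourier_series c"
  proof
    show "g x = fourier_series c x" for x
      using g(1)[of x] sum_nat[OF fourier_series_abs_summable[OF c, of x]] sums_unique2
      unfolding fourier_series_def by blast
  qed
  then show ?thesis using g(2)[of x] by simp
qed

lemma partial_deriv_fourier_series:
  assumes "rapid c"
  shows "partial_deriv i (fourier_series c) = fourier_series (\<lambda>\<xi>. freq \<xi> i * c \<xi>)"
proof
  fix x
  have ax: "(\<Sum>j\<in>UNIV. axis i 1 $ j * of_int (\<xi> $ j)) = real_of_int (\<xi> $ i)" for \<xi>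
  proof -
    have "(\<Sum>j\<in>UNIV. axis i 1 $ j * of_int (\<xi> $ j)) = (\<Sum>j\<in>UNIV. if j = i then of_int (\<xi> $ i) else (0::real))"
      by (intro sum.cong) (auto simp: axis_def)
    then show ?thesis by simp
  qed
  show "partial_deriv i (fourier_series c) x = fourier_series (\<lambda>\<xi>. freq \<xi> i * c \<xi>) x"
    unfolding partial_deriv_eq[OF has_derivative_fourier_series[OF assms]] fourier_series_def ax
    by (simp add: mult_ac)
qed

lemma iterated_partial_fourier_series:
  assumes "rapid c"
  shows "iterated_partial is (fourier_series c) = fourier_series (\<lambda>\<xi>. derivative_symbol is \<xi> * c \<xi>)
    \<and> rapid (\<lambda>\<xi>. derivative_symbol is \<xi> * c \<xi>)"
  using assms
proof (induction "is" arbitrary: c)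
  case Nil
  then show ?case by (simp add: iterated_partial_def derivative_symbol_def)
next
  case (Cons i "is")
  have "iterated_partial (i # is) (fourier_series c)
      = iterated_partial is (fourier_series (\<lambda>\<xi>. freq \<xi> i * c \<xi>))"
    by (simp add: iterated_partial_def partial_deriv_fourier_series[OF Cons.prems])
  with Cons.IH[OF rapid_freq[OF Cons.prems], of i] show ?case
    by (simp add: derivative_symbol_def mult_ac)
qed

lemma fourier_series_Cinf:
  fixes c :: "int ^ 'n \<Rightarrow> complex"
  assumes "rapid c"
  shows "fourier_series c \<in> Cinf"
proof -
  have "fourier_series d differentiable (at x)" if "rapid d" for d x
    using has_derivative_fourier_series[OF that] by (rule differentiableI)
  then have "smooth (fourier_series c)"
    using iterated_partial_fourier_series[OF assms] unfolding smooth_def by metis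
  moreover have "periodic (fourier_series c)"
  proof -
    have "wave \<xi> (x + axis i 1) = wave \<xi> x" for \<xi> :: "int ^ 'n" and i x
      using periodic_wave unfolding periodic_def by blast
    then show ?thesis by (simp add: periodic_def fourier_series_def)
  qed
  ultimately show ?thesis by (simp add: Cinf_def)
qed

text \<open>
  \<open>Cm_norm\<close> is a supremum of reals, so even its nonnegativity depends on boundedness.
\<close>

lemma fourier_series_Cm_norm_le:
  assumes "rapid c"
  shows "0 \<le> Cm_norm m (fourier_series c)"
    and "Cm_norm m (fourier_series c) \<le> 7 ^ m * (\<Sum>\<^sub>\<infinity>\<xi>. weight \<xi> ^ m * cmod (c \<xi>))"
proof -
  let ?B = "7 ^ m * (\<Sum>\<^sub>\<infinity>\<xi>. weight \<xi> ^ m * cmod (c \<xi>))"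
  have summ: "(\<lambda>\<xi>. weight \<xi> ^ m * cmod (c \<xi>)) summable_on UNIV"
    using assms by (simp add: rapid_def)
  have bound: "cmod (iterated_partial is (fourier_series c) x) \<le> ?B" if "length is \<le> m" for "is" x
  proof -
    note it = iterated_partial_fourier_series[OF assms, of "is"]
    have "cmod (iterated_partial is (fourier_series c) x) \<le> (\<Sum>\<^sub>\<infinity>\<xi>. cmod (derivative_symbol is \<xi> * c \<xi>))"
      using it norm_fourier_series_le by metis
    also have "\<dots> \<le> (\<Sum>\<^sub>\<infinity>\<xi>. 7 ^ m * (weight \<xi> ^ m * cmod (c \<xi>)))"
    proof (rule infsum_mono)
      show "(\<lambda>\<xi>. cmod (derivative_symbol is \<xi> * c \<xi>)) summable_on UNIV"
        using it rapid_abs_summable by blast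
      show "(\<lambda>\<xi>. 7 ^ m * (weight \<xi> ^ m * cmod (c \<xi>))) summable_on UNIV"
        using summ by (rule summable_on_cmult_right)
      fix \<xi>
      have "cmod (derivative_symbol is \<xi>) \<le> (7 * weight \<xi>) ^ m"
        using norm_derivative_symbol_le[of "is" \<xi>] power_increasing[OF that, of "7 * weight \<xi>"] weight_ge_1[of \<xi>]
        by linarith
      from mult_right_mono[OF this, of "cmod (c \<xi>)"]
      show "cmod (derivative_symbol is \<xi> * c \<xi>) \<le> 7 ^ m * (weight \<xi> ^ m * cmod (c \<xi>))"
        by (simp add: norm_mult power_mult_distrib mult_ac)
    qed
    also have "\<dots> = ?B" using summ by (intro infsum_cmult_right) auto
    finally show ?thesis .
  qed
  show "Cm_norm m (fourier_series c) \<le> ?B"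
    unfolding Cm_norm_def by (rule cSUP_least) (auto intro: bound exI[of _ "[]"])
  have "0 \<le> cmod (iterated_partial [] (fourier_series c) 0)" by simp
  also have "\<dots> \<le> Cm_norm m (fourier_series c)"
    unfolding Cm_norm_def
    by (rule cSUP_upper2[where x = "([], 0)"]) (auto intro!: bdd_aboveI[of _ ?B] bound)
  finally show "0 \<le> Cm_norm m (fourier_series c)" .
qed

section \<open>Finite Fourier series and truncation\<close>

lemma rapid_finite_support:
  assumes "finite {\<xi>. c \<xi> \<noteq> 0}"
  shows "rapid c"
  unfolding rapid_def
proof
  fix m
  show "(\<lambda>\<xi>. weight \<xi> ^ m * cmod (c \<xi>)) summable_on UNIV"
    by (rule summable_on_cong_neutral[THEN iffD1, OF _ _ _ summable_on_finite[OF assms, of "\<lambda>\<xi>. weight \<xi> ^ m * cmod (c \<xi>)"]]) auto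
qed

lemma wave_eq_fourier_series: "wave \<xi> = fourier_series (\<lambda>\<eta>. if \<eta> = \<xi> then 1 else 0)"
proof
  fix x
  have "(\<Sum>\<^sub>\<infinity>\<eta>. (if \<eta> = \<xi> then 1 else 0) * wave \<eta> x) = (\<Sum>\<^sub>\<infinity>\<eta>\<in>{\<xi>}. wave \<eta> x)"
    by (rule infsum_cong_neutral) auto
  then show "wave \<xi> x = fourier_series (\<lambda>\<eta>. if \<eta> = \<xi> then 1 else 0) x"
    by (simp add: fourier_series_def)
qed

lemma wave_Cinf: "wave \<xi> \<in> Cinf"
  unfolding wave_eq_fourier_series by (intro fourier_series_Cinf rapid_finite_support) simp

lemma fourier_series_restrict_add:
  assumes "rapid c"
  shows "rapid (\<lambda>\<xi>. if \<xi> \<in> F then c \<xi> else 0)"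
    and "fourier_series c x = fourier_series (\<lambda>\<xi>. if \<xi> \<in> F then c \<xi> else 0) x
      + fourier_series (\<lambda>\<xi>. if \<xi> \<in> F then 0 else c \<xi>) x"
proof -
  have r: "rapid (\<lambda>\<xi>. if P \<xi> then c \<xi> else 0)" for P
    by (rule rapid_dominated[OF assms, of _ 1 0]) auto
  show "rapid (\<lambda>\<xi>. if \<xi> \<in> F then c \<xi> else 0)" by (rule r)
  have r': "rapid (\<lambda>\<xi>. if \<xi> \<in> F then 0 else c \<xi>)"
    using r[of "\<lambda>\<xi>. \<xi> \<notin> F"] by (rule back_subst[of rapid]) auto
  show "fourier_series c x = fourier_series (\<lambda>\<xi>. if \<xi> \<in> F then c \<xi> else 0) x
      + fourier_series (\<lambda>\<xi>. if \<xi> \<in> F then 0 else c \<xi>) x"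
    unfolding fourier_series_def
    by (subst infsum_add[symmetric, OF fourier_series_summable[OF r] fourier_series_summable[OF r']])
      (auto intro!: infsum_cong)
qed

lemma fourier_series_finite:
  assumes "finite F"
  shows "fourier_series (\<lambda>\<xi>. if \<xi> \<in> F then c \<xi> else 0) x = (\<Sum>\<xi>\<in>F. c \<xi> * wave \<xi> x)"
proof -
  have "(\<Sum>\<^sub>\<infinity>\<xi>. (if \<xi> \<in> F then c \<xi> else 0) * wave \<xi> x) = (\<Sum>\<^sub>\<infinity>\<xi>\<in>F. c \<xi> * wave \<xi> x)"
    by (rule infsum_cong_neutral) auto
  then show ?thesis using assms by (simp add: fourier_series_def)
qed

section \<open>Uniqueness of Fourier coefficients\<close>

text \<open>Given by closure rules rather than as finite sums, so that linear statements follow by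
  induction and membership follows from the introduction rules. Closure under products is
  derived.\<close>

inductive trig :: "(real ^ 'n \<Rightarrow> complex) \<Rightarrow> bool" where
  wave: "trig (wave \<xi>)"
| scale: "trig p \<Longrightarrow> trig (\<lambda>x. c * p x)"
| add: "trig p \<Longrightarrow> trig q \<Longrightarrow> trig (\<lambda>x. p x + q x)"

lemma trig_mult:
  assumes "trig p" "trig q"
  shows "trig (\<lambda>x. p x * q x)"
  using assms(1)
proof induction
  case (wave \<xi>)
  from assms(2) show ?case
  proof induction
    case (wave \<eta>)
    then show ?case using trig.wave[of "\<xi> + \<eta>"] by (simp add: wave_add[abs_def])
  next
    case (scale p c)
    then show ?case using trig.scale[of _ c] by (simp add: mult.left_commute)
  next
    case (add p q)
    then show ?case using trig.add by (fastforce simp: distrib_left)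
  qed
next
  case (scale p c)
  then show ?case using trig.scale[of _ c] by (simp add: mult.assoc)
next
  case (add p q)
  then show ?case using trig.add by (fastforce simp: distrib_right)
qed

lemma trig_bounded_measurable:
  assumes "trig p"
  shows "p \<in> borel_measurable borel \<and> (\<exists>B. \<forall>x. cmod (p x) \<le> B)"
  using assms
proof induction
  case (scale p c)
  then obtain B where "\<And>x. cmod (p x) \<le> B" by blast
  then have "cmod (c * p x) \<le> cmod c * B" for x by (simp add: norm_mult mult_left_mono)
  then show ?case using scale by auto
next
  case (add p q)
  then obtain B B' where "\<And>x. cmod (p x) \<le> B" "\<And>x. cmod (q x) \<le> B'" by blast
  then have "cmod (p x + q x) \<le> B + B'" for x by (intro norm_triangle_mono)
  then show ?case using add by auto
qed auto

lemma integral_trig_eq_0: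
  assumes g: "integrable torusM g" and 0: "\<And>\<xi>. (LINT x|torusM. g x * wave \<xi> x) = 0"
    and "trig p"
  shows "(LINT x|torusM. g x * p x) = 0"
  using \<open>trig p\<close>
proof induction
  case (scale p c)
  have "(LINT x|torusM. g x * (c * p x)) = (LINT x|torusM. c * (g x * p x))"
    by (simp only: mult.left_commute)
  then show ?case using scale by simp
next
  case (add p q)
  have "integrable torusM (\<lambda>x. g x * r x)" if "trig r" for r
    using trig_bounded_measurable[OF that] g by (auto intro!: integrable_mult_bounded measurable_torus)
  then show ?case using add by (simp add: distrib_left)
qed (rule 0)

text \<open>
  Trigonometric polynomials are dense in the continuous functions by the Stone-Weierstrass theorem on
  the image of the torus in complex space, where they become polynomials. Hence an integrable \<open>g\<close> without
  Fourier coefficients is orthogonal to indicators of closed sets, by a Dynkin argument to all Borel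
  sets of the image, and so, since the torus embeds measurably, to all Borel subsets of the torus.
\<close>

definition circles :: "(complex ^ 'n) set" where
  "circles = {z. \<forall>i. cmod (z $ i) = 1}"

text \<open>The half-open cell has a seam where opposite faces should meet. On the compact image
  under this map the seam is gone, and continuous functions there pull back to periodic continuous
  functions.\<close>

definition circle_map :: "real ^ 'n \<Rightarrow> complex ^ 'n" where
  "circle_map x = (\<chi> i. wave (axis i 1) x)"

lemma wave_axis_eq: "wave (axis i 1) x = cis (2 * pi * x $ i)"
proof -
  have "(\<Sum>j\<in>UNIV. x $ j * of_int (axis i 1 $ j)) = (\<Sum>j\<in>UNIV. if j = i then x $ i else 0)"
    by (intro sum.cong) (auto simp: axis_def)
  then show ?thesis by (simp add: wave_def cis_conv_exp mult_ac)
qed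

lemma circle_map_in_circles: "circle_map x \<in> circles"
  by (simp add: circles_def circle_map_def)

lemma compact_circles: "compact (circles :: (complex ^ 'n) set)"
proof -
  have "closed (circles :: (complex ^ 'n) set)"
    unfolding circles_def by (intro closed_Collect_all closed_Collect_eq continuous_intros)
  moreover have "norm z \<le> real CARD('n)" if "z \<in> circles" for z :: "complex ^ 'n"
    using L2_set_le_sum[of UNIV "\<lambda>i. norm (z $ i)"] that by (simp add: norm_vec_def circles_def)
  then have "bounded (circles :: (complex ^ 'n) set)" by (auto simp: bounded_iff)
  ultimately show ?thesis by (simp add: compact_eq_bounded_closed)
qed

lemma circle_map_measurable [measurable]: "circle_map \<in> borel_measurable borel"
  unfolding circle_map_def[abs_def]
  by (intro borel_measurable_continuous_onI continuous_intros)

text \<open>Stone-Weierstrass for the ring of real continuous functions on \<open>circles\<close>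
  whose pullback is a trigonometric polynomial. Real and imaginary parts of the coordinates separate
  points and pull back to cosines and sines, which are combinations of a wave and its
  conjugate.\<close>

lemma trig_approximation:
  fixes F :: "complex ^ 'n \<Rightarrow> real"
  assumes "continuous_on circles F" "e > 0"
  shows "\<exists>p. trig p \<and> (\<forall>x. cmod (of_real (F (circle_map x)) - p x) < e)"
proof -
  define R where "R = {f :: complex ^ 'n \<Rightarrow> real. continuous_on circles f \<and> trig (\<lambda>x. of_real (f (circle_map x)))}"
  have trig_Re: "trig (\<lambda>x. of_real (Re (circle_map x $ i)))" for i
  proof -
    have "trig (\<lambda>x. (1/2) * (wave (axis i 1) x + wave (- axis i 1) x))"
      by (intro trig.intros)
    then show ?thesis by (simp add: circle_map_def complex_add_cnj cnj_wave[symmetric])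
  qed
  have trig_Im: "trig (\<lambda>x. of_real (Im (circle_map x $ i)))" for i
  proof -
    have "trig (\<lambda>x. (1/(2*\<i>)) * (wave (axis i 1) x + (-1) * wave (- axis i 1) x))"
      by (intro trig.intros)
    moreover have "(1/(2*\<i>)) * (wave (axis i 1) x + (-1) * wave (- axis i 1) x) = of_real (Im (circle_map x $ i))" for x
      by (simp add: circle_map_def cnj_wave[symmetric] complex_eq_iff)
    ultimately show ?thesis by simp
  qed
  interpret function_ring_on R circles
  proof
    show "compact (circles :: (complex ^ 'n) set)" by (rule compact_circles)
    show "(\<lambda>x. f x + g x) \<in> R" if "f \<in> R" "g \<in> R" for f g
      using that trig.add by (auto simp: R_def intro!: continuous_intros)
    show "(\<lambda>x. f x * g x) \<in> R" if "f \<in> R" "g \<in> R" for f g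
      using that trig_mult by (auto simp: R_def intro!: continuous_intros)
    show "(\<lambda>_. c) \<in> R" for c
      using trig.scale[OF trig.wave[of 0], of "of_real c"] by (simp add: R_def)
    show "\<exists>f\<in>R. f x \<noteq> f y" if xy: "x \<noteq> y" for x y
    proof -
      obtain i where "x $ i \<noteq> y $ i" using xy by (auto simp: vec_eq_iff)
      then have ne: "Re (x $ i) \<noteq> Re (y $ i) \<or> Im (x $ i) \<noteq> Im (y $ i)" by (auto simp: complex_eq_iff)
      have R: "(\<lambda>z. Re (z $ i)) \<in> R" "(\<lambda>z. Im (z $ i)) \<in> R"
        using trig_Re trig_Im by (auto simp: R_def intro!: continuous_intros)
      from ne show ?thesis
        by (elim disjE) (rule bexI[OF _ R(1)], assumption, rule bexI[OF _ R(2)], assumption)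
    qed
  qed (simp add: R_def)
  obtain f where f: "f \<in> R" "\<And>x. x \<in> circles \<Longrightarrow> \<bar>F x - f x\<bar> < e"
    using Stone_Weierstrass_basic[OF assms] by blast
  have "cmod (of_real (F (circle_map x)) - of_real (f (circle_map x))) < e" for x
    using f(2)[OF circle_map_in_circles[of x]] by (simp add: of_real_diff[symmetric] del: of_real_diff)
  then show ?thesis using f(1) unfolding R_def by blast
qed

lemma integral_circle_map_eq_0:
  fixes F :: "complex ^ 'n \<Rightarrow> real"
  assumes g: "integrable torusM g" and 0: "\<And>\<xi>. (LINT x|torusM. g x * wave \<xi> x) = 0"
    and F: "continuous_on UNIV F"
  shows "(LINT x|torusM. g x * of_real (F (circle_map x))) = 0"
proof (rule ccontr)
  let ?I = "LINT x|torusM. g x * of_real (F (circle_map x))"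
  assume "?I \<noteq> 0"
  have [measurable]: "F \<in> borel_measurable borel" using F by (rule borel_measurable_continuous_onI)
  have Fcm: "(\<lambda>x. complex_of_real (F (circle_map x))) \<in> borel_measurable borel" by measurable
  define N where "N = (LINT x|torusM. cmod (g x))"
  have N: "0 \<le> N" by (simp add: N_def)
  \<comment> \<open>Chosen so that the approximation error, at most \<open>N * e\<close>, stays
    below half of the integral that is assumed nonzero. The summand 1 keeps the quotient meaningful
    when N is 0.\<close>
  define e where "e = cmod ?I / 2 / (N + 1)"
  have e: "e > 0" using \<open>?I \<noteq> 0\<close> N by (simp add: e_def)
  have cF: "continuous_on circles F" using F by (rule continuous_on_subset) simp
  obtain p where p: "trig p" "\<And>x. cmod (of_real (F (circle_map x)) - p x) < e"
    using trig_approximation[OF cF e] by blast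
  have pm: "p \<in> borel_measurable borel" using trig_bounded_measurable[OF p(1)] by blast
  obtain B where B: "\<And>x. cmod (p x) \<le> B" using trig_bounded_measurable[OF p(1)] by blast
  have i1: "integrable torusM (\<lambda>x. g x * p x)"
    using g pm B by (intro integrable_mult_bounded measurable_torus)
  have i2: "integrable torusM (\<lambda>x. g x * (of_real (F (circle_map x)) - p x))"
    using g pm Fcm p(2) by (intro integrable_mult_bounded[where B = e] measurable_torus borel_measurable_diff) (auto intro: less_imp_le)
  have "?I = (LINT x|torusM. g x * p x + g x * (of_real (F (circle_map x)) - p x))"
    by (simp add: algebra_simps)
  also have "\<dots> = (LINT x|torusM. g x * (of_real (F (circle_map x)) - p x))"
    using i1 i2 integral_trig_eq_0[OF g 0 p(1)] by simp
  finally have I_eq: "?I = (LINT x|torusM. g x * (of_real (F (circle_map x)) - p x))" .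
  have "cmod ?I \<le> (LINT x|torusM. cmod (g x * (of_real (F (circle_map x)) - p x)))"
    unfolding I_eq by (rule integral_norm_bound)
  also have "\<dots> \<le> (LINT x|torusM. cmod (g x) * e)"
  proof (rule integral_mono)
    show "integrable torusM (\<lambda>x. cmod (g x * (of_real (F (circle_map x)) - p x)))"
      using i2 by (rule integrable_norm)
    show "integrable torusM (\<lambda>x. cmod (g x) * e)" using g by simp
    show "cmod (g x * (of_real (F (circle_map x)) - p x)) \<le> cmod (g x) * e" for x
      unfolding norm_mult by (intro mult_left_mono less_imp_le[OF p(2)] norm_ge_zero)
  qed
  also have "\<dots> = N * e" by (simp add: N_def)
  also have "\<dots> \<le> (N + 1) * e" using e by simp
  also have "\<dots> = cmod ?I / 2"
  proof -
    have "N + 1 \<noteq> 0" using N by linarith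
    then have "cmod ?I / 2 = e * (N + 1)"
      unfolding e_def by (rule nonzero_divide_eq_eq[THEN iffD1, OF _ refl])
    then show ?thesis by (simp only: mult.commute)
  qed
  finally show False using \<open>?I \<noteq> 0\<close> by simp
qed

lemma integral_circle_map_closed_eq_0:
  fixes K :: "(complex ^ 'n) set"
  assumes g: "integrable torusM g" and 0: "\<And>\<xi>. (LINT x|torusM. g x * wave \<xi> x) = 0"
    and K: "closed K"
  shows "(LINT x|torusM. g x * indicator K (circle_map x)) = 0"
\<comment> \<open>The distance \<open>infdist\<close> to the empty set is 0 by convention, so the
  cut-offs below would be constantly 1 for empty K.\<close>
proof (cases "K = {}")
  case False
  \<comment> \<open>Continuous cut-offs equal to 1 on K and, for positive k, equal to 0 at distance
    at least 1/k. Since K is closed, they converge pointwise to its indicator.\<close>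
  define F where "F k z = max 0 (1 - real k * infdist z K)" for k z
  have cont: "continuous_on UNIV (F k)" for k
    unfolding F_def by (intro continuous_intros)
  then have [measurable]: "F k \<in> borel_measurable borel" for k by (rule borel_measurable_continuous_onI)
  have [measurable]: "K \<in> sets borel" using K by (rule borel_closed)
  have gm [measurable]: "g \<in> borel_measurable torusM" using g by simp
  have lim: "(\<lambda>k. F k z) \<longlonglongrightarrow> indicator K z" for z
  proof (cases "z \<in> K")
    case True
    then show ?thesis by (simp add: F_def)
  next
    case False
    then have d: "infdist z K > 0"
      using in_closed_iff_infdist_zero[OF K \<open>K \<noteq> {}\<close>, of z] infdist_nonneg[of z K] by linarith
    obtain k0 where "1 / infdist z K < real k0" using reals_Archimedean2 by blast
    then have "F k z = 0" if "k \<ge> k0" for k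
    proof -
      have "1 < real k0 * infdist z K" using \<open>1 / infdist z K < real k0\<close> d by (simp add: field_simps)
      also have "\<dots> \<le> real k * infdist z K" using that d by (intro mult_right_mono) auto
      finally show ?thesis by (simp add: F_def)
    qed
    then have "eventually (\<lambda>k. F k z = indicator K z) sequentially"
      using False unfolding eventually_sequentially by auto
    then show ?thesis by (rule tendsto_eventually)
  qed
  have "(\<lambda>k. LINT x|torusM. g x * of_real (F k (circle_map x)))
      \<longlonglongrightarrow> (LINT x|torusM. g x * of_real (indicator K (circle_map x)))"
  proof (rule integral_dominated_convergence[where w = "\<lambda>x. cmod (g x)"])
    have "(\<lambda>x. complex_of_real (F k (circle_map x))) \<in> borel_measurable borel" for k by measurable
    from measurable_torus[OF this]
    show "(\<lambda>x. g x * of_real (F k (circle_map x))) \<in> borel_measurable torusM" for k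
      by (intro borel_measurable_times[of g torusM] gm)
    have "(\<lambda>x. complex_of_real (indicator K (circle_map x))) \<in> borel_measurable borel" by measurable
    from measurable_torus[OF this]
    show "(\<lambda>x. g x * of_real (indicator K (circle_map x))) \<in> borel_measurable torusM"
      by (intro borel_measurable_times[of g torusM] gm)
    show "AE x in torusM. (\<lambda>k. g x * of_real (F k (circle_map x))) \<longlonglongrightarrow> g x * of_real (indicator K (circle_map x))"
      by (intro AE_I2 tendsto_intros lim)
    have "\<bar>F k z\<bar> \<le> 1" for k z using infdist_nonneg[of z K] by (simp add: F_def)
    then show "AE x in torusM. cmod (g x * of_real (F k (circle_map x))) \<le> cmod (g x)" for k
      by (intro AE_I2) (simp add: norm_mult mult_left_le)
  qed (use g in simp)
  moreover have "(LINT x|torusM. g x * of_real (F k (circle_map x))) = 0" for k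
    by (rule integral_circle_map_eq_0[OF g 0 cont])
  ultimately have "(LINT x|torusM. g x * of_real (indicator K (circle_map x))) = 0"
    by (simp add: LIMSEQ_const_iff)
  moreover have "complex_of_real (indicator K z) = indicator K z" for z by (simp add: indicator_def)
  ultimately show ?thesis by simp
qed simp

lemma integral_circle_map_borel_eq_0:
  fixes A :: "(complex ^ 'n) set"
  assumes g: "integrable torusM g" and 0: "\<And>\<xi>. (LINT x|torusM. g x * wave \<xi> x) = 0"
    and A: "A \<in> sets borel"
  shows "(LINT x|torusM. g x * indicator A (circle_map x)) = 0"
proof -
  have int: "integrable torusM (\<lambda>x. g x * indicator A (circle_map x))"
    if [measurable]: "A \<in> sets borel" for A :: "(complex ^ 'n) set"
  proof -
    have "(\<lambda>x. indicator A (circle_map x) :: complex) \<in> borel_measurable borel" by measurable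
    then show ?thesis
      by (intro integrable_mult_bounded[OF g, where B = 1] measurable_torus) (auto simp: indicator_def)
  qed
  have sb: "sets borel = sigma_sets UNIV (Collect closed :: (complex ^ 'n) set set)"
    by (simp add: borel_eq_closed)
  have Int_closed: "Int_stable (Collect closed :: (complex ^ 'n) set set)"
    by (auto simp: Int_stable_def)
  have Pow_closed: "(Collect closed :: (complex ^ 'n) set set) \<subseteq> Pow UNIV" by simp
  have "A \<in> sigma_sets UNIV (Collect closed)" using A by (simp only: sb)
  then show ?thesis
  proof (induction rule: sigma_sets_induct_disjoint[OF Int_closed Pow_closed, consumes 1, case_names basic empty compl union])
    case (basic A)
    then show ?case using integral_circle_map_closed_eq_0[OF g 0] by simp
  next
    case empty
    then show ?case by simp
  next
    case (compl A)
    have "g x * indicator (UNIV - A) (circle_map x) = g x - g x * indicator A (circle_map x)" for x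
      by (simp add: indicator_def)
    moreover have "integrable torusM (\<lambda>x. g x * indicator A (circle_map x))"
      using compl by (intro int) (simp only: sb)
    \<comment> \<open>Passing to the complement requires the integral over the whole torus to
      vanish, which is the hypothesis at frequency 0.\<close>
    moreover have "(LINT x|torusM. g x) = 0" using 0[of 0] by simp
    ultimately show ?case using compl g by simp
  next
    case (union A)
    have meas: "A i \<in> sets borel" for i using union by (auto simp: sb)
    define U where "U k = (\<Union>i<k. A i)" for k :: nat
    have Um [measurable]: "U k \<in> sets borel" for k using meas by (auto simp: U_def)
    have UNm [measurable]: "(\<Union>i. A i) \<in> sets borel" using meas by auto
    have "(LINT x|torusM. g x * indicator (U k) (circle_map x)) = 0" for k
    proof -
      have "disjoint_family_on A {..<k}" using union(1) by (auto simp: disjoint_family_on_def)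
      then have "g x * indicator (U k) (circle_map x) = (\<Sum>i<k. g x * indicator (A i) (circle_map x))" for x
        unfolding U_def by (subst indicator_UN_disjoint) (simp_all add: sum_distrib_left)
      then have "(LINT x|torusM. g x * indicator (U k) (circle_map x))
          = (LINT x|torusM. (\<Sum>i<k. g x * indicator (A i) (circle_map x)))"
        by (intro Bochner_Integration.integral_cong) auto
      also have "\<dots> = (\<Sum>i<k. LINT x|torusM. g x * indicator (A i) (circle_map x))"
        by (intro Bochner_Integration.integral_sum int meas)
      also have "\<dots> = 0" by (simp add: union(3))
      finally show ?thesis .
    qed
    moreover have "(\<lambda>k. LINT x|torusM. g x * indicator (U k) (circle_map x))
        \<longlonglongrightarrow> (LINT x|torusM. g x * indicator (\<Union>i. A i) (circle_map x))"
    proof (rule integral_dominated_convergence[where w = "\<lambda>x. cmod (g x)"])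
      show "AE x in torusM. (\<lambda>k. g x * indicator (U k) (circle_map x)) \<longlonglongrightarrow> g x * indicator (\<Union>i. A i) (circle_map x)"
        unfolding U_def by (intro AE_I2 tendsto_mult_left LIMSEQ_indicator_UN)
    qed (use int[OF Um] int[OF UNm] g in \<open>auto simp: norm_mult indicator_def\<close>)
    ultimately show ?case by (simp add: LIMSEQ_const_iff)
  qed
qed

text \<open>The argument is continuous off the nonnegative real axis and equals 0 on that axis, so
  cutting it off there changes nothing.\<close>

lemma borel_measurable_Arg2pi [measurable]: "Arg2pi \<in> borel_measurable borel"
proof -
  have "(\<lambda>z. indicator (- \<real>\<^sub>\<ge>\<^sub>0) z *\<^sub>R Arg2pi z) \<in> borel_measurable borel"
    by (intro borel_measurable_continuous_on_indicator borel_comp borel_closed closed_nonneg_Reals_complex)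
      (auto intro!: continuous_at_imp_continuous_on continuous_at_Arg2pi)
  moreover have "indicator (- \<real>\<^sub>\<ge>\<^sub>0) z *\<^sub>R Arg2pi z = Arg2pi z" for z
    using Arg2pi_eq_0[of z] by (auto simp: indicator_def complex_nonneg_Reals_iff complex_is_Real_iff)
  then have "(\<lambda>z. indicator (- \<real>\<^sub>\<ge>\<^sub>0) z *\<^sub>R Arg2pi z) = Arg2pi" by (rule ext)
  ultimately show ?thesis by (simp only:)
qed

lemma AE_torus_eq_0:
  assumes g: "integrable torusM g" and 0: "\<And>\<xi>. (LINT x|torusM. g x * wave \<xi> x) = 0"
  shows "AE x in torusM. g x = 0"
proof (rule torus.density_zero[OF g])
  fix B :: "(real ^ 'a) set" assume "B \<in> sets torusM"
  then have B [measurable]: "B \<in> sets borel" and sub: "B \<subseteq> torus"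
    unfolding torusM_def by (auto simp: sets_restrict_space_iff[OF torus_lborel])
  \<comment> \<open>A Borel left inverse of \<open>circle_map\<close> on the torus. Within the torus
    it presents an arbitrary Borel subset B as the preimage under \<open>circle_map\<close> of a
    Borel set, the only kind of set tested so far.\<close>
  define inv :: "complex ^ 'a \<Rightarrow> real ^ 'a" where "inv z = (\<chi> i. Arg2pi (z $ i) / (2 * pi))" for z
  have "(\<lambda>z. Arg2pi (z $ i) / (2 * pi)) \<in> borel_measurable borel" for i :: 'a
  proof -
    have [measurable]: "(\<lambda>z :: complex ^ 'a. z $ i) \<in> borel_measurable borel"
      by (intro borel_measurable_continuous_onI continuous_intros)
    show ?thesis by measurable
  qed
  then have inv_m: "inv \<in> borel_measurable borel"
    unfolding borel_measurable_euclidean_space[of inv] by (auto simp: Basis_vec_def inner_axis inv_def)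
  have inv: "inv (circle_map x) = x" if "x \<in> torus" for x
  proof -
    have "Arg2pi (cis (2 * pi * x $ i)) = 2 * pi * x $ i" for i
      using that by (intro Arg2pi_unique[of 1]) (auto simp: cis_conv_exp torus_def)
    then show ?thesis by (simp add: inv_def circle_map_def wave_axis_eq vec_eq_iff)
  qed
  have "inv -` B \<in> sets borel" using measurable_sets_borel[OF inv_m B] by simp
  then have "(LINT x|torusM. g x * indicator (inv -` B) (circle_map x)) = 0"
    by (rule integral_circle_map_borel_eq_0[OF g 0])
  moreover have "(LINT x|torusM. g x * indicator (inv -` B) (circle_map x))
      = (LINT x|torusM. indicator B x *\<^sub>R g x)"
    by (intro Bochner_Integration.integral_cong) (auto simp: indicator_def inv)
  ultimately show "set_lebesgue_integral torusM B g = 0"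
    by (simp add: set_lebesgue_integral_def)
qed

lemma AE_torus_eq:
  fixes g h :: "real ^ 'n \<Rightarrow> complex"
  assumes "integrable torusM g" "integrable torusM h"
    and "\<And>\<xi>. (LINT x|torusM. g x * wave \<xi> x) = (LINT x|torusM. h x * wave \<xi> x)"
  shows "AE x in torusM. g x = h x"
proof -
  have "integrable torusM (\<lambda>x. f x * wave \<xi> x)" if "integrable torusM f" for f and \<xi> :: "int ^ 'n"
    using that by (intro integrable_mult_bounded[where B = 1] measurable_torus) auto
  then have "AE x in torusM. g x - h x = 0"
    using assms by (intro AE_torus_eq_0) (auto simp: left_diff_distrib)
  then show ?thesis by (simp only: right_minus_eq)
qed

text \<open>The set where f is nonzero inside the open cube is open and null, hence empty.
  Continuity extends the vanishing to the closed cube, and periodicity to the whole space.\<close>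

lemma periodic_eq_0_everywhere:
  fixes f :: "real ^ 'n \<Rightarrow> complex"
  assumes per: "periodic f" and cont: "continuous_on UNIV f" and ae: "AE x in torusM. f x = 0"
  shows "f x = 0"
proof -
  have "AE x in lborel. x \<in> torus \<longrightarrow> f x = 0"
    using ae unfolding torusM_def by (subst (asm) AE_restrict_space_iff[OF torus_lborel]) simp
  then have "AE x in lborel. \<not> (x \<in> box 0 1 \<and> f x \<noteq> 0)"
    by eventually_elim (use box_subset_torus in blast)
  moreover have "open {x \<in> box 0 1. f x \<noteq> 0}"
  proof -
    have "open (f -` (- {0}))"
      using cont by (intro open_vimage) auto
    then have "open (box 0 1 \<inter> f -` (- {0}))" by (intro open_Int open_box)
    moreover have "box 0 1 \<inter> f -` (- {0}) = {x \<in> box 0 1. f x \<noteq> 0}" by auto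
    ultimately show ?thesis by simp
  qed
  moreover have "{x \<in> box 0 1. f x \<noteq> 0} \<in> null_sets lborel"
    using calculation by (subst AE_iff_null_sets) (auto intro: borel_open)
  ultimately have "{x \<in> box 0 1. f x \<noteq> 0} = {}"
    using open_not_negligible[of "{x \<in> box 0 1. f x \<noteq> 0}"] null_sets_completionI negligible_iff_null_sets by blast
  then have "f x = 0" if "x \<in> box 0 1" for x using that by blast
  then have cl: "f x = 0" if "x \<in> closure (box 0 1)" for x
    using continuous_constant_on_closure[of "box 0 1" f 0 x] that continuous_on_subset[OF cont] by blast
  have "box 0 (1 :: real ^ 'n) \<noteq> {}"
    by (auto simp: interval_ne_empty_cart)
  then have "closure (box 0 (1 :: real ^ 'n)) = cbox 0 1" by (rule closure_box)
  then have "f (\<chi> i. frac (x $ i)) = 0"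
    using cl torus_subset_cbox frac_in_torus[of x] by blast
  then show ?thesis by (simp add: periodic_frac[OF per])
qed

section \<open>Distributions and their Fourier series\<close>

text \<open>Tails are written as sums over the whole index type with some terms replaced by 0, the
  form in which truncated coefficient families arise later.\<close>

lemma infsum_tail_less:
  fixes f :: "'a \<Rightarrow> real"
  assumes f: "f summable_on UNIV" and e: "e > 0"
  shows "\<exists>F. finite F \<and> (\<forall>G. finite G \<and> F \<subseteq> G \<longrightarrow> (\<Sum>\<^sub>\<infinity>x. if x \<in> G then 0 else f x) < e)"
proof -
  have "(f has_sum infsum f UNIV) UNIV" using f by simp
  then have "\<forall>\<^sub>F G in finite_subsets_at_top UNIV. dist (sum f G) (infsum f UNIV) < e"
    unfolding has_sum_def using e by (rule tendstoD)
  then obtain F where F: "finite F" "\<And>G. finite G \<Longrightarrow> F \<subseteq> G \<Longrightarrow> dist (sum f G) (infsum f UNIV) < e"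
    unfolding eventually_finite_subsets_at_top by auto
  have "(\<Sum>\<^sub>\<infinity>x. if x \<in> G then 0 else f x) < e" if "finite G" "F \<subseteq> G" for G
  proof -
    have "infsum f (UNIV - G) = infsum f UNIV - infsum f G"
      using f that by (intro infsum_Diff) auto
    moreover have "(\<Sum>\<^sub>\<infinity>x. if x \<in> G then 0 else f x) = infsum f (UNIV - G)"
      by (rule infsum_cong_neutral) auto
    ultimately show ?thesis using F(2)[OF that] that by (simp add: dist_real_def)
  qed
  then show ?thesis using F(1) by blast
qed

section \<open>Test functions and elementary properties of distributions\<close>

lemma Cinf_differentiable: "\<phi> \<in> Cinf \<Longrightarrow> \<phi> differentiable (at x)"
  unfolding Cinf_def smooth_def by (auto dest: spec[of _ "[]"] simp: iterated_partial_def)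

lemma Cinf_periodic: "\<phi> \<in> Cinf \<Longrightarrow> periodic \<phi>"
  by (simp add: Cinf_def)

lemma Cinf_continuous: "\<phi> \<in> Cinf \<Longrightarrow> continuous_on UNIV \<phi>"
  using Cinf_differentiable
  by (auto simp: continuous_on_eq_continuous_at intro: differentiable_imp_continuous_within)

lemma Cinf_measurable: "\<phi> \<in> Cinf \<Longrightarrow> \<phi> \<in> borel_measurable borel"
  by (intro borel_measurable_continuous_onI Cinf_continuous)

lemma Cinf_bounded: "\<phi> \<in> Cinf \<Longrightarrow> \<exists>B. \<forall>x. cmod (\<phi> x) \<le> B"
  by (intro periodic_continuous_bounded Cinf_periodic Cinf_continuous)

lemma Cinf_integrable:
  assumes "\<phi> \<in> Cinf"
  shows "integrable torusM \<phi>"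
proof -
  obtain B where "\<And>x. cmod (\<phi> x) \<le> B" using Cinf_bounded[OF assms] by blast
  then show ?thesis
    by (intro integrable_torus_bounded measurable_torus Cinf_measurable assms)
qed

lemma Cinf_partial_deriv:
  assumes "\<phi> \<in> Cinf"
  shows "partial_deriv i \<phi> \<in> Cinf"
proof -
  have "iterated_partial is (partial_deriv i \<phi>) = iterated_partial (i # is) \<phi>" for "is"
    by (simp add: iterated_partial_def)
  then have "smooth (partial_deriv i \<phi>)" using assms by (simp add: Cinf_def smooth_def)
  moreover have "partial_deriv i \<phi> (x + axis j 1) = partial_deriv i \<phi> x" for j x
  proof -
    have "(\<phi> has_derivative frechet_derivative \<phi> (at (x + axis j 1))) (at (x + axis j 1))"
      using Cinf_differentiable[OF assms] by (simp add: frechet_derivative_works)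
    moreover have "((\<lambda>y. y + axis j 1) has_derivative (\<lambda>h. h)) (at x)"
      by (auto intro!: derivative_eq_intros)
    ultimately have "((\<lambda>y. \<phi> (y + axis j 1)) has_derivative frechet_derivative \<phi> (at (x + axis j 1))) (at x)"
      using has_derivative_compose by fastforce
    moreover have "(\<lambda>y. \<phi> (y + axis j 1)) = \<phi>"
      using Cinf_periodic[OF assms] by (simp add: periodic_def)
    ultimately have "(\<phi> has_derivative frechet_derivative \<phi> (at (x + axis j 1))) (at x)" by simp
    from partial_deriv_eq[OF this] show ?thesis by (simp add: partial_deriv_def)
  qed
  ultimately show ?thesis by (simp add: Cinf_def periodic_def)
qed

lemma distributionsD:
  assumes "T \<in> distributions"
  shows "\<phi> \<in> Cinf \<Longrightarrow> \<psi> \<in> Cinf \<Longrightarrow> T (\<lambda>x. \<phi> x + \<psi> x) = T \<phi> + T \<psi>"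
    and "\<phi> \<in> Cinf \<Longrightarrow> T (\<lambda>x. c * \<phi> x) = c * T \<phi>"
    and "\<exists>C m. \<forall>\<phi>\<in>Cinf. cmod (T \<phi>) \<le> C * Cm_norm m \<phi>"
  using assms by (auto simp: distributions_def)

lemma Cm_norm_0_ge:
  assumes "\<phi> \<in> Cinf"
  shows "cmod (\<phi> x) \<le> Cm_norm 0 \<phi>"
proof -
  obtain B where "\<And>x. cmod (\<phi> x) \<le> B" using Cinf_bounded[OF assms] by blast
  then show ?thesis
    unfolding Cm_norm_def
    by (intro cSUP_upper2[where x = "([], x)"]) (auto intro!: bdd_aboveI[of _ B] simp: iterated_partial_def)
qed

lemma integrable_mult_Cinf:
  assumes "integrable torusM g" "\<phi> \<in> Cinf"
  shows "integrable torusM (\<lambda>x. g x * \<phi> x)"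
  using assms Cinf_bounded[OF assms(2)] Cinf_measurable[OF assms(2)]
  by (auto intro!: integrable_mult_bounded measurable_torus)

lemma dist_of_distributions:
  assumes "integrable torusM g"
  shows "dist_of g \<in> distributions"
proof -
  have "cmod (dist_of g \<phi>) \<le> (LINT x|torusM. cmod (g x)) * Cm_norm 0 \<phi>" if "\<phi> \<in> Cinf" for \<phi>
  proof -
    have "cmod (dist_of g \<phi>) \<le> (LINT x|torusM. cmod (g x * \<phi> x))"
      unfolding dist_of_eq by (rule integral_norm_bound)
    also have "\<dots> \<le> (LINT x|torusM. cmod (g x) * Cm_norm 0 \<phi>)"
    proof (rule integral_mono)
      show "integrable torusM (\<lambda>x. cmod (g x * \<phi> x))"
        by (intro integrable_norm integrable_mult_Cinf assms that)
      show "integrable torusM (\<lambda>x. cmod (g x) * Cm_norm 0 \<phi>)" using assms by simp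
      show "cmod (g x * \<phi> x) \<le> cmod (g x) * Cm_norm 0 \<phi>" for x
        unfolding norm_mult by (intro mult_left_mono Cm_norm_0_ge[OF that] norm_ge_zero)
    qed
    finally show ?thesis by simp
  qed
  moreover have "dist_of g (\<lambda>x. \<phi> x + \<psi> x) = dist_of g \<phi> + dist_of g \<psi>" if "\<phi> \<in> Cinf" "\<psi> \<in> Cinf" for \<phi> \<psi>
    using integrable_mult_Cinf[OF assms that(1)] integrable_mult_Cinf[OF assms that(2)]
    by (simp add: dist_of_eq distrib_left)
  moreover have "dist_of g (\<lambda>x. c * \<phi> x) = c * dist_of g \<phi>" for c \<phi>
    unfolding dist_of_eq by (simp add: mult.left_commute)
  ultimately show ?thesis unfolding distributions_def by blast
qed

lemma distribution_fourier_series_finite: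
  assumes T: "T \<in> distributions" and "finite F"
  shows "T (fourier_series (\<lambda>\<xi>. if \<xi> \<in> F then c \<xi> else 0)) = (\<Sum>\<xi>\<in>F. c \<xi> * T (wave \<xi>))"
  using assms(2)
proof induction
  case empty
  have "T (\<lambda>x. 0 * wave 0 x) = 0 * T (wave 0)" by (rule distributionsD(2)[OF T wave_Cinf])
  then show ?case by (simp add: fourier_series_def[abs_def])
next
  case (insert \<xi> F)
  let ?\<psi> = "fourier_series (\<lambda>\<xi>. if \<xi> \<in> F then c \<xi> else 0)"
  have w: "(\<lambda>x. c \<xi> * wave \<xi> x) \<in> Cinf"
  proof -
    have eq: "fourier_series (\<lambda>\<eta>. if \<eta> \<in> {\<xi>} then c \<eta> else 0) = (\<lambda>x. c \<xi> * wave \<xi> x)"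
      using fourier_series_finite[of "{\<xi>}" c] by (intro ext) simp
    have "rapid (\<lambda>\<eta>. if \<eta> \<in> {\<xi>} then c \<eta> else 0)"
      by (rule rapid_finite_support, rule finite_subset[of _ "{\<xi>}"]) auto
    from fourier_series_Cinf[OF this] show ?thesis unfolding eq .
  qed
  have p: "?\<psi> \<in> Cinf"
    by (intro fourier_series_Cinf rapid_finite_support finite_subset[OF _ insert.hyps(1)]) auto
  have "fourier_series (\<lambda>\<eta>. if \<eta> \<in> insert \<xi> F then c \<eta> else 0) = (\<lambda>x. c \<xi> * wave \<xi> x + ?\<psi> x)"
    by (intro ext) (simp only: fourier_series_finite[OF insert.hyps(1)]
        fourier_series_finite[OF finite.insertI[OF insert.hyps(1)]] sum.insert[OF insert.hyps])
  then show ?case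
    using insert distributionsD(1)[OF T w p] distributionsD(2)[OF T wave_Cinf] by simp
qed

text \<open>Linearity covers finite truncations only. The remainder is a Fourier series again, so
  the continuity estimate of T bounds it by the tail of a convergent weighted sum of
  coefficients.\<close>

lemma distribution_fourier_series_has_sum:
  assumes T: "T \<in> distributions" and c: "rapid c"
  shows "((\<lambda>\<xi>. c \<xi> * T (wave \<xi>)) has_sum T (fourier_series c)) UNIV"
proof -
  obtain C m where Cm: "\<And>\<phi>. \<phi> \<in> Cinf \<Longrightarrow> cmod (T \<phi>) \<le> C * Cm_norm m \<phi>"
    using distributionsD(3)[OF T] by blast
  \<comment> \<open>The constant C of a distribution may be negative or 0; the absolute value and
    the summand 1 make K positive, so that division by K is possible.\<close>
  define K where "K = \<bar>C\<bar> * 7 ^ m + 1"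
  have K: "K > 0" by (simp add: K_def add_nonneg_pos)
  have summ: "(\<lambda>\<xi>. weight \<xi> ^ m * cmod (c \<xi>)) summable_on UNIV"
    using c by (simp add: rapid_def)
  show ?thesis
    unfolding has_sum_def
  proof (rule tendstoI)
    fix e :: real assume "e > 0"
    then have "e / K > 0" using K by simp
    from infsum_tail_less[OF summ this] obtain F where F: "finite F"
      "\<And>G. finite G \<Longrightarrow> F \<subseteq> G \<Longrightarrow> (\<Sum>\<^sub>\<infinity>\<xi>. if \<xi> \<in> G then 0 else weight \<xi> ^ m * cmod (c \<xi>)) < e / K"
      by blast
    have "dist (\<Sum>\<xi>\<in>G. c \<xi> * T (wave \<xi>)) (T (fourier_series c)) < e" if G: "finite G" "F \<subseteq> G" for G
    proof -
      let ?a = "fourier_series (\<lambda>\<xi>. if \<xi> \<in> G then c \<xi> else 0)"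
      let ?r = "fourier_series (\<lambda>\<xi>. if \<xi> \<in> G then 0 else c \<xi>)"
      let ?t = "\<Sum>\<^sub>\<infinity>\<xi>. if \<xi> \<in> G then 0 else weight \<xi> ^ m * cmod (c \<xi>)"
      have r: "rapid (\<lambda>\<xi>. if \<xi> \<in> G then 0 else c \<xi>)"
        by (rule rapid_dominated[OF c, of _ 1 0]) auto
      have "fourier_series c = (\<lambda>x. ?a x + ?r x)"
        by (intro ext fourier_series_restrict_add c)
      then have "T (fourier_series c) = T ?a + T ?r"
        using distributionsD(1)[OF T fourier_series_Cinf[OF fourier_series_restrict_add(1)[OF c]] fourier_series_Cinf[OF r]]
        by simp
      then have "dist (\<Sum>\<xi>\<in>G. c \<xi> * T (wave \<xi>)) (T (fourier_series c)) = cmod (T ?r)"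
        by (simp add: distribution_fourier_series_finite[OF T G(1)] dist_norm)
      also have "\<dots> \<le> C * Cm_norm m ?r" by (intro Cm fourier_series_Cinf r)
      also have "\<dots> \<le> \<bar>C\<bar> * Cm_norm m ?r"
        using fourier_series_Cm_norm_le(1)[OF r] by (intro mult_right_mono) auto
      also have "\<dots> \<le> \<bar>C\<bar> * (7 ^ m * (\<Sum>\<^sub>\<infinity>\<xi>. weight \<xi> ^ m * cmod (if \<xi> \<in> G then 0 else c \<xi>)))"
        using fourier_series_Cm_norm_le(2)[OF r] by (intro mult_left_mono) auto
      also have "(\<Sum>\<^sub>\<infinity>\<xi>. weight \<xi> ^ m * cmod (if \<xi> \<in> G then 0 else c \<xi>)) = ?t"
        by (intro infsum_cong) auto
      also have "\<bar>C\<bar> * (7 ^ m * ?t) \<le> K * ?t"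
        unfolding K_def distrib_right
        by (simp add: infsum_nonneg weight_pos less_imp_le)
      also have "\<dots> < K * (e / K)" using F(2)[OF G] K by (intro mult_strict_left_mono)
      finally show ?thesis using K by simp
    qed
    then show "\<forall>\<^sub>F G in finite_subsets_at_top UNIV. dist (\<Sum>\<xi>\<in>G. c \<xi> * T (wave \<xi>)) (T (fourier_series c)) < e"
      unfolding eventually_finite_subsets_at_top using F(1) by blast
  qed
qed

section \<open>Fourier inversion for smooth functions\<close>

lemma fourier_coeff_dist_of: "fourier_coeff (dist_of g) \<xi> = (LINT x|torusM. g x * wave (- \<xi>) x)"
  by (simp add: fourier_coeff_eq dist_of_eq)

text \<open>The roles are exchanged: the wave acts as the distribution and the series is its test
  function. Termwise evaluation of distributions then interchanges sum and integral, and
  orthogonality leaves one term.\<close>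

lemma fourier_coeff_fourier_series:
  assumes "rapid c"
  shows "fourier_coeff (dist_of (fourier_series c)) \<xi> = c \<xi>"
proof -
  let ?T = "dist_of (wave (- \<xi>))"
  have T: "?T \<in> distributions" by (intro dist_of_distributions Cinf_integrable wave_Cinf)
  have "?T (wave \<eta>) = (if \<eta> = \<xi> then 1 else 0)" for \<eta>
  proof -
    have "?T (wave \<eta>) = (LINT x|torusM. wave (- \<xi> + \<eta>) x)"
      by (simp only: dist_of_eq wave_add)
    then show ?thesis by (simp only: integral_wave) (auto simp: algebra_simps)
  qed
  then have "(\<lambda>\<eta>. c \<eta> * ?T (wave \<eta>)) = (\<lambda>\<eta>. if \<eta> = \<xi> then c \<xi> else 0)" by auto
  then have "((\<lambda>\<eta>. if \<eta> = \<xi> then c \<xi> else 0) has_sum ?T (fourier_series c)) UNIV"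
    using distribution_fourier_series_has_sum[OF T assms] by (simp only:)
  moreover have "((\<lambda>\<eta>. if \<eta> = \<xi> then c \<xi> else 0) has_sum c \<xi>) UNIV"
    by (rule has_sum_finite_neutralI[of "{\<xi>}"]) auto
  ultimately have "?T (fourier_series c) = c \<xi>" by (rule has_sum_unique)
  then show ?thesis by (simp add: fourier_coeff_dist_of dist_of_eq mult.commute)
qed

text \<open>The right-hand side contains only powers of single components, so decay of the
  coefficients follows from repeated derivatives in one direction at a time, without mixed
  derivatives.\<close>

lemma weight_power_le: "weight (\<xi> :: int ^ 'n) ^ m \<le> (real CARD('n) + 1) ^ m * (1 + (\<Sum>i\<in>UNIV. \<bar>real_of_int (\<xi> $ i)\<bar> ^ (2 * m)))"
proof -
  let ?x = "\<lambda>i. (real_of_int (\<xi> $ i))\<^sup>2"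
  define M where "M = Max (insert 1 (range ?x))"
  have fin: "finite (insert 1 (range ?x))" by simp
  have M1: "1 \<le> M" unfolding M_def by (rule Max_ge[OF fin]) simp
  have Mx: "?x i \<le> M" for i unfolding M_def by (rule Max_ge[OF fin]) simp
  have "M \<in> insert 1 (range ?x)" unfolding M_def by (rule Max_in) auto
  then have "M = 1 \<or> (\<exists>j. M = ?x j)" by auto
  then have Mm: "M ^ m \<le> 1 + (\<Sum>i\<in>UNIV. ?x i ^ m)"
  proof
    assume "M = 1"
    then show ?thesis by (simp add: sum_nonneg)
  next
    assume "\<exists>j. M = ?x j"
    then obtain j where "M = ?x j" ..
    moreover have "?x j ^ m \<le> (\<Sum>i\<in>UNIV. ?x i ^ m)" by (rule member_le_sum) auto
    ultimately show ?thesis by simp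
  qed
  have "weight \<xi> \<le> 1 * M + (\<Sum>i\<in>(UNIV :: 'n set). M)"
    unfolding weight_def using M1 by (intro add_mono sum_mono Mx) auto
  also have "\<dots> = (real CARD('n) + 1) * M" by (simp add: distrib_right)
  finally have "weight \<xi> ^ m \<le> ((real CARD('n) + 1) * M) ^ m"
    using weight_pos[of \<xi>] by (intro power_mono) auto
  also have "\<dots> = (real CARD('n) + 1) ^ m * M ^ m" by (rule power_mult_distrib)
  also have "\<dots> \<le> (real CARD('n) + 1) ^ m * (1 + (\<Sum>i\<in>UNIV. ?x i ^ m))"
    by (intro mult_left_mono Mm) auto
  also have "(\<Sum>i\<in>UNIV. ?x i ^ m) = (\<Sum>i\<in>UNIV. \<bar>real_of_int (\<xi> $ i)\<bar> ^ (2 * m))"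
    by (simp add: power_mult)
  finally show ?thesis .
qed

text \<open>Boundedness with n further powers of the weight pays for summability, since the exponent
  n exceeds n/2.\<close>

lemma rapidI:
  fixes c :: "int ^ 'n \<Rightarrow> complex"
  assumes "\<And>m. \<exists>K. \<forall>\<xi>. weight \<xi> ^ m * cmod (c \<xi>) \<le> K"
  shows "rapid c"
  unfolding rapid_def
proof
  fix m
  obtain K where K: "\<And>\<xi>. weight \<xi> ^ (m + CARD('n)) * cmod (c \<xi>) \<le> K" using assms by blast
  have "(\<lambda>\<xi> :: int ^ 'n. K * weight \<xi> powr (- real CARD('n))) summable_on UNIV"
    by (intro summable_on_cmult_right summable_weight_powr) simp
  then show "(\<lambda>\<xi>. weight \<xi> ^ m * cmod (c \<xi>)) summable_on UNIV"
  proof (rule summable_on_comparison_test)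
    fix \<xi> :: "int ^ 'n"
    have "weight \<xi> ^ m * cmod (c \<xi>) * weight \<xi> ^ CARD('n) \<le> K"
      using K[of \<xi>] by (simp add: power_add mult_ac)
    then show "weight \<xi> ^ m * cmod (c \<xi>) \<le> K * weight \<xi> powr (- real CARD('n))"
      using weight_pos[of \<xi>] by (simp add: powr_minus powr_realpow divide_inverse[symmetric] pos_le_divide_eq)
  qed (intro mult_nonneg_nonneg zero_le_power less_imp_le[OF weight_pos] norm_ge_zero)
qed

lemma fourier_coeff_partial_deriv_Cinf:
  assumes "\<phi> \<in> Cinf"
  shows "fourier_coeff (dist_of (partial_deriv i \<phi>)) \<xi>
    = freq \<xi> i * fourier_coeff (dist_of \<phi>) \<xi>"
  unfolding fourier_coeff_dist_of
  by (intro integral_partial_deriv_wave Cinf_periodic Cinf_differentiable Cinf_continuous Cinf_partial_deriv assms)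

lemma norm_fourier_coeff_le:
  assumes "\<phi> \<in> Cinf"
  shows "\<exists>B. \<forall>\<xi>. cmod (fourier_coeff (dist_of \<phi>) \<xi>) \<le> B"
proof -
  have "cmod (fourier_coeff (dist_of \<phi>) \<xi>) \<le> (LINT x|torusM. cmod (\<phi> x))" for \<xi>
    unfolding fourier_coeff_dist_of using integral_norm_bound[of torusM "\<lambda>x. \<phi> x * wave (- \<xi>) x"]
    by (simp add: norm_mult)
  then show ?thesis by blast
qed

lemma rapid_fourier_coeff_Cinf:
  fixes \<phi> :: "real ^ 'n \<Rightarrow> complex"
  assumes "\<phi> \<in> Cinf"
  shows "rapid (fourier_coeff (dist_of \<phi>))"
proof (rule rapidI)
  fix m
  let ?c = "fourier_coeff (dist_of \<phi>)"
  have der: "(partial_deriv i ^^ k) \<phi> \<in> Cinf \<and>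
      (\<forall>\<xi>. fourier_coeff (dist_of ((partial_deriv i ^^ k) \<phi>)) \<xi>
        = (freq \<xi> i) ^ k * ?c \<xi>)" for i k
    by (induction k) (simp_all add: assms Cinf_partial_deriv fourier_coeff_partial_deriv_Cinf)
  have "\<exists>B. \<forall>\<xi>. \<bar>real_of_int (\<xi> $ i)\<bar> ^ (2 * m) * cmod (?c \<xi>) \<le> B" for i
  proof -
    obtain B where B: "\<And>\<xi>. cmod (fourier_coeff (dist_of ((partial_deriv i ^^ (2 * m)) \<phi>)) \<xi>) \<le> B"
      using norm_fourier_coeff_le der by blast
    have "\<bar>real_of_int (\<xi> $ i)\<bar> ^ (2 * m) * cmod (?c \<xi>) \<le> B" for \<xi>
    proof -
      have "\<bar>real_of_int (\<xi> $ i)\<bar> ^ (2 * m) \<le> (2 * pi * \<bar>real_of_int (\<xi> $ i)\<bar>) ^ (2 * m)"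
        using pi_ge_two mult_right_mono[of 1 "2 * pi" "\<bar>real_of_int (\<xi> $ i)\<bar>"] by (intro power_mono) auto
      also have "\<dots> = cmod ((freq \<xi> i) ^ (2 * m))"
        by (simp add: norm_power norm_mult)
      finally have "\<bar>real_of_int (\<xi> $ i)\<bar> ^ (2 * m) * cmod (?c \<xi>)
          \<le> cmod ((freq \<xi> i) ^ (2 * m)) * cmod (?c \<xi>)"
        by (intro mult_right_mono) auto
      also have "\<dots> = cmod (fourier_coeff (dist_of ((partial_deriv i ^^ (2 * m)) \<phi>)) \<xi>)"
        using der[where i = i and k = "2 * m"] by (simp only: norm_mult)
      finally show ?thesis using B[of \<xi>] by linarith
    qed
    then show ?thesis by blast
  qed
  then obtain B where B: "\<And>i \<xi>. \<bar>real_of_int (\<xi> $ i)\<bar> ^ (2 * m) * cmod (?c \<xi>) \<le> B i"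
    by metis
  obtain B0 where B0: "\<And>\<xi>. cmod (?c \<xi>) \<le> B0"
    using norm_fourier_coeff_le[OF assms] by blast
  have "weight \<xi> ^ m * cmod (?c \<xi>) \<le> (real CARD('n) + 1) ^ m * (B0 + (\<Sum>i\<in>UNIV. B i))" for \<xi>
  proof -
    have "weight \<xi> ^ m * cmod (?c \<xi>)
      \<le> (real CARD('n) + 1) ^ m * (1 + (\<Sum>i\<in>UNIV. \<bar>real_of_int (\<xi> $ i)\<bar> ^ (2 * m))) * cmod (?c \<xi>)"
      by (intro mult_right_mono weight_power_le) auto
    also have "\<dots> = (real CARD('n) + 1) ^ m * (cmod (?c \<xi>)
        + (\<Sum>i\<in>UNIV. \<bar>real_of_int (\<xi> $ i)\<bar> ^ (2 * m) * cmod (?c \<xi>)))"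
      by (simp add: mult.assoc distrib_right sum_distrib_right)
    also have "\<dots> \<le> (real CARD('n) + 1) ^ m * (B0 + (\<Sum>i\<in>UNIV. B i))"
      by (intro mult_left_mono add_mono sum_mono B B0) auto
    finally show ?thesis .
  qed
  then show "\<exists>K. \<forall>\<xi>. weight \<xi> ^ m * cmod (?c \<xi>) \<le> K" by blast
qed

text \<open>Both sides are smooth and have the same coefficients, hence agree almost everywhere;
  continuity and periodicity remove the null set.\<close>

lemma fourier_inversion_Cinf:
  assumes "\<phi> \<in> Cinf"
  shows "\<phi> = fourier_series (fourier_coeff (dist_of \<phi>))"
proof
  fix x
  let ?\<psi> = "fourier_series (fourier_coeff (dist_of \<phi>))"
  note r = rapid_fourier_coeff_Cinf[OF assms]
  have psi: "?\<psi> \<in> Cinf" by (intro fourier_series_Cinf r)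
  have "AE x in torusM. \<phi> x = ?\<psi> x"
  proof (rule AE_torus_eq)
    fix \<xi>
    have "fourier_coeff (dist_of \<phi>) (- \<xi>) = fourier_coeff (dist_of ?\<psi>) (- \<xi>)"
      by (simp only: fourier_coeff_fourier_series[OF r])
    then show "(LINT x|torusM. \<phi> x * wave \<xi> x) = (LINT x|torusM. ?\<psi> x * wave \<xi> x)"
      by (simp add: fourier_coeff_dist_of)
  qed (intro Cinf_integrable assms psi)+
  then have "AE x in torusM. \<phi> x - ?\<psi> x = 0" by (simp only: right_minus_eq)
  moreover have "periodic (\<lambda>x. \<phi> x - ?\<psi> x)"
    using Cinf_periodic[OF assms] Cinf_periodic[OF psi] by (simp add: periodic_def)
  ultimately have "\<phi> x - ?\<psi> x = 0"
    by (intro periodic_eq_0_everywhere[where f = "\<lambda>x. \<phi> x - ?\<psi> x"]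
        continuous_on_diff[OF Cinf_continuous[OF assms] Cinf_continuous[OF psi]])
  then show "\<phi> x = ?\<psi> x" by simp
qed

text \<open>Every test function is its own Fourier series, and distributions act on such series term
  by term, so their values on waves determine them.\<close>

lemma distribution_eqI:
  assumes "S \<in> distributions" "T \<in> distributions" "\<And>\<xi>. fourier_coeff S \<xi> = fourier_coeff T \<xi>"
  shows "S =\<^sub>D T"
  unfolding dist_eq_def
proof
  fix \<phi> :: "real ^ 'a \<Rightarrow> complex" assume phi: "\<phi> \<in> Cinf"
  let ?c = "fourier_coeff (dist_of \<phi>)"
  have "S (wave \<xi>) = T (wave \<xi>)" for \<xi> using assms(3)[of "- \<xi>"] by (simp add: fourier_coeff_eq)
  then have "((\<lambda>\<xi>. ?c \<xi> * S (wave \<xi>)) has_sum T (fourier_series ?c)) UNIV"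
    using distribution_fourier_series_has_sum[OF assms(2) rapid_fourier_coeff_Cinf[OF phi]] by simp
  with distribution_fourier_series_has_sum[OF assms(1) rapid_fourier_coeff_Cinf[OF phi]]
  have "S (fourier_series ?c) = T (fourier_series ?c)" by (rule has_sum_unique)
  then show "S \<phi> = T \<phi>" using fourier_inversion_Cinf[OF phi] by simp
qed

section \<open>Products of square-integrable functions\<close>

definition psum :: "(int ^ 'n \<Rightarrow> complex) \<Rightarrow> (int ^ 'n) set \<Rightarrow> real ^ 'n \<Rightarrow> complex" where
  "psum c F x = (\<Sum>\<xi>\<in>F. c \<xi> * wave \<xi> x)"

lemma psum_measurable [measurable]: "psum c F \<in> borel_measurable borel"
  unfolding psum_def[abs_def] by (intro borel_measurable_sum borel_measurable_times) measurable

lemma norm_psum_le: "cmod (psum c F x) \<le> (\<Sum>\<xi>\<in>F. cmod (c \<xi>))"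
  unfolding psum_def by (rule order_trans[OF norm_sum]) (simp add: norm_mult)

text \<open>The integrable \<open>W\<close> bounds the squares of the partial sums. For two such
  families with majorants W and V, the sum W + V dominates all products of partial sums.\<close>

definition dominated_psums ::
    "(int ^ 'n \<Rightarrow> complex) \<Rightarrow> (real ^ 'n \<Rightarrow> complex) \<Rightarrow> (nat \<Rightarrow> (int ^ 'n) set) \<Rightarrow> (real ^ 'n \<Rightarrow> real) \<Rightarrow> bool"
  where
  "dominated_psums c g F W \<longleftrightarrow> (\<forall>k. finite (F k)) \<and> integrable torusM W
    \<and> (AE x in torusM. (\<forall>k. (cmod (psum c (F k) x))\<^sup>2 \<le> W x)
        \<and> (\<lambda>k. psum c (F k) x) \<longlonglongrightarrow> g x)"

lemma integrable_wave: "integrable torusM (wave \<xi>)"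
  by (intro Cinf_integrable wave_Cinf)

lemma integral_psum_wave:
  assumes "finite F"
  shows "(LINT x|torusM. psum c F x * wave (- \<xi>) x) = (if \<xi> \<in> F then c \<xi> else 0)"
proof -
  have "(LINT x|torusM. psum c F x * wave (- \<xi>) x)
      = (LINT x|torusM. (\<Sum>q\<in>F. c q * wave (q + - \<xi>) x))"
    by (simp only: psum_def sum_distrib_right mult.assoc wave_add)
  also have "\<dots> = (\<Sum>q\<in>F. c q * (LINT x|torusM. wave (q + - \<xi>) x))"
    by (subst Bochner_Integration.integral_sum) (simp_all add: integrable_wave)
  also have "\<dots> = (\<Sum>q\<in>F. if q = \<xi> then c \<xi> else 0)"
    unfolding integral_wave by (intro sum.cong) auto
  finally show ?thesis using assms by simp
qed

lemma integral_norm_psum: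
  assumes "finite F"
  shows "(LINT x|torusM. (cmod (psum c F x))\<^sup>2) = (\<Sum>\<xi>\<in>F. (cmod (c \<xi>))\<^sup>2)"
proof -
  have int: "integrable torusM (\<lambda>x. psum c F x * wave (- \<xi>) x)" for \<xi>
    using norm_psum_le[of c F]
    by (intro integrable_torus_bounded[where B = "\<Sum>\<xi>\<in>F. cmod (c \<xi>)"] measurable_torus) (simp_all add: norm_mult)
  have "complex_of_real (LINT x|torusM. (cmod (psum c F x))\<^sup>2)
      = (LINT x|torusM. complex_of_real ((cmod (psum c F x))\<^sup>2))"
    by (rule integral_complex_of_real[symmetric])
  also have "\<dots> = (LINT x|torusM. (\<Sum>\<xi>\<in>F. cnj (c \<xi>) * (psum c F x * wave (- \<xi>) x)))"
  proof (rule Bochner_Integration.integral_cong[OF refl])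
    fix x
    have "complex_of_real ((cmod (psum c F x))\<^sup>2) = psum c F x * cnj (psum c F x)"
      by (rule complex_norm_square)
    also have "cnj (psum c F x) = (\<Sum>\<xi>\<in>F. cnj (c \<xi>) * wave (- \<xi>) x)"
      by (simp add: psum_def cnj_wave)
    finally show "complex_of_real ((cmod (psum c F x))\<^sup>2) = (\<Sum>\<xi>\<in>F. cnj (c \<xi>) * (psum c F x * wave (- \<xi>) x))"
      by (simp only: sum_distrib_left mult.left_commute)
  qed
  also have "\<dots> = (\<Sum>\<xi>\<in>F. cnj (c \<xi>) * (LINT x|torusM. psum c F x * wave (- \<xi>) x))"
    by (subst Bochner_Integration.integral_sum) (simp_all add: int)
  also have "\<dots> = (\<Sum>\<xi>\<in>F. cnj (c \<xi>) * c \<xi>)"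
    by (intro sum.cong refl) (simp add: integral_psum_wave[OF assms])
  also have "\<dots> = complex_of_real (\<Sum>\<xi>\<in>F. (cmod (c \<xi>))\<^sup>2)"
    by (simp add: complex_norm_square mult.commute del: of_real_power)
  finally show ?thesis by (simp only: of_real_eq_iff)
qed

lemma AE_summable_integrable_suminf:
  fixes f :: "nat \<Rightarrow> 'a \<Rightarrow> real"
  assumes int: "\<And>i. integrable M (f i)" and nonneg: "\<And>i x. 0 \<le> f i x"
    and summ: "summable (\<lambda>i. LINT x|M. f i x)"
  shows "AE x in M. summable (\<lambda>i. f i x)" "integrable M (\<lambda>x. \<Sum>i. f i x)"
proof -
  have [measurable]: "f i \<in> borel_measurable M" for i using int by simp
  have "(\<integral>\<^sup>+x. (\<Sum>i. ennreal (f i x)) \<partial>M) = (\<Sum>i. \<integral>\<^sup>+x. ennreal (f i x) \<partial>M)"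
    by (rule nn_integral_suminf) measurable
  also have "\<dots> = (\<Sum>i. ennreal (LINT x|M. f i x))"
    using int nonneg by (intro suminf_cong nn_integral_eq_integral) auto
  also have "\<dots> = ennreal (\<Sum>i. LINT x|M. f i x)"
    using summ nonneg by (intro suminf_ennreal2) auto
  finally have fin: "(\<integral>\<^sup>+x. (\<Sum>i. ennreal (f i x)) \<partial>M) \<noteq> \<infinity>" by simp
  have "AE x in M. (\<Sum>i. ennreal (f i x)) \<noteq> \<infinity>"
    by (rule nn_integral_PInf_AE[OF _ fin]) measurable
  then show ae: "AE x in M. summable (\<lambda>i. f i x)"
    by eventually_elim (auto intro!: summable_suminf_not_top nonneg)
  have "(\<lambda>i. LINT x|M. norm (f i x)) = (\<lambda>i. LINT x|M. f i x)" using nonneg by simp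
  with summ ae show "integrable M (\<lambda>x. \<Sum>i. f i x)"
    using nonneg by (intro integrable_suminf int) auto
qed

text \<open>
  Finite frequency sets whose tails decay like \<open>4\<^sup>-\<^sup>k\<close> yield partial sums that converge almost everywhere
  and have a common square-integrable majorant, so that products of two such sequences can be
  integrated termwise by dominated convergence.
\<close>

lemma riesz_fischer:
  fixes c :: "int ^ 'n \<Rightarrow> complex"
  assumes c: "(\<lambda>\<xi>. (cmod (c \<xi>))\<^sup>2) summable_on UNIV"
  shows "\<exists>g F W. periodic g \<and> integrable torusM g \<and> (\<forall>\<xi>. fourier_coeff (dist_of g) \<xi> = c \<xi>)
    \<and> dominated_psums c g F W"
proof -
  let ?tail = "\<lambda>G. \<Sum>\<^sub>\<infinity>\<xi>. if \<xi> \<in> G then 0 else (cmod (c \<xi>))\<^sup>2"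
  have "\<exists>F. finite F \<and> ?tail F < (1/4) ^ k" for k :: nat
    using infsum_tail_less[OF c, of "(1/4) ^ k"] by auto
  then obtain F where fin: "\<And>k::nat. finite (F k)" and tail: "\<And>k. ?tail (F k) < (1/4) ^ k" by metis
  have off: "sum (\<lambda>\<xi>. (cmod (c \<xi>))\<^sup>2) X \<le> (1/4) ^ k" if "finite X" "X \<inter> F k = {}" for X k
  proof -
    have "sum (\<lambda>\<xi>. (cmod (c \<xi>))\<^sup>2) X = (\<Sum>\<xi>\<in>X. if \<xi> \<in> F k then 0 else (cmod (c \<xi>))\<^sup>2)"
      using that by (intro sum.cong) auto
    also have "\<dots> \<le> ?tail (F k)"
      using that by (intro finite_sum_le_infsum summable_on_comparison_test[OF c]) auto
    finally show ?thesis using tail[of k] by linarith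
  qed
  let ?S = "\<lambda>k. psum c (F k)"
  \<comment> \<open>The sets \<open>F k\<close> need not be nested. The increment of the partial
    sums is therefore expanded over the union of two consecutive sets, with the signed coefficients
    \<open>b\<close>.\<close>
  define G where "G k = F (Suc k) \<union> F k" for k
  define b where "b k \<xi> = (if \<xi> \<in> F (Suc k) then c \<xi> else 0) - (if \<xi> \<in> F k then c \<xi> else 0)" for k \<xi>
  define d where "d k = psum (b k) (G k)" for k
  have finG: "finite (G k)" for k using fin by (simp add: G_def)
  have S_Suc: "?S (Suc k) x - ?S k x = d k x" for k x
  proof -
    have "?S k x = (\<Sum>\<xi>\<in>G k. (if \<xi> \<in> F k then c \<xi> else 0) * wave \<xi> x)"
      unfolding psum_def using finG by (intro sum.mono_neutral_cong_left) (auto simp: G_def)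
    moreover have "?S (Suc k) x = (\<Sum>\<xi>\<in>G k. (if \<xi> \<in> F (Suc k) then c \<xi> else 0) * wave \<xi> x)"
      unfolding psum_def using finG by (intro sum.mono_neutral_cong_left) (auto simp: G_def)
    ultimately show ?thesis
      by (simp only: d_def psum_def b_def left_diff_distrib sum_subtractf)
  qed
  have b_sum: "(\<Sum>\<xi>\<in>G k. (cmod (b k \<xi>))\<^sup>2) \<le> 2 * (1/4) ^ k" for k
  proof -
    have "(\<Sum>\<xi>\<in>G k. (cmod (b k \<xi>))\<^sup>2)
        = (\<Sum>\<xi>\<in>(F (Suc k) - F k) \<union> (F k - F (Suc k)). (cmod (c \<xi>))\<^sup>2)"
      using finG by (intro sum.mono_neutral_cong_right) (auto simp: G_def b_def)
    also have "\<dots> = (\<Sum>\<xi>\<in>F (Suc k) - F k. (cmod (c \<xi>))\<^sup>2) + (\<Sum>\<xi>\<in>F k - F (Suc k). (cmod (c \<xi>))\<^sup>2)"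
      using fin by (intro sum.union_disjoint) auto
    also have "\<dots> \<le> (1/4) ^ k + (1/4) ^ Suc k"
      using fin by (intro add_mono off) auto
    also have "\<dots> \<le> 2 * (1/4) ^ k" by simp
    finally show ?thesis .
  qed
  have bounded_int: "integrable torusM (\<lambda>x. (cmod (psum e X x))\<^sup>2)" for e X
  proof (rule integrable_torus_bounded[OF measurable_torus])
    show "norm ((cmod (psum e X x))\<^sup>2) \<le> (\<Sum>\<xi>\<in>X. cmod (e \<xi>))\<^sup>2" for x
      using power_mono[OF norm_psum_le[of e X x] norm_ge_zero, of 2] by simp
  qed measurable
  \<comment> \<open>The integral of the squared increment is of order 4^-k, so the factor 2^k leaves
    a summable series. That factor is what lets Cauchy-Schwarz control the sum of the unsquared
    increments.\<close>
  define f where "f k x = 2 ^ k * (cmod (d k x))\<^sup>2" for k x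
  have f_int: "integrable torusM (f k)" for k
    unfolding f_def[abs_def] d_def by (intro integrable_mult_right bounded_int)
  have f_nonneg: "0 \<le> f k x" for k x by (simp add: f_def)
  have f_summ: "summable (\<lambda>k. LINT x|torusM. f k x)"
  proof (rule summable_comparison_test')
    show "summable (\<lambda>k. 2 * (1/2::real) ^ k)" by (intro summable_mult summable_geometric) simp
    fix k
    have "(LINT x|torusM. f k x) = 2 ^ k * (\<Sum>\<xi>\<in>G k. (cmod (b k \<xi>))\<^sup>2)"
      unfolding f_def d_def by (simp add: integral_norm_psum[OF finG])
    also have "\<dots> \<le> 2 ^ k * (2 * (1/4) ^ k)" by (intro mult_left_mono b_sum) simp
    also have "\<dots> = 2 * (1/2) ^ k" by (simp add: power_divide power_mult_distrib[symmetric] field_simps)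
    finally have "(LINT x|torusM. f k x) \<le> 2 * (1/2) ^ k" .
    moreover have "0 \<le> (LINT x|torusM. f k x)" by (simp add: f_nonneg)
    ultimately show "norm (LINT x|torusM. f k x) \<le> 2 * (1/2) ^ k" by simp
  qed
  note h = AE_summable_integrable_suminf[OF f_int f_nonneg f_summ]
  \<comment> \<open>The factor 4 arises as 2 from squaring a sum of two terms times 2 from the
    geometric series in the Cauchy-Schwarz estimate for the increments.\<close>
  define W where "W x = 2 * (cmod (?S 0 x))\<^sup>2 + 4 * (\<Sum>k. f k x)" for x
  define g where "g x = lim (\<lambda>k. ?S k x)" for x
  have W_int: "integrable torusM W"
    unfolding W_def[abs_def] by (intro Bochner_Integration.integrable_add integrable_mult_right bounded_int h)
  have S_eq: "?S k x = ?S 0 x + (\<Sum>i<k. d i x)" for k x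
    using sum_lessThan_telescope[of "\<lambda>k. ?S k x" k] by (simp add: S_Suc)
  have geo: "(\<Sum>i<k. (1/2::real) ^ i) \<le> 2" for k
    using sum_le_suminf[OF summable_geometric[of "1/2::real"], of "{..<k}"] by (simp add: suminf_geometric)
  have pt: "(\<forall>k. (cmod (?S k x))\<^sup>2 \<le> W x) \<and> (\<lambda>k. ?S k x) \<longlonglongrightarrow> g x" if s: "summable (\<lambda>k. f k x)" for x
  proof
    have "cmod (d k x) \<le> f k x + (1/2) ^ k" for k
    proof -
      have "0 \<le> 2 ^ k * (cmod (d k x) - (1/2) ^ k)\<^sup>2" by simp
      also have "\<dots> = f k x - 2 * cmod (d k x) + (1/2) ^ k"
        by (simp add: f_def power2_diff algebra_simps power_divide power2_eq_square)
      finally have "2 * cmod (d k x) \<le> f k x + (1/2) ^ k" by simp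
      then show ?thesis using norm_ge_zero[of "d k x"] by linarith
    qed
    then have "summable (\<lambda>k. d k x)"
      by (intro summable_comparison_test'[OF summable_add[OF s summable_geometric[of "1/2::real"]]]) auto
    then have "(\<lambda>k. ?S 0 x + (\<Sum>i<k. d i x)) \<longlonglongrightarrow> ?S 0 x + (\<Sum>i. d i x)"
      by (intro tendsto_intros summable_LIMSEQ)
    then have "convergent (\<lambda>k. ?S k x)" unfolding S_eq[symmetric] by (rule convergentI)
    then show "(\<lambda>k. ?S k x) \<longlonglongrightarrow> g x" unfolding g_def by (simp add: convergent_LIMSEQ_iff)
    show "\<forall>k. (cmod (?S k x))\<^sup>2 \<le> W x"
    proof
      fix k
      have sq: "(y + z)\<^sup>2 \<le> 2 * y\<^sup>2 + 2 * z\<^sup>2" for y z :: real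
        using zero_le_power2[of "y - z"] by (simp add: power2_eq_square algebra_simps)
      have "(\<Sum>i<k. cmod (d i x))\<^sup>2 = (\<Sum>i<k. sqrt ((1/2) ^ i) * sqrt (f i x))\<^sup>2"
        by (intro arg_cong[where f = "\<lambda>y. y\<^sup>2"] sum.cong refl)
          (simp add: f_def real_sqrt_mult[symmetric] mult.assoc[symmetric] power_mult_distrib[symmetric])
      also have "\<dots> \<le> (\<Sum>i<k. (sqrt ((1/2) ^ i))\<^sup>2) * (\<Sum>i<k. (sqrt (f i x))\<^sup>2)"
        by (rule Cauchy_Schwarz_ineq_sum)
      also have "\<dots> = (\<Sum>i<k. (1/2) ^ i) * (\<Sum>i<k. f i x)"
        by (simp add: f_nonneg)
      also have "\<dots> \<le> 2 * (\<Sum>i. f i x)"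
        using s f_nonneg by (intro mult_mono geo sum_le_suminf sum_nonneg) auto
      finally have D: "(\<Sum>i<k. cmod (d i x))\<^sup>2 \<le> 2 * (\<Sum>i. f i x)" .
      have "cmod (?S k x) \<le> cmod (?S 0 x) + (\<Sum>i<k. cmod (d i x))"
        unfolding S_eq[of k] by (intro order_trans[OF norm_triangle_ineq] add_left_mono norm_sum)
      then have "(cmod (?S k x))\<^sup>2 \<le> (cmod (?S 0 x) + (\<Sum>i<k. cmod (d i x)))\<^sup>2"
        by (intro power_mono) auto
      also have "\<dots> \<le> 2 * (cmod (?S 0 x))\<^sup>2 + 2 * (\<Sum>i<k. cmod (d i x))\<^sup>2" by (rule sq)
      also have "\<dots> \<le> W x" using D by (simp add: W_def)
      finally show "(cmod (?S k x))\<^sup>2 \<le> W x" .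
    qed
  qed
  have ae: "AE x in torusM. (\<forall>k. (cmod (?S k x))\<^sup>2 \<le> W x) \<and> (\<lambda>k. ?S k x) \<longlonglongrightarrow> g x"
    using h(1) by eventually_elim (rule pt)
  \<comment> \<open>Converts the majorant of the squares into an integrable majorant of the partial
    sums themselves, using that constants are integrable on the torus.\<close>
  have le_W: "y \<le> 1 + w" if "y\<^sup>2 \<le> w" for y w :: real
  proof -
    have "2 * y \<le> y\<^sup>2 + 1" using zero_le_power2[of "y - 1"] by (simp add: power2_diff)
    then show ?thesis using that zero_le_power2[of y] by linarith
  qed
  have g_meas: "g \<in> borel_measurable torusM"
    unfolding g_def[abs_def] by (intro borel_measurable_lim_metric measurable_torus psum_measurable)
  have S_int: "integrable torusM (?S k)" for k
    by (intro integrable_torus_bounded[OF measurable_torus[OF psum_measurable] norm_psum_le])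
  have W1_int: "integrable torusM (\<lambda>x. 1 + W x)" using W_int by simp
  have g_int: "integrable torusM g"
  proof (rule integrable_dominated_convergence[where s = ?S and w = "\<lambda>x. 1 + W x"])
    show "AE x in torusM. (\<lambda>k. ?S k x) \<longlonglongrightarrow> g x" using ae by eventually_elim simp
    show "AE x in torusM. cmod (?S k x) \<le> 1 + W x" for k
      using ae by eventually_elim (simp add: le_W)
  qed (intro g_meas W1_int measurable_torus psum_measurable)+
  have "fourier_coeff (dist_of g) \<xi> = c \<xi>" for \<xi>
  proof -
    have "(\<lambda>k. LINT x|torusM. ?S k x * wave (- \<xi>) x) \<longlonglongrightarrow> (LINT x|torusM. g x * wave (- \<xi>) x)"
    proof (rule integral_dominated_convergence[where w = "\<lambda>x. 1 + W x"])
      show "AE x in torusM. (\<lambda>k. ?S k x * wave (- \<xi>) x) \<longlonglongrightarrow> g x * wave (- \<xi>) x"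
        using ae by eventually_elim (auto intro: tendsto_intros)
      show "AE x in torusM. cmod (?S k x * wave (- \<xi>) x) \<le> 1 + W x" for k
        using ae by eventually_elim (simp add: norm_mult le_W)
    qed (intro g_meas W1_int borel_measurable_times measurable_torus[OF psum_measurable]
        measurable_torus[OF borel_measurable_wave])+
    moreover have "(\<lambda>k. LINT x|torusM. ?S k x * wave (- \<xi>) x) \<longlonglongrightarrow> c \<xi>"
    proof -
      have bound: "cmod ((LINT x|torusM. ?S k x * wave (- \<xi>) x) - c \<xi>) \<le> (1/2) ^ k" for k
      proof (cases "\<xi> \<in> F k")
        case False
        have "(cmod (c \<xi>))\<^sup>2 \<le> (1/4) ^ k" using off[of "{\<xi>}" k] False by simp
        also have "(1/4::real) ^ k = ((1/2) ^ k)\<^sup>2" by (simp add: power2_eq_square flip: power_mult_distrib)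
        finally have "cmod (c \<xi>) \<le> (1/2) ^ k" by (rule power2_le_imp_le) simp
        then show ?thesis using False by (simp add: integral_psum_wave[OF fin])
      qed (simp add: integral_psum_wave[OF fin])
      have "(\<lambda>k. (LINT x|torusM. ?S k x * wave (- \<xi>) x) - c \<xi>) \<longlonglongrightarrow> 0"
        by (rule tendsto_norm_zero_cancel, rule Lim_null_comparison[OF _ LIMSEQ_realpow_zero[of "1/2"]]) (use bound in auto)
      then show ?thesis by (rule LIM_zero_cancel)
    qed
    ultimately have "(LINT x|torusM. g x * wave (- \<xi>) x) = c \<xi>" by (rule LIMSEQ_unique)
    then show ?thesis by (simp add: fourier_coeff_dist_of)
  qed
  moreover have "periodic g"
  proof -
    have "wave \<xi> (x + axis i 1) = wave \<xi> x" for \<xi> :: "int ^ 'n" and i x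
      using periodic_wave unfolding periodic_def by blast
    then show ?thesis by (simp add: periodic_def g_def psum_def)
  qed
  ultimately show ?thesis using g_int fin W_int ae unfolding dominated_psums_def by blast
qed

text \<open>
  \<open>fun_of\<close> is a choice; it is meaningful here because such a function exists, and it is unique up to
  a null set.
\<close>

lemma fun_of_psums:
  fixes T :: "'n::finite distribution"
  assumes T: "T \<in> distributions" and c: "(\<lambda>\<xi>. (cmod (fourier_coeff T \<xi>))\<^sup>2) summable_on UNIV"
  shows "integrable torusM (fun_of T)"
    and "\<exists>F W. dominated_psums (fourier_coeff T) (fun_of T) F W"
proof -
  obtain g F W where g: "periodic g" "integrable torusM g" "\<And>\<xi>. fourier_coeff (dist_of g) \<xi> = fourier_coeff T \<xi>"
    and F: "dominated_psums (fourier_coeff T) g F W"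
    using riesz_fischer[OF c] by blast
  have "T =\<^sub>D dist_of g"
    by (intro distribution_eqI T dist_of_distributions g(2)) (simp add: g(3))
  then have "\<exists>g. periodic g \<and> set_integrable lborel torus g \<and> T =\<^sub>D dist_of g"
    using g by (auto simp: set_integrable_torus)
  from someI_ex[OF this] have f: "periodic (fun_of T)" "set_integrable lborel torus (fun_of T)" "T =\<^sub>D dist_of (fun_of T)"
    unfolding fun_of_def by auto
  show int: "integrable torusM (fun_of T)" using f(2) by (simp only: set_integrable_torus)
  have "AE x in torusM. g x = fun_of T x"
  proof (rule AE_torus_eq[OF g(2) int])
    fix \<xi>
    have "fourier_coeff (dist_of g) (- \<xi>) = fourier_coeff (dist_of (fun_of T)) (- \<xi>)"
      using f(3) wave_Cinf[of \<xi>] by (simp add: g(3)) (simp add: fourier_coeff_eq dist_eq_def)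
    then show "(LINT x|torusM. g x * wave \<xi> x) = (LINT x|torusM. fun_of T x * wave \<xi> x)"
      by (simp add: fourier_coeff_dist_of)
  qed
  then have "dominated_psums (fourier_coeff T) (fun_of T) F W"
    using F unfolding dominated_psums_def by (auto elim: eventually_elim2)
  then show "\<exists>F W. dominated_psums (fourier_coeff T) (fun_of T) F W" by blast
qed

text \<open>The convolution theorem as a limit of finite convolutions. Each approximant is the
  coefficient of a product of trigonometric polynomials, and it is dominated by a finite convolution
  of absolute values, so uniform estimates carry over to the product.\<close>

lemma fourier_coeff_dist_mult_limit:
  fixes S T :: "'n::finite distribution"
  assumes S: "S \<in> distributions" "(\<lambda>\<xi>. (cmod (fourier_coeff S \<xi>))\<^sup>2) summable_on UNIV"
    and T: "T \<in> distributions" "(\<lambda>\<xi>. (cmod (fourier_coeff T \<xi>))\<^sup>2) summable_on UNIV"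
  shows "\<exists>F a. (\<forall>k::nat. finite (F k)) \<and> (\<forall>\<xi>. (\<lambda>k. a k \<xi>) \<longlonglongrightarrow> fourier_coeff (dist_mult S T) \<xi>)
    \<and> (\<forall>k \<xi>. cmod (a k \<xi>) \<le> (\<Sum>q\<in>F k. cmod (fourier_coeff S q) * cmod (fourier_coeff T (\<xi> - q))))"
proof -
  let ?c = "fourier_coeff S" and ?d = "fourier_coeff T"
  obtain F W where F: "\<And>k::nat. finite (F k)" "integrable torusM W"
    and aeF: "AE x in torusM. (\<forall>k. (cmod (psum ?c (F k) x))\<^sup>2 \<le> W x)
        \<and> (\<lambda>k. psum ?c (F k) x) \<longlonglongrightarrow> fun_of S x"
    using fun_of_psums(2)[OF S] unfolding dominated_psums_def by blast
  obtain G V where G: "\<And>k::nat. finite (G k)" "integrable torusM V"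
    and aeG: "AE x in torusM. (\<forall>k. (cmod (psum ?d (G k) x))\<^sup>2 \<le> V x)
        \<and> (\<lambda>k. psum ?d (G k) x) \<longlonglongrightarrow> fun_of T x"
    using fun_of_psums(2)[OF T] unfolding dominated_psums_def by blast
  define a where "a k \<xi> = (LINT x|torusM. psum ?c (F k) x * psum ?d (G k) x * wave (- \<xi>) x)" for k \<xi>
  have "(\<lambda>k. a k \<xi>) \<longlonglongrightarrow> fourier_coeff (dist_mult S T) \<xi>" for \<xi>
    unfolding a_def dist_mult_def fourier_coeff_dist_of
  proof (rule integral_dominated_convergence[where w = "\<lambda>x. W x + V x"])
    show "AE x in torusM. (\<lambda>k. psum ?c (F k) x * psum ?d (G k) x * wave (- \<xi>) x)
        \<longlonglongrightarrow> fun_of S x * fun_of T x * wave (- \<xi>) x"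
      using aeF aeG by eventually_elim (auto intro: tendsto_intros)
    have ab: "y * z \<le> y\<^sup>2 + z\<^sup>2" if "0 \<le> y" "0 \<le> z" for y z :: real
      using zero_le_power2[of "y - z"] mult_nonneg_nonneg[OF that] by (simp add: power2_diff)
    show "AE x in torusM. cmod (psum ?c (F k) x * psum ?d (G k) x * wave (- \<xi>) x) \<le> W x + V x" for k
      using aeF aeG
    proof eventually_elim
      case (elim x)
      have "cmod (psum ?c (F k) x * psum ?d (G k) x * wave (- \<xi>) x)
          = cmod (psum ?c (F k) x) * cmod (psum ?d (G k) x)" by (simp add: norm_mult)
      also have "\<dots> \<le> (cmod (psum ?c (F k) x))\<^sup>2 + (cmod (psum ?d (G k) x))\<^sup>2"
        by (intro ab) auto
      also have "\<dots> \<le> W x + V x" using elim by (intro add_mono) auto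
      finally show ?case .
    qed
    have "fun_of S \<in> borel_measurable torusM" "fun_of T \<in> borel_measurable torusM"
      using fun_of_psums(1)[OF S] fun_of_psums(1)[OF T] by auto
    then show "(\<lambda>x. fun_of S x * fun_of T x * wave (- \<xi>) x) \<in> borel_measurable torusM"
      using measurable_torus[OF borel_measurable_wave] by (intro borel_measurable_times)
    show "(\<lambda>x. psum ?c (F k) x * psum ?d (G k) x * wave (- \<xi>) x) \<in> borel_measurable torusM" for k
      by (rule measurable_torus) measurable
    show "integrable torusM (\<lambda>x. W x + V x)" using F(2) G(2) by simp
  qed
  moreover have "cmod (a k \<xi>) \<le> (\<Sum>q\<in>F k. cmod (?c q) * cmod (?d (\<xi> - q)))" for k \<xi>
  proof -
    have "a k \<xi> = (LINT x|torusM. (\<Sum>q\<in>F k. ?c q * (psum ?d (G k) x * wave (- (\<xi> - q)) x)))"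
    proof -
      have "wave (- (\<xi> - q)) x = wave q x * wave (- \<xi>) x" for q x
        using wave_add[of q "- \<xi>" x] by simp
      then show ?thesis
        unfolding a_def by (intro Bochner_Integration.integral_cong refl)
          (simp add: psum_def[of ?c] sum_distrib_left sum_distrib_right mult_ac)
    qed
    also have "\<dots> = (\<Sum>q\<in>F k. ?c q * (LINT x|torusM. psum ?d (G k) x * wave (- (\<xi> - q)) x))"
    proof (subst Bochner_Integration.integral_sum)
      show "integrable torusM (\<lambda>x. ?c q * (psum ?d (G k) x * wave (- (\<xi> - q)) x))" for q
        using norm_psum_le[of ?d "G k"]
        by (intro integrable_mult_right integrable_torus_bounded[where B = "\<Sum>\<xi>\<in>G k. cmod (?d \<xi>)"] measurable_torus)
          (simp_all add: norm_mult)
    qed simp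
    also have "\<dots> = (\<Sum>q\<in>F k. ?c q * (if \<xi> - q \<in> G k then ?d (\<xi> - q) else 0))"
      by (simp only: integral_psum_wave[OF G(1)])
    finally have "cmod (a k \<xi>) \<le> (\<Sum>q\<in>F k. cmod (?c q * (if \<xi> - q \<in> G k then ?d (\<xi> - q) else 0)))"
      by (simp only: norm_sum)
    also have "\<dots> \<le> (\<Sum>q\<in>F k. cmod (?c q) * cmod (?d (\<xi> - q)))"
      by (intro sum_mono) (auto simp: norm_mult)
    finally show ?thesis .
  qed
  ultimately show ?thesis using F(1) by blast
qed

section \<open>Sobolev sequences and the product estimate\<close>

definition sobolev :: "real \<Rightarrow> (int ^ 'n \<Rightarrow> complex) \<Rightarrow> bool" where
  "sobolev s c \<longleftrightarrow> (\<lambda>\<xi>. weight \<xi> powr s * (cmod (c \<xi>))\<^sup>2) summable_on UNIV"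

lemma H_per_iff: "T \<in> H_per s \<longleftrightarrow> T \<in> distributions \<and> sobolev s (fourier_coeff T)"
  by (simp add: H_per_def sobolev_def weight_def)

lemma sobolev_dominated:
  assumes "sobolev s c" "r \<le> s" "\<And>\<xi>. cmod (d \<xi>) \<le> K * cmod (c \<xi>)"
  shows "sobolev r d"
proof -
  have "(\<lambda>\<xi>. K\<^sup>2 * (weight \<xi> powr s * (cmod (c \<xi>))\<^sup>2)) summable_on UNIV"
    using assms(1) unfolding sobolev_def by (rule summable_on_cmult_right)
  then show ?thesis
    unfolding sobolev_def
  proof (rule summable_on_comparison_test)
    fix \<xi>
    have "(cmod (d \<xi>))\<^sup>2 \<le> (K * cmod (c \<xi>))\<^sup>2" by (intro power_mono assms(3)) auto
    moreover have "weight \<xi> powr r \<le> weight \<xi> powr s"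
      using weight_ge_1 assms(2) by (intro powr_mono) auto
    ultimately have "weight \<xi> powr r * (cmod (d \<xi>))\<^sup>2 \<le> weight \<xi> powr s * (K * cmod (c \<xi>))\<^sup>2"
      by (intro mult_mono) auto
    then show "weight \<xi> powr r * (cmod (d \<xi>))\<^sup>2 \<le> K\<^sup>2 * (weight \<xi> powr s * (cmod (c \<xi>))\<^sup>2)"
      by (simp add: power_mult_distrib mult_ac)
  qed simp
qed

lemma sobolev_mono: "sobolev s c \<Longrightarrow> r \<le> s \<Longrightarrow> sobolev r c"
  by (erule sobolev_dominated[where K = 1]) auto

text \<open>The weight has order two, so its power q accounts for 2q derivatives. With q = 1 and q =
  1/2 this reads off the gain of two derivatives for the velocity and one for the pressure.\<close>

lemma sobolev_weight_mult_iff: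
  "sobolev s (\<lambda>\<xi>. of_real (weight \<xi> powr q) * c \<xi>) \<longleftrightarrow> sobolev (s + 2 * q) c"
proof -
  have "weight \<xi> powr s * (cmod (of_real (weight \<xi> powr q) * c \<xi>))\<^sup>2 = weight \<xi> powr (s + 2 * q) * (cmod (c \<xi>))\<^sup>2" for \<xi>
  proof -
    have "(weight \<xi> powr q)\<^sup>2 = weight \<xi> powr (2 * q)"
      by (simp only: power2_eq_square powr_add[symmetric] mult_2)
    then show ?thesis by (simp add: norm_mult power_mult_distrib powr_add[of _ s])
  qed
  then show ?thesis by (simp only: sobolev_def)
qed

lemma sobolev_add:
  assumes "sobolev s c" "sobolev s d"
  shows "sobolev s (\<lambda>\<xi>. c \<xi> + d \<xi>)"
proof -
  have "(\<lambda>\<xi>. 2 * (weight \<xi> powr s * (cmod (c \<xi>))\<^sup>2) + 2 * (weight \<xi> powr s * (cmod (d \<xi>))\<^sup>2)) summable_on UNIV"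
    using assms unfolding sobolev_def by (intro summable_on_add summable_on_cmult_right)
  then show ?thesis
    unfolding sobolev_def
  proof (rule summable_on_comparison_test)
    fix \<xi>
    have "(cmod (c \<xi> + d \<xi>))\<^sup>2 \<le> (cmod (c \<xi>) + cmod (d \<xi>))\<^sup>2"
      by (intro power_mono norm_triangle_ineq) auto
    also have "\<dots> \<le> 2 * (cmod (c \<xi>))\<^sup>2 + 2 * (cmod (d \<xi>))\<^sup>2"
      using zero_le_power2[of "cmod (c \<xi>) - cmod (d \<xi>)"] by (simp add: power2_eq_square algebra_simps)
    finally have "weight \<xi> powr s * (cmod (c \<xi> + d \<xi>))\<^sup>2 \<le> weight \<xi> powr s * (2 * (cmod (c \<xi>))\<^sup>2 + 2 * (cmod (d \<xi>))\<^sup>2)"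
      by (intro mult_left_mono) auto
    then show "weight \<xi> powr s * (cmod (c \<xi> + d \<xi>))\<^sup>2
        \<le> 2 * (weight \<xi> powr s * (cmod (c \<xi>))\<^sup>2) + 2 * (weight \<xi> powr s * (cmod (d \<xi>))\<^sup>2)"
      by (simp add: distrib_left mult_ac)
  qed simp
qed

lemma sobolev_norm: "sobolev s (\<lambda>\<xi>. of_real (cmod (c \<xi>))) \<longleftrightarrow> sobolev s c"
  by (simp add: sobolev_def)

lemma sobolev_sum_norm:
  assumes "finite I" "\<And>i. i \<in> I \<Longrightarrow> sobolev s (c i)"
  shows "sobolev s (\<lambda>\<xi>. of_real (\<Sum>i\<in>I. cmod (c i \<xi>)))"
  using assms
proof (induction I)
  case empty
  then show ?case by (simp add: sobolev_def)
next
  case (insert i I)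
  then have "sobolev s (\<lambda>\<xi>. of_real (cmod (c i \<xi>)) + of_real (\<Sum>i\<in>I. cmod (c i \<xi>)))"
    by (intro sobolev_add insert.IH) (auto simp: sobolev_norm)
  then show ?case using insert.hyps by simp
qed

lemma sobolev_finite_bound:
  assumes "sobolev s c"
  obtains P where "\<And>X. finite X \<Longrightarrow> (\<Sum>\<xi>\<in>X. weight \<xi> powr s * (cmod (c \<xi>))\<^sup>2) \<le> P"
  using assms unfolding sobolev_def by (subst (asm) summable_on_nonneg_iff) auto

lemma weight_powr_half_square: "(weight \<xi> powr (s / 2))\<^sup>2 = weight \<xi> powr s"
  by (simp add: power2_eq_square powr_add[symmetric])

text \<open>After the weights of order s are absorbed into the square-summable sequences
  \<open>A\<close> and \<open>B\<close>, the splitting inequality leaves one factor \<open>w\<close>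
  at one of the three frequencies. The assumption \<open>large\<close> says precisely that the
  exponent of the squared \<open>w\<close> is in the summable range.\<close>

lemma sobolev_dist_mult:
  fixes S T :: "'n::finite distribution"
  assumes S: "S \<in> distributions" "sobolev s (fourier_coeff S)"
    and T: "T \<in> distributions" "sobolev s (fourier_coeff T)"
    and s: "0 \<le> s" "0 < \<delta>" "\<delta> \<le> 1" and large: "s + 1 - \<delta> > real CARD('n) / 2"
  shows "sobolev (s - 1 + \<delta>) (fourier_coeff (dist_mult S T))"
proof -
  define t where "t = s - 1 + \<delta>"
  define \<sigma> where "\<sigma> = s + 1 - \<delta>"
  let ?N = "fourier_coeff (dist_mult S T)"
  have "sobolev 0 (fourier_coeff S)" "sobolev 0 (fourier_coeff T)"
    using S(2) T(2) s(1) by (auto intro: sobolev_mono)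
  moreover have "weight \<xi> powr 0 = 1" for \<xi> :: "int ^ 'n" using weight_pos[of \<xi>] by simp
  ultimately have "(\<lambda>\<xi>. (cmod (fourier_coeff S \<xi>))\<^sup>2) summable_on UNIV" "(\<lambda>\<xi>. (cmod (fourier_coeff T \<xi>))\<^sup>2) summable_on UNIV"
    by (simp_all only: sobolev_def mult_1)
  then obtain F a where F: "\<And>k::nat. finite (F k)" and lim: "\<And>\<xi>. (\<lambda>k. a k \<xi>) \<longlonglongrightarrow> ?N \<xi>"
    and a: "\<And>k \<xi>. cmod (a k \<xi>) \<le> (\<Sum>q\<in>F k. cmod (fourier_coeff S q) * cmod (fourier_coeff T (\<xi> - q)))"
    using fourier_coeff_dist_mult_limit[OF S(1) _ T(1)] by blast
  define A where "A \<xi> = weight \<xi> powr (s / 2) * cmod (fourier_coeff S \<xi>)" for \<xi>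
  define B where "B \<xi> = weight \<xi> powr (s / 2) * cmod (fourier_coeff T \<xi>)" for \<xi>
  define w where "w \<xi> = weight \<xi> powr (- \<sigma> / 2)" for \<xi> :: "int ^ 'n"
  have nonneg: "0 \<le> A \<xi>" "0 \<le> B \<xi>" "0 \<le> w \<xi>" for \<xi> by (simp_all add: A_def B_def w_def)
  obtain P where P: "\<And>X. finite X \<Longrightarrow> (\<Sum>\<xi>\<in>X. (A \<xi>)\<^sup>2) \<le> P"
    using sobolev_finite_bound[OF S(2)] unfolding A_def power_mult_distrib weight_powr_half_square by blast
  obtain Q where Q: "\<And>X. finite X \<Longrightarrow> (\<Sum>\<xi>\<in>X. (B \<xi>)\<^sup>2) \<le> Q"
    using sobolev_finite_bound[OF T(2)] unfolding B_def power_mult_distrib weight_powr_half_square by blast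
  obtain Z where Z: "\<And>X. finite X \<Longrightarrow> (\<Sum>\<xi>\<in>X. (w \<xi>)\<^sup>2) \<le> Z"
    using sum_weight_powr_bound[of \<sigma>, where 'n = 'n] large
    unfolding w_def weight_powr_half_square \<sigma>_def by blast
  define K where "K = (4::real) powr (s / 2)"
  have K: "0 \<le> K" by (simp add: K_def)
  let ?C = "\<lambda>k \<xi>. \<Sum>q\<in>F k. A q * B (\<xi> - q) * (w \<xi> + w q + w (\<xi> - q))"
  have pt: "weight \<xi> powr (t / 2) * cmod (a k \<xi>) \<le> K * ?C k \<xi>" for k \<xi>
  proof -
    have "weight \<xi> powr (t / 2) * cmod (a k \<xi>)
        \<le> weight \<xi> powr (t / 2) * (\<Sum>q\<in>F k. cmod (fourier_coeff S q) * cmod (fourier_coeff T (\<xi> - q)))"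
      by (intro mult_left_mono a) simp
    also have "\<dots> = (\<Sum>q\<in>F k. weight \<xi> powr (t / 2) * (cmod (fourier_coeff S q) * cmod (fourier_coeff T (\<xi> - q))))"
      by (rule sum_distrib_left)
    also have "\<dots> \<le> (\<Sum>q\<in>F k. K * (A q * B (\<xi> - q) * (w \<xi> + w q + w (\<xi> - q))))"
    proof (rule sum_mono)
      fix q
      have cancel: "y = weight \<zeta> powr (- s / 2) * (weight \<zeta> powr (s / 2) * y)" for y and \<zeta> :: "int ^ 'n"
        using weight_pos[of \<zeta>] by (simp add: mult.assoc[symmetric] powr_add[symmetric])
      have "(weight \<xi> powr (t / 2) * weight q powr (- s / 2) * weight (\<xi> - q) powr (- s / 2)) * (A q * B (\<xi> - q))
          = weight \<xi> powr (t / 2) * ((weight q powr (- s / 2) * A q) * (weight (\<xi> - q) powr (- s / 2) * B (\<xi> - q)))"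
        by (simp only: mult_ac)
      also have "\<dots> = weight \<xi> powr (t / 2) * (cmod (fourier_coeff S q) * cmod (fourier_coeff T (\<xi> - q)))"
        by (simp only: A_def B_def cancel[symmetric])
      finally have "weight \<xi> powr (t / 2) * (cmod (fourier_coeff S q) * cmod (fourier_coeff T (\<xi> - q)))
          = (weight \<xi> powr (t / 2) * weight q powr (- s / 2) * weight (\<xi> - q) powr (- s / 2)) * (A q * B (\<xi> - q))"
        by (rule sym)
      also have "\<dots> \<le> (K * (w \<xi> + w q + w (\<xi> - q))) * (A q * B (\<xi> - q))"
        using weight_powr_split[OF s, of q "\<xi> - q"] nonneg
        by (intro mult_right_mono) (simp_all add: K_def w_def \<sigma>_def t_def)
      finally show "weight \<xi> powr (t / 2) * (cmod (fourier_coeff S q) * cmod (fourier_coeff T (\<xi> - q)))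
          \<le> K * (A q * B (\<xi> - q) * (w \<xi> + w q + w (\<xi> - q)))"
        by (simp only: mult_ac)
    qed
    finally show ?thesis by (simp only: sum_distrib_left)
  qed
  \<comment> \<open>A Fatou argument: the constant depends neither on X nor on k, so the limit in k
    may be taken inside the finite sum over X.\<close>
  have fin_bound: "(\<Sum>\<xi>\<in>X. weight \<xi> powr t * (cmod (?N \<xi>))\<^sup>2) \<le> K\<^sup>2 * (9 * (P * Q * Z))" if "finite X" for X
  proof (rule LIMSEQ_le_const2)
    show "(\<lambda>k. \<Sum>\<xi>\<in>X. weight \<xi> powr t * (cmod (a k \<xi>))\<^sup>2) \<longlonglongrightarrow> (\<Sum>\<xi>\<in>X. weight \<xi> powr t * (cmod (?N \<xi>))\<^sup>2)"
      by (intro tendsto_intros lim)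
    have "(\<Sum>\<xi>\<in>X. weight \<xi> powr t * (cmod (a k \<xi>))\<^sup>2) \<le> K\<^sup>2 * (9 * (P * Q * Z))" for k
    proof -
      have "(\<Sum>\<xi>\<in>X. weight \<xi> powr t * (cmod (a k \<xi>))\<^sup>2) = (\<Sum>\<xi>\<in>X. (weight \<xi> powr (t / 2) * cmod (a k \<xi>))\<^sup>2)"
        by (simp add: power_mult_distrib weight_powr_half_square)
      also have "\<dots> \<le> (\<Sum>\<xi>\<in>X. (K * ?C k \<xi>)\<^sup>2)"
        by (intro sum_mono power_mono pt) simp
      also have "\<dots> = K\<^sup>2 * (\<Sum>\<xi>\<in>X. (?C k \<xi>)\<^sup>2)"
        unfolding power_mult_distrib by (rule sum_distrib_left[symmetric])
      also have "\<dots> \<le> K\<^sup>2 * (9 * (P * Q * Z))"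
        by (intro mult_left_mono sum_convolution_weighted_le nonneg P Q Z F that zero_le_power2)
      finally show ?thesis .
    qed
    then show "\<exists>N. \<forall>k\<ge>N. (\<Sum>\<xi>\<in>X. weight \<xi> powr t * (cmod (a k \<xi>))\<^sup>2) \<le> K\<^sup>2 * (9 * (P * Q * Z))" by blast
  qed
  then show ?thesis
    unfolding sobolev_def t_def[symmetric] by (subst summable_on_nonneg_iff) auto
qed

section \<open>The symbol of the Stokes operator\<close>

text \<open>A Korn identity at a single frequency. The cross terms, summed over both indices,
  contain the divergence sum as a factor and vanish; the two remaining parts are equal after
  exchanging indices, whence the factor 1/2.\<close>

lemma norm_symmetrized_tensor_square:
  fixes x :: "'n::finite \<Rightarrow> real" and U :: "'n \<Rightarrow> complex"
  assumes div: "(\<Sum>k\<in>UNIV. of_real (x k) * U k) = 0"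
  shows "(\<Sum>k\<in>UNIV. \<Sum>\<alpha>\<in>UNIV. (cmod ((of_real (x k) * U \<alpha> + of_real (x \<alpha>) * U k) / 2))\<^sup>2)
    = (\<Sum>k\<in>UNIV. (x k)\<^sup>2) * (\<Sum>k\<in>UNIV. (cmod (U k))\<^sup>2) / 2"
proof -
  let ?z = "\<lambda>k \<alpha>. (of_real (x k) * U \<alpha> + of_real (x \<alpha>) * U k) / 2"
  let ?m = "\<lambda>k \<alpha>. complex_of_real ((x k)\<^sup>2 * (cmod (U \<alpha>))\<^sup>2)"
  let ?r = "\<lambda>k \<alpha>. (of_real (x \<alpha>) * U \<alpha>) * cnj (of_real (x k) * U k)"
  have pt: "complex_of_real ((cmod (?z k \<alpha>))\<^sup>2) = (?m k \<alpha> + ?m \<alpha> k + ?r k \<alpha> + ?r \<alpha> k) / 4" for k \<alpha>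
    unfolding of_real_mult of_real_power complex_norm_square[unfolded of_real_power]
    by (simp add: field_simps power2_eq_square)
  have div': "(\<Sum>k\<in>UNIV. cnj (of_real (x k) * U k)) = 0"
    using arg_cong[OF div, of cnj] by simp
  have r: "(\<Sum>k\<in>UNIV. \<Sum>\<alpha>\<in>UNIV. ?r k \<alpha>) = 0" "(\<Sum>k\<in>UNIV. \<Sum>\<alpha>\<in>UNIV. ?r \<alpha> k) = 0"
  proof -
    have "(\<Sum>k\<in>UNIV. \<Sum>\<alpha>\<in>UNIV. ?r k \<alpha>) = (\<Sum>k\<in>UNIV. (\<Sum>\<alpha>\<in>UNIV. of_real (x \<alpha>) * U \<alpha>) * cnj (of_real (x k) * U k))"
      by (simp only: sum_distrib_right)
    then show "(\<Sum>k\<in>UNIV. \<Sum>\<alpha>\<in>UNIV. ?r k \<alpha>) = 0" by (simp add: div)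
    then show "(\<Sum>k\<in>UNIV. \<Sum>\<alpha>\<in>UNIV. ?r \<alpha> k) = 0" by (subst sum.swap)
  qed
  have m: "(\<Sum>k\<in>UNIV. \<Sum>\<alpha>\<in>UNIV. ?m k \<alpha>) = of_real ((\<Sum>k\<in>UNIV. (x k)\<^sup>2) * (\<Sum>k\<in>UNIV. (cmod (U k))\<^sup>2))"
    by (simp only: sum_product of_real_sum)
  then have m': "(\<Sum>k\<in>UNIV. \<Sum>\<alpha>\<in>UNIV. ?m \<alpha> k) = of_real ((\<Sum>k\<in>UNIV. (x k)\<^sup>2) * (\<Sum>k\<in>UNIV. (cmod (U k))\<^sup>2))"
    by (subst sum.swap)
  have "complex_of_real (\<Sum>k\<in>UNIV. \<Sum>\<alpha>\<in>UNIV. (cmod (?z k \<alpha>))\<^sup>2)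
      = (\<Sum>k\<in>UNIV. \<Sum>\<alpha>\<in>UNIV. (?m k \<alpha> + ?m \<alpha> k + ?r k \<alpha> + ?r \<alpha> k) / 4)"
    by (simp only: of_real_sum pt)
  also have "\<dots> = ((\<Sum>k\<in>UNIV. \<Sum>\<alpha>\<in>UNIV. ?m k \<alpha>) + (\<Sum>k\<in>UNIV. \<Sum>\<alpha>\<in>UNIV. ?m \<alpha> k)
      + (\<Sum>k\<in>UNIV. \<Sum>\<alpha>\<in>UNIV. ?r k \<alpha>) + (\<Sum>k\<in>UNIV. \<Sum>\<alpha>\<in>UNIV. ?r \<alpha> k)) / 4"
    by (simp only: sum_divide_distrib[symmetric] sum.distrib)
  also have "\<dots> = of_real ((\<Sum>k\<in>UNIV. (x k)\<^sup>2) * (\<Sum>k\<in>UNIV. (cmod (U k))\<^sup>2) / 2)"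
    unfolding m m' r by simp
  finally show ?thesis by (simp only: of_real_eq_iff)
qed

definition elliptic_constant :: "'n::finite tensor \<Rightarrow> real \<Rightarrow> bool" where
  "elliptic_constant a C \<longleftrightarrow> (\<forall>\<zeta> :: real ^ 'n ^ 'n. \<zeta> = transpose \<zeta> \<longrightarrow> (\<Sum>k\<in>UNIV. \<zeta> $ k $ k) = 0 \<longrightarrow>
     (\<Sum>k\<in>UNIV. \<Sum>\<alpha>\<in>UNIV. \<zeta> $ k $ \<alpha> * \<zeta> $ k $ \<alpha>) \<le>
     C * (\<Sum>k\<in>UNIV. \<Sum>j\<in>UNIV. \<Sum>\<alpha>\<in>UNIV. \<Sum>\<beta>\<in>UNIV. a k j \<alpha> \<beta> * \<zeta> $ k $ \<alpha> * \<zeta> $ j $ \<beta>))"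

text \<open>
  Testing with the conjugate of \<open>U\<close> removes the pressure, and the symmetry of \<open>a\<close> replaces \<open>x \<otimes> U\<close> by its
  symmetric, trace-free part, to which relaxed ellipticity applies separately in real and imaginary part.
\<close>

lemma elliptic_symbol_bound:
  fixes a :: "'n::finite tensor" and x :: "'n \<Rightarrow> real" and U H :: "'n \<Rightarrow> complex"
  assumes sym: "tensor_symmetric a"
    and C: "C > 0" "elliptic_constant a C"
    and div: "(\<Sum>k\<in>UNIV. of_real (x k) * U k) = 0"
    and eq: "\<And>k. 4 * of_real pi ^ 2 * (\<Sum>\<alpha>\<in>UNIV. of_real (x \<alpha>) * (\<Sum>j\<in>UNIV. \<Sum>\<beta>\<in>UNIV.
        of_real (a k j \<alpha> \<beta>) * ((of_real (x j) * U \<beta> + of_real (x \<beta>) * U j) / 2))) + of_real (x k) * P = H k"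
  shows "(\<Sum>k\<in>UNIV. (x k)\<^sup>2) * cmod (U m) \<le> C * (\<Sum>k\<in>UNIV. cmod (H k))"
proof -
  define z where "z k \<alpha> = (of_real (x k) * U \<alpha> + of_real (x \<alpha>) * U k) / 2" for k \<alpha>
  define R where "R = sqrt (\<Sum>k\<in>UNIV. (cmod (U k))\<^sup>2)"
  define X where "X = (\<Sum>k\<in>UNIV. (x k)\<^sup>2)"
  have R2: "R\<^sup>2 = (\<Sum>k\<in>UNIV. (cmod (U k))\<^sup>2)" by (simp add: R_def sum_nonneg)
  have R0: "0 \<le> R" by (simp add: R_def sum_nonneg)
  have U_le: "cmod (U k) \<le> R" for k
  proof -
    have "(cmod (U k))\<^sup>2 \<le> R\<^sup>2" unfolding R2 by (rule member_le_sum) auto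
    then show ?thesis using R0 by (rule power2_le_imp_le)
  qed
  let ?A = "\<lambda>k j \<alpha> \<beta>. complex_of_real (a k j \<alpha> \<beta>)"
  let ?T = "\<lambda>k \<alpha>. \<Sum>j\<in>UNIV. \<Sum>\<beta>\<in>UNIV. ?A k j \<alpha> \<beta> * z j \<beta>"
  have T_sym: "?T k \<alpha> = ?T \<alpha> k" for k \<alpha>
  proof -
    have "a k j \<alpha> \<beta> = a \<alpha> j k \<beta>" for j \<beta>
      using sym unfolding tensor_symmetric_def by blast
    then show ?thesis by (simp only:)
  qed
  define Q where "Q = (\<Sum>k\<in>UNIV. \<Sum>\<alpha>\<in>UNIV. cnj (z k \<alpha>) * ?T k \<alpha>)"
  define Y where "Y = (\<Sum>k\<in>UNIV. \<Sum>\<alpha>\<in>UNIV. cnj (U k) * (of_real (x \<alpha>) * ?T k \<alpha>))"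
  have QY: "Q = Y"
  proof -
    have "cnj (z k \<alpha>) * y = (cnj (U \<alpha>) * (of_real (x k) * y) + cnj (U k) * (of_real (x \<alpha>) * y)) / 2" for k \<alpha> y
      by (simp add: z_def field_simps)
    then have "Q = ((\<Sum>k\<in>UNIV. \<Sum>\<alpha>\<in>UNIV. cnj (U \<alpha>) * (of_real (x k) * ?T k \<alpha>)) + Y) / 2"
      unfolding Q_def Y_def by (simp only: sum.distrib sum_divide_distrib[symmetric])
    also have "(\<Sum>k\<in>UNIV. \<Sum>\<alpha>\<in>UNIV. cnj (U \<alpha>) * (of_real (x k) * ?T k \<alpha>)) = Y"
      unfolding Y_def by (subst sum.swap) (intro sum.cong refl arg_cong2[where f = "(*)"] T_sym)
    finally show ?thesis by simp
  qed
  have div': "(\<Sum>k\<in>UNIV. of_real (x k) * cnj (U k)) = 0"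
    using arg_cong[OF div, of cnj] by simp
  have QH: "4 * of_real pi ^ 2 * Q = (\<Sum>k\<in>UNIV. cnj (U k) * H k)"
  proof -
    have "u * (c + v * P) = u * c + P * (v * u)" for u c v by (simp add: algebra_simps)
    moreover have "H k = 4 * of_real pi ^ 2 * (\<Sum>\<alpha>\<in>UNIV. of_real (x \<alpha>) * ?T k \<alpha>) + of_real (x k) * P" for k
      unfolding z_def by (rule eq[symmetric])
    ultimately have "(\<Sum>k\<in>UNIV. cnj (U k) * H k)
        = (\<Sum>k\<in>UNIV. cnj (U k) * (4 * of_real pi ^ 2 * (\<Sum>\<alpha>\<in>UNIV. of_real (x \<alpha>) * ?T k \<alpha>)) + P * (of_real (x k) * cnj (U k)))"
      by (simp only:)
    also have "\<dots> = 4 * of_real pi ^ 2 * Y + P * (\<Sum>k\<in>UNIV. of_real (x k) * cnj (U k))"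
      unfolding Y_def sum.distrib sum_distrib_left by (simp only: mult.left_commute)
    finally show ?thesis by (simp add: div' QY)
  qed
  have ReQ: "(\<Sum>k\<in>UNIV. \<Sum>\<alpha>\<in>UNIV. (cmod (z k \<alpha>))\<^sup>2) \<le> C * Re Q"
  proof -
    let ?q = "\<lambda>\<zeta> :: real ^ 'n ^ 'n. \<Sum>k\<in>UNIV. \<Sum>j\<in>UNIV. \<Sum>\<alpha>\<in>UNIV. \<Sum>\<beta>\<in>UNIV. a k j \<alpha> \<beta> * \<zeta> $ k $ \<alpha> * \<zeta> $ j $ \<beta>"
    define zr :: "real ^ 'n ^ 'n" where "zr = (\<chi> k \<alpha>. Re (z k \<alpha>))"
    define zi :: "real ^ 'n ^ 'n" where "zi = (\<chi> k \<alpha>. Im (z k \<alpha>))"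
    have zsym: "z k \<alpha> = z \<alpha> k" for k \<alpha> by (simp add: z_def add.commute)
    have ztr: "(\<Sum>k\<in>UNIV. z k k) = 0"
    proof -
      have "z k k = of_real (x k) * U k" for k by (simp add: z_def)
      then show ?thesis using div by (simp only:)
    qed
    have tr: "zr = transpose zr" "zi = transpose zi"
      using arg_cong[OF zsym, of Re] arg_cong[OF zsym, of Im] by (auto simp: zr_def zi_def transpose_def vec_eq_iff)
    have tr0: "(\<Sum>k\<in>UNIV. zr $ k $ k) = 0" "(\<Sum>k\<in>UNIV. zi $ k $ k) = 0"
      using arg_cong[OF ztr, of Re] arg_cong[OF ztr, of Im] by (simp_all add: zr_def zi_def)
    have "(\<Sum>k\<in>UNIV. \<Sum>\<alpha>\<in>UNIV. zr $ k $ \<alpha> * zr $ k $ \<alpha>) \<le> C * ?q zr"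
        "(\<Sum>k\<in>UNIV. \<Sum>\<alpha>\<in>UNIV. zi $ k $ \<alpha> * zi $ k $ \<alpha>) \<le> C * ?q zi"
      using C(2) tr tr0 unfolding elliptic_constant_def by (blast, blast)
    moreover have "(\<Sum>k\<in>UNIV. \<Sum>\<alpha>\<in>UNIV. (cmod (z k \<alpha>))\<^sup>2)
        = (\<Sum>k\<in>UNIV. \<Sum>\<alpha>\<in>UNIV. zr $ k $ \<alpha> * zr $ k $ \<alpha>) + (\<Sum>k\<in>UNIV. \<Sum>\<alpha>\<in>UNIV. zi $ k $ \<alpha> * zi $ k $ \<alpha>)"
    proof -
      have "(cmod (z k \<alpha>))\<^sup>2 = zr $ k $ \<alpha> * zr $ k $ \<alpha> + zi $ k $ \<alpha> * zi $ k $ \<alpha>" for k \<alpha>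
        unfolding cmod_power2 by (simp add: zr_def zi_def power2_eq_square)
      then show ?thesis by (simp only: sum.distrib)
    qed
    moreover have "Re Q = ?q zr + ?q zi"
    proof -
      have "Re Q = (\<Sum>k\<in>UNIV. \<Sum>\<alpha>\<in>UNIV. \<Sum>j\<in>UNIV. \<Sum>\<beta>\<in>UNIV.
          a k j \<alpha> \<beta> * zr $ k $ \<alpha> * zr $ j $ \<beta> + a k j \<alpha> \<beta> * zi $ k $ \<alpha> * zi $ j $ \<beta>)"
        unfolding Q_def sum_distrib_left Re_sum
        by (intro sum.cong refl) (simp add: zr_def zi_def algebra_simps)
      also have "\<dots> = (\<Sum>k\<in>UNIV. \<Sum>j\<in>UNIV. \<Sum>\<alpha>\<in>UNIV. \<Sum>\<beta>\<in>UNIV.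
          a k j \<alpha> \<beta> * zr $ k $ \<alpha> * zr $ j $ \<beta> + a k j \<alpha> \<beta> * zi $ k $ \<alpha> * zi $ j $ \<beta>)"
        by (intro sum.cong refl sum.swap)
      finally show ?thesis by (simp only: sum.distrib)
    qed
    ultimately show ?thesis by (simp only: distrib_left)
  qed
  have "X * R\<^sup>2 / 2 \<le> C * Re Q"
    using ReQ norm_symmetrized_tensor_square[OF div] by (simp only: z_def X_def R2)
  also have "\<dots> \<le> C * ((\<Sum>k\<in>UNIV. cmod (H k)) * R / (4 * pi\<^sup>2))"
  proof (intro mult_left_mono)
    have "4 * pi\<^sup>2 * Re Q = Re (4 * of_real pi ^ 2 * Q)"
      by (simp add: power2_eq_square)
    also have "\<dots> \<le> cmod (\<Sum>k\<in>UNIV. cnj (U k) * H k)"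
      unfolding QH by (rule complex_Re_le_cmod)
    also have "\<dots> \<le> (\<Sum>k\<in>UNIV. cmod (U k) * cmod (H k))"
      by (rule order_trans[OF norm_sum]) (simp add: norm_mult)
    also have "\<dots> \<le> (\<Sum>k\<in>UNIV. R * cmod (H k))"
      by (intro sum_mono mult_right_mono U_le) auto
    also have "\<dots> = (\<Sum>k\<in>UNIV. cmod (H k)) * R" by (simp only: sum_distrib_left mult.commute)
    finally show "Re Q \<le> (\<Sum>k\<in>UNIV. cmod (H k)) * R / (4 * pi\<^sup>2)"
      by (simp add: pos_le_divide_eq mult.commute)
  qed (use C in simp)
  \<comment> \<open>Since 4 pi^2 \<ge> 2, the constant of the symbol can be traded for 2, which
    cancels the factor 1/2 coming from the symmetrization.\<close>
  also have "\<dots> \<le> C * ((\<Sum>k\<in>UNIV. cmod (H k)) * R / 2)"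
  proof (intro mult_left_mono divide_left_mono)
    have "2\<^sup>2 \<le> pi\<^sup>2" using pi_ge_two by (intro power_mono) auto
    then show "2 \<le> 4 * pi\<^sup>2" by simp
  qed (use C R0 in \<open>auto intro!: mult_nonneg_nonneg sum_nonneg\<close>)
  finally have fin: "(X * R) * R \<le> (C * (\<Sum>k\<in>UNIV. cmod (H k))) * R" by (simp add: power2_eq_square mult_ac)
  have "X * R \<le> C * (\<Sum>k\<in>UNIV. cmod (H k))"
  proof (cases "R = 0")
    case True
    then show ?thesis using C by (simp add: sum_nonneg)
  next
    case False
    then show ?thesis using fin R0 by (simp add: mult_le_cancel_right)
  qed
  moreover have "X * cmod (U m) \<le> X * R"
    by (intro mult_left_mono U_le) (simp add: X_def sum_nonneg)
  ultimately show ?thesis by (simp add: X_def)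
qed

section \<open>The equation in Fourier coefficients\<close>

lemma partial_deriv_scaled_wave:
  "partial_deriv i (\<lambda>x. c * wave (- \<xi>) x) = (\<lambda>x. (- c * (freq \<xi> i)) * wave (- \<xi>) x)"
proof
  fix x
  have "((\<lambda>x. c * wave (- \<xi>) x) has_derivative (\<lambda>h. c * frechet_derivative (wave (- \<xi>)) (at x) h)) (at x)"
    using differentiable_wave frechet_derivative_works by (intro has_derivative_mult_right) blast
  from partial_deriv_eq[OF this, of i]
  show "partial_deriv i (\<lambda>x. c * wave (- \<xi>) x) x = (- c * (freq \<xi> i)) * wave (- \<xi>) x"
    using partial_deriv_wave[of i "- \<xi>" x] by (simp add: partial_deriv_def)
qed

text \<open>The premise asks for homogeneity on multiples of one wave, a family stable under
  differentiation. In this form the rule applies to \<open>dist_mult\<close> as well, whose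
  continuity as a functional has not been established.\<close>

lemma dist_deriv_scaled_wave:
  assumes "\<And>c. T (\<lambda>x. c * wave (- \<xi>) x) = c * fourier_coeff T \<xi>"
  shows "dist_deriv i T (\<lambda>x. c * wave (- \<xi>) x) = c * (freq \<xi> i) * fourier_coeff T \<xi>"
  unfolding dist_deriv_def partial_deriv_scaled_wave assms by simp

lemma distribution_scaled_wave:
  assumes "T \<in> distributions"
  shows "T (\<lambda>x. c * wave (- \<xi>) x) = c * fourier_coeff T \<xi>"
  using distributionsD(2)[OF assms wave_Cinf, of c] by (simp add: fourier_coeff_eq)

lemma dist_mult_scaled_wave:
  "dist_mult S T (\<lambda>x. c * wave (- \<xi>) x) = c * fourier_coeff (dist_mult S T) \<xi>"
  unfolding fourier_coeff_eq unfolding dist_mult_def dist_of_eq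
  by (simp add: mult.left_commute[of _ c])

text \<open>Each term is tested with \<open>wave (- \<xi>)\<close>. The two derivatives in the
  viscous term give (2 pi i)^2 = - 4 pi^2, so the minus sign of the equation turns it positive. The
  shape matches the hypothesis of \<open>elliptic_symbol_bound\<close>, with 2 pi i times the
  pressure coefficient as P.\<close>

lemma NS_fourier:
  fixes u :: "'n \<Rightarrow> 'n::finite distribution"
  assumes NS: "NS_solution a u p f"
    and u: "\<And>k. u k \<in> distributions" and p: "p \<in> distributions"
  shows "4 * of_real pi ^ 2 * (\<Sum>\<alpha>\<in>UNIV. of_real (of_int (\<xi> $ \<alpha>)) * (\<Sum>j\<in>UNIV. \<Sum>\<beta>\<in>UNIV. of_real (a k j \<alpha> \<beta>) *
      ((of_real (of_int (\<xi> $ j)) * fourier_coeff (u \<beta>) \<xi> + of_real (of_int (\<xi> $ \<beta>)) * fourier_coeff (u j) \<xi>) / 2)))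
    + of_real (of_int (\<xi> $ k)) * (2 * of_real pi * \<i> * fourier_coeff p \<xi>)
    = fourier_coeff (f k) \<xi>
      - (\<Sum>j\<in>UNIV. freq \<xi> j * fourier_coeff (dist_mult (u j) (u k)) \<xi>)"
proof -
  let ?e = "wave (- \<xi>)"
  let ?D = "\<lambda>i. freq \<xi> i"
  let ?U = "\<lambda>k. fourier_coeff (u k) \<xi>"
  have strain: "strain u j \<beta> (\<lambda>x. c * ?e x) = c * ((?D j * ?U \<beta> + ?D \<beta> * ?U j) / 2)" for j \<beta> c
    unfolding strain_def
    by (simp only: dist_deriv_scaled_wave[OF distribution_scaled_wave[OF u]]) (simp add: algebra_simps add_divide_distrib)
  have "L_op a u k ?e = (\<Sum>\<alpha>\<in>UNIV. ?D \<alpha> * (\<Sum>j\<in>UNIV. \<Sum>\<beta>\<in>UNIV. of_real (a k j \<alpha> \<beta>) * ((?D j * ?U \<beta> + ?D \<beta> * ?U j) / 2)))"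
  proof -
    \<comment> \<open>The factor 1 puts the wave into the scaled form to which the differentiation
      rules apply.\<close>
    have "L_op a u k (\<lambda>x. 1 * ?e x) = (\<Sum>\<alpha>\<in>UNIV. - (\<Sum>j\<in>UNIV. \<Sum>\<beta>\<in>UNIV. of_real (a k j \<alpha> \<beta>) * ((- 1 * ?D \<alpha>) * ((?D j * ?U \<beta> + ?D \<beta> * ?U j) / 2))))"
      unfolding L_op_def dist_deriv_def[of _ "\<lambda>\<psi>. \<Sum>j\<in>UNIV. \<Sum>\<beta>\<in>UNIV. of_real (a k j _ \<beta>) * strain u j \<beta> \<psi>"]
        partial_deriv_scaled_wave strain by simp
    also have "\<dots> = (\<Sum>\<alpha>\<in>UNIV. ?D \<alpha> * (\<Sum>j\<in>UNIV. \<Sum>\<beta>\<in>UNIV. of_real (a k j \<alpha> \<beta>) * ((?D j * ?U \<beta> + ?D \<beta> * ?U j) / 2)))"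
      unfolding sum_distrib_left sum_negf[symmetric] by (intro sum.cong refl) simp
    finally show ?thesis by simp
  qed
  also have "\<dots> = - (4 * of_real pi ^ 2 * (\<Sum>\<alpha>\<in>UNIV. of_real (of_int (\<xi> $ \<alpha>)) * (\<Sum>j\<in>UNIV. \<Sum>\<beta>\<in>UNIV. of_real (a k j \<alpha> \<beta>) *
      ((of_real (of_int (\<xi> $ j)) * ?U \<beta> + of_real (of_int (\<xi> $ \<beta>)) * ?U j) / 2))))"
    unfolding sum_distrib_left sum_negf[symmetric]
    by (intro sum.cong refl) (simp add: power2_eq_square field_simps)
  finally have L: "L_op a u k ?e = - (4 * of_real pi ^ 2 * (\<Sum>\<alpha>\<in>UNIV. of_real (of_int (\<xi> $ \<alpha>)) * (\<Sum>j\<in>UNIV. \<Sum>\<beta>\<in>UNIV. of_real (a k j \<alpha> \<beta>) *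
      ((of_real (of_int (\<xi> $ j)) * ?U \<beta> + of_real (of_int (\<xi> $ \<beta>)) * ?U j) / 2))))" .
  have P: "dist_deriv k p ?e = of_real (of_int (\<xi> $ k)) * (2 * of_real pi * \<i> * fourier_coeff p \<xi>)"
    using dist_deriv_scaled_wave[where c = 1, OF distribution_scaled_wave[OF p], of k \<xi>] by (simp add: mult_ac)
  have C: "convection u k ?e = (\<Sum>j\<in>UNIV. ?D j * fourier_coeff (dist_mult (u j) (u k)) \<xi>)"
  proof -
    have "dist_deriv j (dist_mult (u j) (u k)) ?e = ?D j * fourier_coeff (dist_mult (u j) (u k)) \<xi>" for j
      using dist_deriv_scaled_wave[where c = 1 and T = "dist_mult (u j) (u k)" and i = j, OF dist_mult_scaled_wave] by simp
    then show ?thesis by (simp only: convection_def)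
  qed
  have "- L_op a u k ?e + dist_deriv k p ?e + convection u k ?e = fourier_coeff (f k) \<xi>"
    using NS wave_Cinf[of "- \<xi>"] by (simp add: NS_solution_def dist_eq_def fourier_coeff_eq)
  then show ?thesis unfolding L P C by (simp add: algebra_simps)
qed

lemma divergence_fourier:
  fixes u :: "'n \<Rightarrow> 'n::finite distribution"
  assumes div: "dist_div u =\<^sub>D (\<lambda>\<phi>. 0)" and u: "\<And>k. u k \<in> distributions"
  shows "(\<Sum>k\<in>UNIV. of_real (of_int (\<xi> $ k)) * fourier_coeff (u k) \<xi>) = 0"
proof -
  have "dist_div u (wave (- \<xi>)) = 0" using div wave_Cinf[of "- \<xi>"] by (simp add: dist_eq_def)
  moreover have "dist_deriv j (u j) (wave (- \<xi>)) = 2 * of_real pi * \<i> * (of_real (of_int (\<xi> $ j)) * fourier_coeff (u j) \<xi>)" for j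
    using dist_deriv_scaled_wave[where c = 1, OF distribution_scaled_wave[OF u[of j]], of j \<xi>] by (simp add: mult_ac)
  ultimately have "2 * of_real pi * \<i> * (\<Sum>k\<in>UNIV. of_real (of_int (\<xi> $ k)) * fourier_coeff (u k) \<xi>) = 0"
    unfolding dist_div_def by (simp only: sum_distrib_left)
  then show ?thesis by simp
qed

text \<open>A nonzero integer vector has length at least 1, so away from frequency 0 the weight is
  comparable to the symbol. At frequency 0 the mean-value conditions on velocity and pressure take
  over.\<close>

lemma weight_le_sum_squares: "\<xi> \<noteq> 0 \<Longrightarrow> weight \<xi> \<le> 2 * (\<Sum>i\<in>UNIV. (real_of_int (\<xi> $ i))\<^sup>2)"
proof -
  assume "\<xi> \<noteq> 0"
  then obtain i where "\<xi> $ i \<noteq> 0" by (auto simp: vec_eq_iff)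
  then have "1 \<le> \<bar>\<xi> $ i\<bar>" by linarith
  then have "1\<^sup>2 \<le> (real_of_int \<bar>\<xi> $ i\<bar>)\<^sup>2" by (intro power_mono) linarith+
  then have "1 \<le> (real_of_int (\<xi> $ i))\<^sup>2" by simp
  also have "\<dots> \<le> (\<Sum>i\<in>UNIV. (real_of_int (\<xi> $ i))\<^sup>2)" by (rule member_le_sum) auto
  finally show ?thesis by (simp add: weight_def)
qed

lemma abs_component_le_sqrt_weight: "\<bar>real_of_int (\<xi> $ i)\<bar> \<le> weight \<xi> powr (1/2)"
proof -
  have "(real_of_int (\<xi> $ i))\<^sup>2 \<le> (\<Sum>i\<in>UNIV. (real_of_int (\<xi> $ i))\<^sup>2)" by (rule member_le_sum) auto
  then have "\<bar>real_of_int (\<xi> $ i)\<bar> \<le> sqrt (weight \<xi>)" by (intro real_le_rsqrt) (simp add: weight_def)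
  then show ?thesis using weight_pos[of \<xi>] by (simp add: powr_half_sqrt)
qed

definition tensor_bound :: "'n::finite tensor \<Rightarrow> real" where
  "tensor_bound a = (\<Sum>k\<in>UNIV. \<Sum>\<alpha>\<in>UNIV. \<Sum>j\<in>UNIV. \<Sum>\<beta>\<in>UNIV. \<bar>a k j \<alpha> \<beta>\<bar>)"

text \<open>Up to a constant, a bound for f minus the divergence of u \<otimes> u at frequency
  \<xi>, the divergence counting as half a power of the weight.\<close>

definition source_size :: "('n \<Rightarrow> 'n::finite distribution) \<Rightarrow> ('n \<Rightarrow> 'n distribution) \<Rightarrow> int ^ 'n \<Rightarrow> real" where
  "source_size u f \<xi> = (\<Sum>k\<in>UNIV. cmod (fourier_coeff (f k) \<xi>))
    + weight \<xi> powr (1/2) * (\<Sum>(j, k)\<in>UNIV. cmod (fourier_coeff (dist_mult (u j) (u k)) \<xi>))"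

lemma source_size_nonneg: "0 \<le> source_size u f \<xi>"
  unfolding source_size_def by (intro add_nonneg_nonneg mult_nonneg_nonneg sum_nonneg) auto

lemma NS_fourier_estimates:
  fixes u :: "'n \<Rightarrow> 'n::finite distribution"
  assumes sym: "tensor_symmetric a" and ell: "relaxed_elliptic a"
    and NS: "NS_solution a u p f"
    and u: "\<And>k. u k \<in> distributions" and p: "p \<in> distributions"
    and div: "dist_div u =\<^sub>D (\<lambda>\<phi>. 0)"
    and u0: "\<And>k. fourier_coeff (u k) 0 = 0" and p0: "fourier_coeff p 0 = 0"
  shows "\<exists>K. \<forall>\<xi>. (\<forall>m. weight \<xi> * cmod (fourier_coeff (u m) \<xi>) \<le> K * source_size u f \<xi>)
    \<and> weight \<xi> powr (1/2) * cmod (fourier_coeff p \<xi>) \<le> K * source_size u f \<xi>"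
proof -
  obtain C where C: "C > 0" "elliptic_constant a C"
    using ell unfolding relaxed_elliptic_def elliptic_constant_def by blast
  let ?U = "\<lambda>m. fourier_coeff (u m)"
  let ?F = "\<lambda>\<xi>. \<Sum>k\<in>UNIV. cmod (fourier_coeff (f k) \<xi>)"
  let ?N = "\<lambda>\<xi>. \<Sum>(j, k)\<in>UNIV. cmod (fourier_coeff (dist_mult (u j) (u k)) \<xi>)"
  let ?H = "\<lambda>\<xi> k. fourier_coeff (f k) \<xi>
      - (\<Sum>j\<in>UNIV. freq \<xi> j * fourier_coeff (dist_mult (u j) (u k)) \<xi>)"
  let ?G = "source_size u f"
  have H: "(\<Sum>k\<in>UNIV. cmod (?H \<xi> k)) \<le> 7 * ?G \<xi>" for \<xi>
  proof -
    have "cmod (?H \<xi> k) \<le> cmod (fourier_coeff (f k) \<xi>)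
        + (\<Sum>j\<in>UNIV. 7 * (weight \<xi> powr (1/2) * cmod (fourier_coeff (dist_mult (u j) (u k)) \<xi>)))" for k
    proof (rule order_trans[OF norm_triangle_ineq4] , rule add_left_mono, rule sum_norm_le)
      fix j
      have "cmod (freq \<xi> j) \<le> 7 * weight \<xi> powr (1/2)"
        using abs_component_le_sqrt_weight[of \<xi> j] pi_approx
          mult_mono[of "2 * pi" 7 "\<bar>real_of_int (\<xi> $ j)\<bar>" "weight \<xi> powr (1/2)"]
        by (simp add: norm_mult)
      from mult_right_mono[OF this norm_ge_zero]
      show "cmod (freq \<xi> j * fourier_coeff (dist_mult (u j) (u k)) \<xi>)
          \<le> 7 * (weight \<xi> powr (1/2) * cmod (fourier_coeff (dist_mult (u j) (u k)) \<xi>))"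
        by (simp only: norm_mult mult.assoc)
    qed
    then have "(\<Sum>k\<in>UNIV. cmod (?H \<xi> k)) \<le> (\<Sum>k\<in>UNIV. cmod (fourier_coeff (f k) \<xi>)
        + (\<Sum>j\<in>UNIV. 7 * (weight \<xi> powr (1/2) * cmod (fourier_coeff (dist_mult (u j) (u k)) \<xi>))))"
      by (rule sum_mono)
    also have "\<dots> = ?F \<xi> + 7 * (weight \<xi> powr (1/2) * (\<Sum>k\<in>UNIV. \<Sum>j\<in>UNIV. cmod (fourier_coeff (dist_mult (u j) (u k)) \<xi>)))"
      by (simp only: sum.distrib sum_distrib_left)
    also have "(\<Sum>k\<in>UNIV. \<Sum>j\<in>UNIV. cmod (fourier_coeff (dist_mult (u j) (u k)) \<xi>)) = ?N \<xi>"
      by (subst sum.swap) (simp add: sum.cartesian_product)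
    also have "?F \<xi> + 7 * (weight \<xi> powr (1/2) * ?N \<xi>) \<le> 7 * ?G \<xi>"
      by (simp add: source_size_def sum_nonneg)
    finally show ?thesis .
  qed
  note G0 = source_size_nonneg[of u f]
  \<comment> \<open>The factor 14 is 7 from the bound on the source times 2 from comparing the
    weight with the sum of squares.\<close>
  define K1 where "K1 = 14 * C"
  have U_est: "weight \<xi> * cmod (?U m \<xi>) \<le> K1 * ?G \<xi>" for m \<xi>
  proof (cases "\<xi> = 0")
    case True
    then show ?thesis using u0 G0[of \<xi>] C(1) by (simp add: K1_def)
  next
    case False
    have "(\<Sum>k\<in>UNIV. (real_of_int (\<xi> $ k))\<^sup>2) * cmod (?U m \<xi>) \<le> C * (\<Sum>k\<in>UNIV. cmod (?H \<xi> k))"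
      by (rule elliptic_symbol_bound[OF sym C divergence_fourier[OF div u] NS_fourier[OF NS u p]])
    also have "\<dots> \<le> C * (7 * ?G \<xi>)" using C(1) by (intro mult_left_mono H) auto
    finally have 1: "(\<Sum>k\<in>UNIV. (real_of_int (\<xi> $ k))\<^sup>2) * cmod (?U m \<xi>) \<le> C * (7 * ?G \<xi>)" .
    have "weight \<xi> * cmod (?U m \<xi>) \<le> 2 * (\<Sum>k\<in>UNIV. (real_of_int (\<xi> $ k))\<^sup>2) * cmod (?U m \<xi>)"
      by (intro mult_right_mono weight_le_sum_squares False) auto
    also have "\<dots> \<le> 2 * (C * (7 * ?G \<xi>))"
      using 1 by (simp only: mult.assoc)
    finally show ?thesis by (simp add: K1_def)
  qed
  define B where "B = tensor_bound a"
  have B0: "0 \<le> B" by (simp add: B_def tensor_bound_def sum_nonneg)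
  \<comment> \<open>The 7 bounds the source and 64 = 4 * 4^2 bounds 4 pi^2. The product
    \<open>B * K1\<close> controls the viscous term, using the velocity estimate just
    obtained.\<close>
  define K2 where "K2 = 7 + 64 * (B * K1)"
  have P_comp: "\<bar>real_of_int (\<xi> $ k)\<bar> * cmod (fourier_coeff p \<xi>) \<le> K2 * ?G \<xi>" for k \<xi>
  proof -
    let ?Z = "\<lambda>j \<beta>. (of_real (of_int (\<xi> $ j)) * ?U \<beta> \<xi> + of_real (of_int (\<xi> $ \<beta>)) * ?U j \<xi>) / 2"
    let ?L = "\<Sum>\<alpha>\<in>UNIV. of_real (of_int (\<xi> $ \<alpha>)) * (\<Sum>j\<in>UNIV. \<Sum>\<beta>\<in>UNIV. of_real (a k j \<alpha> \<beta>) * ?Z j \<beta>)"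
    let ?x = "\<lambda>i. \<bar>real_of_int (\<xi> $ i)\<bar>"
    let ?P = "of_real (of_int (\<xi> $ k)) * (2 * of_real pi * \<i> * fourier_coeff p \<xi>)"
    let ?w = "weight \<xi> powr (1/2)"
    have ww: "?w * ?w = weight \<xi>" using weight_pos[of \<xi>] by (simp add: powr_add[symmetric])
    have xU: "?x i * (?x j * cmod (?U m \<xi>)) \<le> K1 * ?G \<xi>" for i j m
    proof -
      have "?x i * (?x j * cmod (?U m \<xi>)) \<le> ?w * (?w * cmod (?U m \<xi>))"
        by (intro mult_mono abs_component_le_sqrt_weight) auto
      also have "\<dots> = weight \<xi> * cmod (?U m \<xi>)" by (simp only: mult.assoc[symmetric] ww)
      finally show ?thesis using U_est[of \<xi> m] by linarith
    qed
    have xZ: "?x \<alpha> * cmod (?Z j \<beta>) \<le> K1 * ?G \<xi>" for \<alpha> j \<beta>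
    proof -
      have "cmod (?Z j \<beta>) \<le> (?x j * cmod (?U \<beta> \<xi>) + ?x \<beta> * cmod (?U j \<xi>)) / 2"
        using norm_triangle_ineq[of "of_real (of_int (\<xi> $ j)) * ?U \<beta> \<xi>" "of_real (of_int (\<xi> $ \<beta>)) * ?U j \<xi>"]
        by (simp add: norm_mult norm_divide)
      then have "?x \<alpha> * cmod (?Z j \<beta>)
          \<le> ?x \<alpha> * ((?x j * cmod (?U \<beta> \<xi>) + ?x \<beta> * cmod (?U j \<xi>)) / 2)"
        by (intro mult_left_mono) auto
      also have "\<dots> = (?x \<alpha> * (?x j * cmod (?U \<beta> \<xi>))
          + ?x \<alpha> * (?x \<beta> * cmod (?U j \<xi>))) / 2"
        by (simp only: times_divide_eq_right distrib_left)
      also have "\<dots> \<le> (K1 * ?G \<xi> + K1 * ?G \<xi>) / 2"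
        by (intro divide_right_mono add_mono xU) auto
      finally show ?thesis by simp
    qed
    have L: "cmod ?L \<le> B * (K1 * ?G \<xi>)"
    proof -
      have "cmod ?L \<le> (\<Sum>\<alpha>\<in>UNIV. \<Sum>j\<in>UNIV. \<Sum>\<beta>\<in>UNIV. \<bar>a k j \<alpha> \<beta>\<bar> * (K1 * ?G \<xi>))"
      proof (rule sum_norm_le)
        fix \<alpha>
        have "cmod (of_real (of_int (\<xi> $ \<alpha>)) * (\<Sum>j\<in>UNIV. \<Sum>\<beta>\<in>UNIV. of_real (a k j \<alpha> \<beta>) * ?Z j \<beta>))
            = cmod (\<Sum>j\<in>UNIV. \<Sum>\<beta>\<in>UNIV. of_real (a k j \<alpha> \<beta>) * (of_real (of_int (\<xi> $ \<alpha>)) * ?Z j \<beta>))"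
          by (simp only: sum_distrib_left mult.left_commute)
        also have "\<dots> \<le> (\<Sum>j\<in>UNIV. \<Sum>\<beta>\<in>UNIV. \<bar>a k j \<alpha> \<beta>\<bar> * (K1 * ?G \<xi>))"
        proof (intro sum_norm_le)
          fix j \<beta>
          have "cmod (of_real (a k j \<alpha> \<beta>) * (of_real (of_int (\<xi> $ \<alpha>)) * ?Z j \<beta>))
              = \<bar>a k j \<alpha> \<beta>\<bar> * (?x \<alpha> * cmod (?Z j \<beta>))"
            by (simp only: norm_mult norm_of_real)
          also have "\<dots> \<le> \<bar>a k j \<alpha> \<beta>\<bar> * (K1 * ?G \<xi>)" by (intro mult_left_mono xZ) simp
          finally show "cmod (of_real (a k j \<alpha> \<beta>) * (of_real (of_int (\<xi> $ \<alpha>)) * ?Z j \<beta>)) \<le> \<bar>a k j \<alpha> \<beta>\<bar> * (K1 * ?G \<xi>)" .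
        qed
        finally show "cmod (of_real (of_int (\<xi> $ \<alpha>)) * (\<Sum>j\<in>UNIV. \<Sum>\<beta>\<in>UNIV. of_real (a k j \<alpha> \<beta>) * ?Z j \<beta>))
            \<le> (\<Sum>j\<in>UNIV. \<Sum>\<beta>\<in>UNIV. \<bar>a k j \<alpha> \<beta>\<bar> * (K1 * ?G \<xi>))" .
      qed
      also have "\<dots> = (\<Sum>\<alpha>\<in>UNIV. \<Sum>j\<in>UNIV. \<Sum>\<beta>\<in>UNIV. \<bar>a k j \<alpha> \<beta>\<bar>) * (K1 * ?G \<xi>)"
        by (simp only: sum_distrib_right)
      also have "\<dots> \<le> B * (K1 * ?G \<xi>)"
      proof (rule mult_right_mono)
        show "(\<Sum>\<alpha>\<in>UNIV. \<Sum>j\<in>UNIV. \<Sum>\<beta>\<in>UNIV. \<bar>a k j \<alpha> \<beta>\<bar>) \<le> B"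
          unfolding B_def tensor_bound_def
          by (rule member_le_sum[where f = "\<lambda>k. \<Sum>\<alpha>\<in>UNIV. \<Sum>j\<in>UNIV. \<Sum>\<beta>\<in>UNIV. \<bar>a k j \<alpha> \<beta>\<bar>"]) (auto intro: sum_nonneg)
        show "0 \<le> K1 * ?G \<xi>" using C(1) G0[of \<xi>] by (simp add: K1_def)
      qed
      finally show ?thesis .
    qed
    have "?P = ?H \<xi> k - 4 * of_real pi ^ 2 * ?L"
      using NS_fourier[OF NS u p, of \<xi> k] by (simp only: eq_diff_eq add.commute)
    then have "cmod (?P) \<le> cmod (?H \<xi> k) + cmod (4 * of_real pi ^ 2 * ?L)"
      by (simp only: norm_triangle_ineq4)
    also have "cmod (4 * of_real pi ^ 2 * ?L) \<le> 64 * (B * (K1 * ?G \<xi>))"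
    proof -
      have "pi ^ 2 \<le> 4 ^ 2" using pi_less_4 by (intro power_mono) auto
      then have "cmod (4 * of_real pi ^ 2) \<le> 64" by (simp add: norm_mult norm_power)
      then show ?thesis unfolding norm_mult[of "4 * of_real pi ^ 2"] by (intro mult_mono L) auto
    qed
    also have "cmod (?H \<xi> k) \<le> 7 * ?G \<xi>"
      using H[of \<xi>] member_le_sum[of k UNIV "\<lambda>k. cmod (?H \<xi> k)"] by simp
    finally have "cmod (?P) \<le> K2 * ?G \<xi>"
      by (simp add: K2_def algebra_simps)
    moreover have "cmod (?P)
        = 2 * pi * (?x k * cmod (fourier_coeff p \<xi>))"
      by (simp add: norm_mult)
    moreover have "1 * (?x k * cmod (fourier_coeff p \<xi>)) \<le> 2 * pi * (?x k * cmod (fourier_coeff p \<xi>))"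
      using pi_ge_two by (intro mult_right_mono) auto
    ultimately show ?thesis by linarith
  qed
  \<comment> \<open>Only the products of single frequency components with the pressure coefficient
    are controlled. Summing them costs the dimension, and the square root of the weight is at most
    twice the sum of the absolute components.\<close>
  define K3 where "K3 = real CARD('n) * 2 * K2"
  have K2_0: "0 \<le> K2" using C(1) B0 by (simp add: K2_def K1_def)
  have P_est: "weight \<xi> powr (1/2) * cmod (fourier_coeff p \<xi>) \<le> K3 * ?G \<xi>" for \<xi>
  proof (cases "\<xi> = 0")
    case True
    then show ?thesis using p0 G0[of \<xi>] K2_0 by (simp add: K3_def)
  next
    case False
    let ?A = "\<Sum>k\<in>UNIV. \<bar>real_of_int (\<xi> $ k)\<bar>"
    have "sqrt (weight \<xi>) \<le> 2 * ?A"
    proof (rule real_le_lsqrt)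
      have "weight \<xi> \<le> 2 * (\<Sum>i\<in>UNIV. (real_of_int (\<xi> $ i))\<^sup>2)" by (rule weight_le_sum_squares[OF False])
      also have "(\<Sum>i\<in>UNIV. (real_of_int (\<xi> $ i))\<^sup>2) \<le> (\<Sum>i\<in>UNIV. \<bar>real_of_int (\<xi> $ i)\<bar> * ?A)"
      proof (rule sum_mono)
        fix i
        have "\<bar>real_of_int (\<xi> $ i)\<bar> \<le> ?A" by (rule member_le_sum) auto
        from mult_left_mono[OF this, of "\<bar>real_of_int (\<xi> $ i)\<bar>"]
        show "(real_of_int (\<xi> $ i))\<^sup>2 \<le> \<bar>real_of_int (\<xi> $ i)\<bar> * ?A"
          by (simp add: power2_eq_square)
      qed
      also have "\<dots> = ?A\<^sup>2"
        by (simp only: sum_distrib_right[symmetric] power2_eq_square)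
      finally have "weight \<xi> \<le> 2 * ?A\<^sup>2" by simp
      also have "\<dots> \<le> (2 * ?A)\<^sup>2" by (simp add: power_mult_distrib)
      finally show "weight \<xi> \<le> (2 * ?A)\<^sup>2" .
    qed (simp add: sum_nonneg)
    then have "weight \<xi> powr (1/2) * cmod (fourier_coeff p \<xi>) \<le> 2 * ?A * cmod (fourier_coeff p \<xi>)"
      using weight_pos[of \<xi>] by (intro mult_right_mono) (simp_all add: powr_half_sqrt)
    also have "\<dots> = 2 * (\<Sum>k\<in>UNIV. \<bar>real_of_int (\<xi> $ k)\<bar> * cmod (fourier_coeff p \<xi>))"
      by (simp only: mult.assoc sum_distrib_right)
    also have "\<dots> \<le> 2 * (\<Sum>k\<in>(UNIV::'n set). K2 * ?G \<xi>)"
      by (intro mult_left_mono sum_mono P_comp) auto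
    also have "\<dots> = K3 * ?G \<xi>" by (simp add: K3_def)
    finally show ?thesis .
  qed
  have K0: "0 \<le> K1" "0 \<le> K3" using C(1) K2_0 by (simp_all add: K1_def K3_def)
  have "weight \<xi> * cmod (?U m \<xi>) \<le> (K1 + K3) * ?G \<xi>" for m \<xi>
    using U_est[of \<xi> m] mult_nonneg_nonneg[OF K0(2) G0[of \<xi>]] by (simp add: distrib_right)
  moreover have "weight \<xi> powr (1/2) * cmod (fourier_coeff p \<xi>) \<le> (K1 + K3) * ?G \<xi>" for \<xi>
    using P_est[of \<xi>] mult_nonneg_nonneg[OF K0(1) G0[of \<xi>]] by (simp add: distrib_right)
  ultimately show ?thesis by blast
qed

section \<open>Regularity\<close>

text \<open>The source has order r - 2: for f by assumption, for the convection term because u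
  \<otimes> u has order s - 1 + \<delta> \<ge> r - 1 and one derivative is lost. Keeping r apart
  from s + \<delta> lets the order of f cap the gain and also allows r = s.\<close>

lemma NS_regularity_step:
  fixes u :: "'n \<Rightarrow> 'n::finite distribution"
  assumes sym: "tensor_symmetric a" and ell: "relaxed_elliptic a"
    and NS: "NS_solution a u p f"
    and u: "\<And>k. u k \<in> distributions" and p: "p \<in> distributions"
    and div: "dist_div u =\<^sub>D (\<lambda>\<phi>. 0)"
    and zero: "\<And>k. fourier_coeff (u k) 0 = 0" "fourier_coeff p 0 = 0"
    and s: "0 \<le> s" "0 < \<delta>" "\<delta> \<le> 1" "s + 1 - \<delta> > real CARD('n) / 2" "r \<le> s + \<delta>"
    and us: "\<And>k. sobolev s (fourier_coeff (u k))"
    and fs: "\<And>k. sobolev (r - 2) (fourier_coeff (f k))"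
  shows "(\<forall>k. sobolev r (fourier_coeff (u k))) \<and> sobolev (r - 1) (fourier_coeff p)"
proof -
  let ?N = "\<lambda>\<xi>. \<Sum>(j, k)\<in>UNIV. cmod (fourier_coeff (dist_mult (u j) (u k)) \<xi>)"
  let ?G = "source_size u f"
  obtain K where K: "\<And>m \<xi>. weight \<xi> * cmod (fourier_coeff (u m) \<xi>) \<le> K * ?G \<xi>"
      "\<And>\<xi>. weight \<xi> powr (1/2) * cmod (fourier_coeff p \<xi>) \<le> K * ?G \<xi>"
    using NS_fourier_estimates[OF sym ell NS u p div zero] by blast
  have "sobolev (r - 1) (fourier_coeff (dist_mult (u j) (u k)))" for j k
    by (rule sobolev_mono[OF sobolev_dist_mult[OF u us u us s(1-4)]]) (use s(5) in simp)
  then have "sobolev (r - 1) (\<lambda>\<xi>. of_real (\<Sum>i\<in>UNIV. cmod (fourier_coeff (dist_mult (u (fst i)) (u (snd i))) \<xi>)))"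
    by (intro sobolev_sum_norm) auto
  then have "sobolev (r - 2) (\<lambda>\<xi>. of_real (weight \<xi> powr (1/2)) * of_real (?N \<xi>))"
    unfolding sobolev_weight_mult_iff by (simp add: case_prod_beta)
  then have G: "sobolev (r - 2) (\<lambda>\<xi>. of_real (?G \<xi>))"
    unfolding source_size_def of_real_add of_real_mult[of "weight _ powr (1/2)"]
    by (intro sobolev_add sobolev_sum_norm fs) auto
  have "sobolev (r - 2) (\<lambda>\<xi>. of_real (weight \<xi> powr 1) * fourier_coeff (u m) \<xi>)" for m
    by (rule sobolev_dominated[OF G order_refl, where K = K])
      (simp add: K(1) norm_mult source_size_nonneg abs_of_pos[OF weight_pos])
  moreover have "sobolev (r - 2) (\<lambda>\<xi>. of_real (weight \<xi> powr (1/2)) * fourier_coeff p \<xi>)"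
    by (rule sobolev_dominated[OF G order_refl, where K = K])
      (simp add: K(2) norm_mult source_size_nonneg)
  ultimately show ?thesis unfolding sobolev_weight_mult_iff by simp
qed

text \<open>The right-hand side enters through its coefficients and the equation only, so the same
  statement serves Sobolev and smooth data.\<close>

lemma NS_regularity:
  fixes u :: "'n \<Rightarrow> 'n::finite distribution"
  assumes card: "CARD('n) \<ge> 2" and sym: "tensor_symmetric a" and ell: "relaxed_elliptic a"
    and s: "s\<^sub>1 > - 1 + real CARD('n) / 2" "s\<^sub>2 > s\<^sub>1"
    and u: "u \<in> vec_H_dot_sigma s\<^sub>1" and p: "p \<in> H_dot (s\<^sub>1 - 1)"
    and f: "\<And>k. sobolev (s\<^sub>2 - 2) (fourier_coeff (f k))"
    and NS: "NS_solution a u p f"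
  shows "u \<in> vec_H_dot_sigma s\<^sub>2 \<and> p \<in> H_dot (s\<^sub>2 - 1)"
proof -
  have ud: "\<And>k. u k \<in> distributions" and us: "\<And>k. sobolev s\<^sub>1 (fourier_coeff (u k))"
    and u0: "\<And>k. fourier_coeff (u k) 0 = 0" and div: "dist_div u =\<^sub>D (\<lambda>\<phi>. 0)"
    using u by (auto simp: vec_H_dot_sigma_def vec_H_dot_def H_dot_def H_per_iff)
  have pd: "p \<in> distributions" and p0: "fourier_coeff p 0 = 0"
    using p by (auto simp: H_dot_def H_per_iff)
  \<comment> \<open>Half of the margin above the critical order n/2 - 1 keeps the summability
    condition strict; the cap at 1 is required by the product estimate.\<close>
  define \<delta> where "\<delta> = min 1 ((s\<^sub>1 + 1 - real CARD('n) / 2) / 2)"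
  \<comment> \<open>Here n \<ge> 2 enters: the velocity is square-integrable from the start, so the
    pointwise product is meaningful.\<close>
  have s1: "0 \<le> s\<^sub>1" using s(1) card by simp
  have \<delta>: "0 < \<delta>" "\<delta> \<le> 1" "s\<^sub>1 + 1 - \<delta> > real CARD('n) / 2"
    using s(1) by (auto simp: \<delta>_def min_def field_simps)
  note step = NS_regularity_step[OF sym ell NS ud pd div u0 p0]
  have iter: "\<forall>k. sobolev (min (s\<^sub>1 + real m * \<delta>) s\<^sub>2) (fourier_coeff (u k))" for m
  proof (induction m)
    case 0
    then show ?case using us s(2) by simp
  next
    case (Suc m)
    let ?s = "min (s\<^sub>1 + real m * \<delta>) s\<^sub>2" and ?r = "min (s\<^sub>1 + real (Suc m) * \<delta>) s\<^sub>2"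
    have ge: "s\<^sub>1 \<le> ?s" using s(2) \<delta>(1) by simp
    have "(\<forall>k. sobolev ?r (fourier_coeff (u k))) \<and> sobolev (?r - 1) (fourier_coeff p)"
    proof (rule step[where s = ?s and \<delta> = \<delta>])
      show "0 \<le> ?s" "?s + 1 - \<delta> > real CARD('n) / 2" using ge s1 \<delta>(3) by linarith+
      show "?r \<le> ?s + \<delta>" using \<delta>(1) by (auto simp: min_def algebra_simps)
      show "sobolev ?s (fourier_coeff (u k))" for k using Suc by blast
      show "sobolev (?r - 2) (fourier_coeff (f k))" for k by (rule sobolev_mono[OF f]) simp
    qed (fact \<delta>)+
    then show ?case by blast
  qed
  obtain m :: nat where "(s\<^sub>2 - s\<^sub>1) / \<delta> < real m" using reals_Archimedean2 by blast
  then have "s\<^sub>2 \<le> s\<^sub>1 + real m * \<delta>" using \<delta>(1) by (simp add: field_simps)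
  then have us2: "sobolev s\<^sub>2 (fourier_coeff (u k))" for k using iter[of m] by (simp add: min_absorb2)
  \<comment> \<open>The iteration records the velocity alone. One further pass with both orders
    equal to the target yields the pressure.\<close>
  have "(\<forall>k. sobolev s\<^sub>2 (fourier_coeff (u k))) \<and> sobolev (s\<^sub>2 - 1) (fourier_coeff p)"
    by (rule step[where s = s\<^sub>2 and \<delta> = \<delta>]) (use s1 s(2) \<delta> us2 f in auto)
  then show ?thesis
    using ud pd u0 p0 div by (auto simp: vec_H_dot_sigma_def vec_H_dot_def H_dot_def H_per_iff)
qed

section \<open>Smooth right-hand sides\<close>

lemma rapid_imp_sobolev:
  fixes c :: "int ^ 'n \<Rightarrow> complex"
  assumes "rapid c"
  shows "sobolev s c"
proof -
  obtain m :: nat where m: "s < real m" using reals_Archimedean2 by blast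
  define B where "B = (\<Sum>\<^sub>\<infinity>\<xi>. cmod (c \<xi>))"
  have B: "cmod (c \<xi>) \<le> B" for \<xi>
    using finite_sum_le_infsum[OF rapid_abs_summable[OF assms], of "{\<xi>}"] by (simp add: B_def)
  have "(\<lambda>\<xi>. B * (weight \<xi> ^ m * cmod (c \<xi>))) summable_on UNIV"
    using assms unfolding rapid_def by (intro summable_on_cmult_right) blast
  then show ?thesis
    unfolding sobolev_def
  proof (rule summable_on_comparison_test)
    fix \<xi> :: "int ^ 'n"
    have "weight \<xi> powr s \<le> weight \<xi> powr real m" using weight_ge_1[of \<xi>] m by (intro powr_mono) auto
    then have "weight \<xi> powr s \<le> weight \<xi> ^ m" using weight_pos[of \<xi>] by (simp add: powr_realpow)
    then have "weight \<xi> powr s * (cmod (c \<xi>) * cmod (c \<xi>)) \<le> weight \<xi> ^ m * (B * cmod (c \<xi>))"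
      using weight_pos[of \<xi>] by (intro mult_mono B mult_right_mono) auto
    then show "weight \<xi> powr s * (cmod (c \<xi>))\<^sup>2 \<le> B * (weight \<xi> ^ m * cmod (c \<xi>))"
      by (simp add: power2_eq_square mult_ac)
  qed simp
qed

text \<open>A single term of the summable family of order 2m already bounds the weight to the power
  m times the coefficient, so all orders together give decay of every order.\<close>

lemma sobolev_all_imp_rapid:
  fixes c :: "int ^ 'n \<Rightarrow> complex"
  assumes "\<And>s. sobolev s c"
  shows "rapid c"
proof (rule rapidI)
  fix m
  obtain P where P: "\<And>X. finite X \<Longrightarrow> (\<Sum>\<xi>\<in>X. weight \<xi> powr (real (2 * m)) * (cmod (c \<xi>))\<^sup>2) \<le> P"
    using sobolev_finite_bound[OF assms] by blast
  have "weight \<xi> ^ m * cmod (c \<xi>) \<le> sqrt P" for \<xi> :: "int ^ 'n"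
  proof (rule real_le_rsqrt)
    have "weight \<xi> powr (real (2 * m)) = (weight \<xi> ^ m)\<^sup>2"
      using weight_pos[of \<xi>] by (simp only: powr_realpow power_mult[symmetric] mult.commute)
    then show "(weight \<xi> ^ m * cmod (c \<xi>))\<^sup>2 \<le> P"
      using P[of "{\<xi>}"] by (simp add: power_mult_distrib)
  qed
  then show "\<exists>K. \<forall>\<xi>. weight \<xi> ^ m * cmod (c \<xi>) \<le> K" by blast
qed

lemma dist_Cinf_dotI:
  assumes "\<And>s. T \<in> H_dot s"
  shows "T \<in> dist_Cinf_dot"
proof -
  let ?c = "fourier_coeff T"
  have T: "T \<in> distributions" "?c 0 = 0" and "\<And>s. sobolev s ?c"
    using assms by (auto simp: H_dot_def H_per_iff)
  then have r: "rapid ?c" by (intro sobolev_all_imp_rapid)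
  note g = fourier_series_Cinf[OF r]
  have "T =\<^sub>D dist_of (fourier_series ?c)"
    by (intro distribution_eqI T(1) dist_of_distributions Cinf_integrable g)
      (simp add: fourier_coeff_fourier_series[OF r])
  moreover have "(LINT x:torus|lborel. fourier_series ?c x) = 0"
    using fourier_coeff_fourier_series[OF r, of 0] T(2)
    by (simp add: set_integral_torus fourier_coeff_dist_of)
  ultimately show ?thesis using g by (auto simp: dist_Cinf_dot_def Cinf_dot_def)
qed

lemma sobolev_dist_Cinf_dot:
  assumes "T \<in> dist_Cinf_dot"
  shows "sobolev s (fourier_coeff T)"
proof -
  obtain g where g: "g \<in> Cinf" "T =\<^sub>D dist_of g"
    using assms by (auto simp: dist_Cinf_dot_def Cinf_dot_def)
  have "fourier_coeff T \<xi> = fourier_coeff (dist_of g) \<xi>" for \<xi>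
    using g(2) wave_Cinf[of "- \<xi>"] by (simp add: fourier_coeff_eq dist_eq_def)
  then have "fourier_coeff T = fourier_coeff (dist_of g)" by (rule ext)
  then show ?thesis using rapid_imp_sobolev[OF rapid_fourier_coeff_Cinf[OF g(1)]] by simp
qed

theorem theorem6p3:
  fixes a :: "'n::finite tensor"
  assumes "CARD('n) \<ge> 2"
    and "tensor_symmetric a"
    and "relaxed_elliptic a"
  shows "(\<forall>s\<^sub>1 s\<^sub>2 u p f.
            s\<^sub>1 > - 1 + real CARD('n) / 2 \<longrightarrow> s\<^sub>2 > s\<^sub>1 \<longrightarrow>
            u \<in> vec_H_dot_sigma s\<^sub>1 \<longrightarrow> p \<in> H_dot (s\<^sub>1 - 1) \<longrightarrow>
            f \<in> vec_H_dot (s\<^sub>2 - 2) \<longrightarrow> NS_solution a u p f \<longrightarrow>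
            u \<in> vec_H_dot_sigma s\<^sub>2 \<and> p \<in> H_dot (s\<^sub>2 - 1))
       \<and> (\<forall>s\<^sub>1 u p f.
            s\<^sub>1 > - 1 + real CARD('n) / 2 \<longrightarrow>
            u \<in> vec_H_dot_sigma s\<^sub>1 \<longrightarrow> p \<in> H_dot (s\<^sub>1 - 1) \<longrightarrow>
            f \<in> vec_dist_Cinf_dot \<longrightarrow> NS_solution a u p f \<longrightarrow>
            u \<in> vec_dist_Cinf_dot \<and> p \<in> dist_Cinf_dot)"
proof (intro conjI allI impI)
  fix s\<^sub>1 s\<^sub>2 :: real and u f :: "'n \<Rightarrow> 'n distribution" and p :: "'n distribution"
  assume *: "s\<^sub>1 > - 1 + real CARD('n) / 2" "s\<^sub>2 > s\<^sub>1" "u \<in> vec_H_dot_sigma s\<^sub>1" "p \<in> H_dot (s\<^sub>1 - 1)"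
    and f: "f \<in> vec_H_dot (s\<^sub>2 - 2)" and NS: "NS_solution a u p f"
  have "sobolev (s\<^sub>2 - 2) (fourier_coeff (f k))" for k
    using f by (simp add: vec_H_dot_def H_dot_def H_per_iff)
  from NS_regularity[OF assms * this NS]
  show "u \<in> vec_H_dot_sigma s\<^sub>2" "p \<in> H_dot (s\<^sub>2 - 1)" by auto
next
  fix s\<^sub>1 :: real and u f :: "'n \<Rightarrow> 'n distribution" and p :: "'n distribution"
  assume s1: "s\<^sub>1 > - 1 + real CARD('n) / 2" and up: "u \<in> vec_H_dot_sigma s\<^sub>1" "p \<in> H_dot (s\<^sub>1 - 1)"
    and f: "f \<in> vec_dist_Cinf_dot" and NS: "NS_solution a u p f"
  have fs: "sobolev s (fourier_coeff (f k))" for k s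
    using f by (intro sobolev_dist_Cinf_dot) (simp add: vec_dist_Cinf_dot_def)
  \<comment> \<open>The target order must exceed the initial one, so the maximum with the initial
    order plus 1 is used and the result is weakened to order s afterwards.\<close>
  have reg: "u \<in> vec_H_dot_sigma (max s (s\<^sub>1 + 1)) \<and> p \<in> H_dot (max s (s\<^sub>1 + 1) - 1)" for s
    by (rule NS_regularity[OF assms s1 _ up fs NS]) simp
  have mono: "T \<in> H_dot r" if "T \<in> H_dot s" "r \<le> s" for T :: "'n distribution" and r s
    using that sobolev_mono by (auto simp: H_dot_def H_per_iff)
  have "u k \<in> H_dot s" for k s
    using reg[of s] by (intro mono[of "u k" "max s (s\<^sub>1 + 1)" s]) (auto simp: vec_H_dot_sigma_def vec_H_dot_def)
  then show "u \<in> vec_dist_Cinf_dot"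
    by (simp add: vec_dist_Cinf_dot_def dist_Cinf_dotI)
  have "p \<in> H_dot s" for s
    using reg[of "s + 1"] by (intro mono[of p "max (s + 1) (s\<^sub>1 + 1) - 1" s]) auto
  then show "p \<in> dist_Cinf_dot" by (rule dist_Cinf_dotI)
qed

end
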